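(* Let $\mathbb{K}$, $\mathcal{S}$, $V_1^L,V_2^L$ and ${\rm mult}(\mathscr{B}(\mathcal{S}))$ be as in the context. For every projective transformation $L$ of $\mathbb{P}^2(\mathbb{K})$, $${\rm mult}(\mathscr{B}(\mathcal{S}))=\deg_{\overline t}\Big({\rm Content}_{\{\overline x,\overline y\}}\big({\rm Res}_{t_3}(V_1^L,V_2^L)\big)\Big).$$
   Context: $\mathbb{K}$ is an algebraically closed field of characteristic zero. $\mathcal{S}=(s_1:s_2:s_3):\mathbb{P}^2(\mathbb{K})\dashrightarrow\mathbb{P}^2(\mathbb{K})$ is a dominant rational map, $s_i\in\mathbb{K}[t_1,t_2,t_3]$ homogeneous of the same degree, $\gcd(s_1,s_2,s_3)=1$, and $s_i(0,0,1)\neq0$ for $i=1,2,3$. $\mathscr{B}(\mathcal{S})$ is the set of common zeros of $s_1,s_2,s_3$ in $\mathbb{P}^2(\mathbb{K})$. With indeterminates $\overline x=(x_1,x_2,x_3)$, $\overline y=(y_1,y_2,y_3)$ and $\mathbb{F}$ the algebraic closure of $\mathbb{K}(\overline x,\overline y)$, let $V_1=\sum x_is_i$, $V_2=\sum y_is_i$ and ${\rm mult}(\mathscr{B}(\mathcal{S}))=\sum_{A\in\mathscr{B}(\mathcal{S})}{\rm mult}_A(\mathscr{C}(V_1),\mathscr{C}(V_2))$ (intersection multiplicities of the plane curves in $\mathbb{P}^2(\mathbb{F})$). For a projective transformation $L=(L_1:L_2:L_3)$ of $\mathbb{P}^2(\mathbb{K})$, $V_1^L=\sum_i x_iL_i(s_1,s_2,s_3)$,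 $V_2^L=\sum_i y_iL_i(s_1,s_2,s_3)$. ${\rm Res}_{t_3}$ is the resultant w.r.t. $t_3$; ${\rm Content}_{\{\overline x,\overline y\}}(R)$ is the gcd in $\mathbb{K}[t_1,t_2]$ of the coefficients of $R$ as a polynomial in $\overline x,\overline y$ (up to a nonzero constant); $\deg_{\overline t}$ is the degree in $t_1,t_2$. *)

theory Defs
  imports "Subresultants.Resultant_Prelim"
          "HOL-Algebra.Algebraic_Closure_Type"
          "HOL-Computational_Algebra.Fraction_Field"
          "HOL-Library.Extended_Nat"
begin

text \<open>
  Polynomials in t1,t2,t3 are nested univariate polynomials of type
  'c poly poly poly: the innermost variable is t1, the middle one t2,
  the outermost one t3.  Thus Polynomial.coeff (Polynomial.coeff (Polynomial.coeff s k) j) i is the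
  coefficient of t1^i t2^j t3^k.  Polynomials in t1,t2 are 'c poly poly
  (t1 inner, t2 outer).

  Polynomials in the six indeterminates x1,x2,x3,y1,y2,y3 over a
  coefficient ring 'c are 'c poly poly poly poly poly poly, with layers
  (innermost to outermost) x1,x2,x3,y1,y2,y3; var6 1..3 are x1..x3 and
  var6 4..6 are y1..y3.
\<close>

type_synonym 'c poly6 = "'c poly poly poly poly poly poly"

definition const6 :: "'c::zero \<Rightarrow> 'c poly6" where
  "const6 c = [:[:[:[:[:[:c:]:]:]:]:]:]"

definition var6 :: "nat \<Rightarrow> 'c::comm_ring_1 poly6" where
  "var6 k =
     (if k = 1 then [:[:[:[:[:Polynomial.monom 1 1:]:]:]:]:]
      else if k = 2 then [:[:[:[:Polynomial.monom 1 1:]:]:]:]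
      else if k = 3 then [:[:[:Polynomial.monom 1 1:]:]:]
      else if k = 4 then [:[:Polynomial.monom 1 1:]:]
      else if k = 5 then [:Polynomial.monom 1 1:]
      else if k = 6 then Polynomial.monom 1 1
      else 0)"

definition ev3 :: "'c::comm_semiring_1 poly poly poly \<Rightarrow> 'c \<times> 'c \<times> 'c \<Rightarrow> 'c" where
  "ev3 s p = (case p of (a1, a2, a3) \<Rightarrow> poly (poly (poly s [:[:a3:]:]) [:a2:]) a1)"

definition hom3 :: "nat \<Rightarrow> 'c::zero poly poly poly \<Rightarrow> bool" where
  "hom3 d s \<longleftrightarrow> (\<forall>i j k. Polynomial.coeff (Polynomial.coeff (Polynomial.coeff s k) j) i \<noteq> 0 \<longrightarrow> i + j + k = d)"

definition const3 :: "'c::zero \<Rightarrow> 'c poly poly poly" where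
  "const3 c = [:[:[:c:]:]:]"

text \<open>Dominance of S = (s1:s2:s3): the image is Zariski dense in P^2, i.e. it is not
  contained in any curve G = 0 with G a nonzero homogeneous form; equivalently
  G(s1,s2,s3) is not the zero polynomial for every nonzero homogeneous G.\<close>
definition dominant3 :: "(nat \<Rightarrow> 'c::comm_ring_1 poly poly poly) \<Rightarrow> bool" where
  "dominant3 s \<longleftrightarrow>
     (\<forall>G :: 'c poly poly poly. \<forall>e. G \<noteq> 0 \<longrightarrow> hom3 e G \<longrightarrow>
        ev3 (map_poly (map_poly (map_poly const3)) G) (s 1, s 2, s 3) \<noteq> 0)"

definition pclass :: "'c::field \<times> 'c \<times> 'c \<Rightarrow> ('c \<times> 'c \<times> 'c) set" where
  "pclass p = (case p of (a1, a2, a3) \<Rightarrow> {(c * a1, c * a2, c * a3) | c. c \<noteq> 0})"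

definition base_points :: "(nat \<Rightarrow> 'c::field poly poly poly) \<Rightarrow> ('c \<times> 'c \<times> 'c) set set" where
  "base_points s = {pclass a | a. a \<noteq> (0, 0, 0) \<and> (\<forall>i\<in>{1,2,3}. ev3 (s i) a = 0)}"

text \<open>h lies in the ideal generated by f,g in the local ring of the affine plane at (a,b)
  (a is the value of the inner variable, b of the outer one).\<close>
definition in_loc_ideal :: "'c::field poly poly \<Rightarrow> 'c poly poly \<Rightarrow> 'c \<Rightarrow> 'c \<Rightarrow> 'c poly poly \<Rightarrow> bool" where
  "in_loc_ideal f g a b h \<longleftrightarrow>
     (\<exists>q u v. poly (poly q [:b:]) a \<noteq> 0 \<and> q * h = u * f + v * g)"

text \<open>Affine intersection multiplicity: dimension over the ground field of O_P / (f,g),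
  where O_P is the local ring at P = (a,b).  It is the supremum of the sizes of families
  of polynomials whose classes in O_P/(f,g) are linearly independent (the classes of
  polynomials span O_P/(f,g) whenever the latter is finite dimensional).\<close>
definition aff_imult :: "'c::field poly poly \<Rightarrow> 'c poly poly \<Rightarrow> 'c \<Rightarrow> 'c \<Rightarrow> enat" where
  "aff_imult f g a b =
     Sup {enat n | n. \<exists>h :: nat \<Rightarrow> 'c poly poly.
            \<forall>c :: nat \<Rightarrow> 'c. in_loc_ideal f g a b (\<Sum>i<n. smult [:c i:] (h i)) \<longrightarrow>
                             (\<forall>i<n. c i = 0)}"

text \<open>Intersection multiplicity at a point (p1:p2:p3) of P^2 of the projective curves
  f = 0, g = 0 (f,g homogeneous in t1,t2,t3), computed in an affine chart containing
  the point (dehomogenizing w.r.t. a coordinate that does not vanish at the point).\<close>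
definition proj_imult :: "'c::field poly poly poly \<Rightarrow> 'c poly poly poly \<Rightarrow> 'c \<times> 'c \<times> 'c \<Rightarrow> enat" where
  "proj_imult f g p = (case p of (p1, p2, p3) \<Rightarrow>
     if p3 \<noteq> 0 then aff_imult (poly f 1) (poly g 1) (p1 / p3) (p2 / p3)
     else if p2 \<noteq> 0 then
       aff_imult (map_poly (\<lambda>c. poly c 1) f) (map_poly (\<lambda>c. poly c 1) g) (p1 / p2) (p3 / p2)
     else
       aff_imult (map_poly (map_poly (\<lambda>c. poly c 1)) f) (map_poly (map_poly (\<lambda>c. poly c 1)) g)
         (p2 / p1) (p3 / p1))"

type_synonym 'a FF = "'a poly6 fract alg_closure"

definition embK :: "'a::field \<Rightarrow> 'a FF" where
  "embK a = to_ac (Fract (const6 a) 1)"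

definition indetF :: "nat \<Rightarrow> 'a::field FF" where
  "indetF k = to_ac (Fract (var6 k) 1)"

definition V1F :: "(nat \<Rightarrow> 'a::field poly poly poly) \<Rightarrow> 'a FF poly poly poly" where
  "V1F s = (\<Sum>i\<in>{1,2,3}. smult [:[:indetF i:]:] (map_poly (map_poly (map_poly embK)) (s i)))"

definition V2F :: "(nat \<Rightarrow> 'a::field poly poly poly) \<Rightarrow> 'a FF poly poly poly" where
  "V2F s = (\<Sum>i\<in>{1,2,3}. smult [:[:indetF (i + 3):]:] (map_poly (map_poly (map_poly embK)) (s i)))"

definition embK3 :: "'a::field \<times> 'a \<times> 'a \<Rightarrow> 'a FF \<times> 'a FF \<times> 'a FF" where
  "embK3 p = (case p of (a1, a2, a3) \<Rightarrow> (embK a1, embK a2, embK a3))"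

definition mult_base :: "(nat \<Rightarrow> 'a::field poly poly poly) \<Rightarrow> enat" where
  "mult_base s = (\<Sum>A\<in>base_points s. proj_imult (V1F s) (V2F s) (embK3 (SOME a. a \<in> A)))"

text \<open>V1^L, V2^L as polynomials in t3 with coefficients in K[t1,t2][x,y]
  (type ('a poly poly) poly6 poly; the outermost variable is t3).
  The projective transformation L is given by the matrix l (indices 1..3):
  L_i(s1,s2,s3) = sum_j l i j * s_j.\<close>
definition Lform :: "(nat \<Rightarrow> nat \<Rightarrow> 'a::comm_ring_1) \<Rightarrow> (nat \<Rightarrow> 'a poly poly poly) \<Rightarrow> nat \<Rightarrow> 'a poly poly poly" where
  "Lform l s i = (\<Sum>j\<in>{1,2,3}. smult [:[:l i j:]:] (s j))"

definition V1L :: "(nat \<Rightarrow> nat \<Rightarrow> 'a::comm_ring_1) \<Rightarrow> (nat \<Rightarrow> 'a poly poly poly) \<Rightarrow> 'a poly poly poly6 poly" where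
  "V1L l s = (\<Sum>i\<in>{1,2,3}. [:var6 i:] * map_poly const6 (Lform l s i))"

definition V2L :: "(nat \<Rightarrow> nat \<Rightarrow> 'a::comm_ring_1) \<Rightarrow> (nat \<Rightarrow> 'a poly poly poly) \<Rightarrow> 'a poly poly poly6 poly" where
  "V2L l s = (\<Sum>i\<in>{1,2,3}. [:var6 (i + 3):] * map_poly const6 (Lform l s i))"

definition det3 :: "(nat \<Rightarrow> nat \<Rightarrow> 'a::comm_ring_1) \<Rightarrow> 'a" where
  "det3 l = l 1 1 * (l 2 2 * l 3 3 - l 2 3 * l 3 2)
          - l 1 2 * (l 2 1 * l 3 3 - l 2 3 * l 3 1)
          + l 1 3 * (l 2 1 * l 3 2 - l 2 2 * l 3 1)"

definition coeffs6 :: "'c::zero poly6 \<Rightarrow> 'c set" where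
  "coeffs6 R = {Polynomial.coeff (Polynomial.coeff (Polynomial.coeff (Polynomial.coeff (Polynomial.coeff (Polynomial.coeff R a) b) c) d) e) f | a b c d e f. True}"

text \<open>Content w.r.t. x,y: a gcd in K[t1,t2] of all these coefficients
  (determined up to a nonzero constant factor).\<close>
definition is_gcd_of :: "'c::comm_semiring_1 set \<Rightarrow> 'c \<Rightarrow> bool" where
  "is_gcd_of C c \<longleftrightarrow> (\<forall>x\<in>C. c dvd x) \<and> (\<forall>e. (\<forall>x\<in>C. e dvd x) \<longrightarrow> e dvd c)"

definition content_xy :: "'a::field poly poly poly6 \<Rightarrow> 'a poly poly" where
  "content_xy R = (SOME c. is_gcd_of (coeffs6 R) c)"

definition tdeg2 :: "'c::zero poly poly \<Rightarrow> nat" where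
  "tdeg2 c = Max ({i + j | i j. Polynomial.coeff (Polynomial.coeff c j) i \<noteq> 0} \<union> {0})"

end

(*
  Dehomogenize along a line through the centre of projection (0:0:1). The fibre of the local
  intersection ring over this line is the cokernel of the Sylvester matrix, localized at the line,
  so its dimension is the order of the resultant there; by the Chinese remainder theorem it is also
  the sum of the intersection multiplicities of the points on the line. On lines defined over the
  ground field, all common points of the two generic members are base points, and the order
  of the resultant is the multiplicity of the line in the content, because the indeterminates are
  algebraically independent. A linear substitution of the indeterminates absorbs L.
*)
theory Submission
  imports Defs "Berlekamp_Zassenhaus.Unique_Factorization_Poly"
begin

text \<open>Since no \<open>s i\<close> vanishes at (0:0:1), the top coefficient in t3 of each
  generic member is a nonzero constant. This enters three times. It lets division by one member
  bound degrees, so that the quotient along a line becomes a cokernel of the Sylvester matrix; it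
  keeps degrees, hence resultants, stable under the substitutions; and it keeps the centre out of
  the base locus, so that every base point lies on exactly one line through the centre. The
  resultant over \<open>'a FF\<close> may have further zeros, at lines not defined over the ground
  field, but the content has coefficients in an algebraically closed field and splits into ground
  field lines, so only these have to be examined. The line t2 = 0 is invisible after t2 := 1 and is
  treated separately with t1 := 1. That the resultant does not vanish is seen by specializing the
  two members to s1 and s1 + x s2 + x^2 s3: for all but finitely many x no irreducible polynomial
  divides both, and a field of characteristic zero is infinite.\<close>

hide_const (open) Polynomials.lead_coeff Polynomials.degree Coset.order up_ring.coeff up_ring.monom
  Divisibility.irreducible

subsection \<open>Relative dimension of subspaces\<close>

locale relative_dimension = vector_space scale
  for scale :: "'k::field \<Rightarrow> 'b::ab_group_add \<Rightarrow> 'b"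
begin

definition indep_mod :: "'b set \<Rightarrow> nat \<Rightarrow> (nat \<Rightarrow> 'b) \<Rightarrow> bool" where
  "indep_mod W n h \<longleftrightarrow> (\<forall>c. (\<Sum>i<n. scale (c i) (h i)) \<in> W \<longrightarrow> (\<forall>i<n. c i = 0))"

text \<open>For subspaces with \<open>W\<close> inside \<open>V\<close> this is the dimension of
  V/W, phrased without quotient spaces. The shape is that of \<open>aff_imult\<close>, so
  intersection multiplicities become instances by unfolding.\<close>

definition reldim :: "'b set \<Rightarrow> 'b set \<Rightarrow> enat" where
  "reldim V W = Sup {enat n | n. \<exists>h. (\<forall>i<n. h i \<in> V) \<and> indep_mod W n h}"

lemma indep_mod_basis:
  assumes B: "independent B" and AB: "A \<subseteq> B"
    and bij: "bij_betw h {..<n} C" and C: "C \<subseteq> B - A"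
  shows "indep_mod (span A) n h"
  unfolding indep_mod_def
proof (intro allI impI)
  fix c i assume x: "(\<Sum>i<n. scale (c i) (h i)) \<in> span A" and i: "i < n"
  show "c i = 0"
  proof (rule ccontr)
    assume ci: "c i \<noteq> 0"
    have hi: "h i \<in> C" using bij i by (auto simp: bij_betw_def)
    have sub: "A \<subseteq> B - {h i}" using hi C AB by auto
    have "h j \<in> B - {h i}" if "j \<in> {..<n} - {i}" for j
      using that bij C i by (auto simp: bij_betw_def inj_on_def)
    then have rest: "(\<Sum>j\<in>{..<n}-{i}. scale (c j) (h j)) \<in> span (B - {h i})"
      by (intro span_sum span_scale span_base)
    have "(\<Sum>j<n. scale (c j) (h j)) = scale (c i) (h i) + (\<Sum>j\<in>{..<n}-{i}. scale (c j) (h j))"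
      using i by (subst sum.remove[of _ i]) auto
    then have eq: "scale (c i) (h i) = (\<Sum>j<n. scale (c j) (h j)) - (\<Sum>j\<in>{..<n}-{i}. scale (c j) (h j))"
      by simp
    have "scale (c i) (h i) \<in> span (B - {h i})"
      unfolding eq using x rest span_mono[OF sub] by (intro span_diff) auto
    then have "scale (inverse (c i)) (scale (c i) (h i)) \<in> span (B - {h i})"
      by (rule span_scale)
    then have "h i \<in> span (B - {h i})" using ci by simp
    then show False using B hi C unfolding dependent_def by blast
  qed
qed

text \<open>Split each \<open>h i\<close> into a part in \<open>span A\<close> and a part
  \<open>b i\<close> in \<open>span D\<close>. A linear relation among the \<open>b i\<close> puts
  the same combination of the \<open>h i\<close> into \<open>span A\<close>, so the
  \<open>b i\<close> are independent in a space spanned by \<open>card D\<close> vectors.\<close>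

lemma indep_mod_le_card:
  assumes fin: "finite D" and V: "V \<subseteq> span (A \<union> D)"
    and h: "\<forall>i<n. h i \<in> V" and ind: "indep_mod (span A) n h"
  shows "n \<le> card D"
proof -
  have "\<exists>a b. a \<in> span A \<and> b \<in> span D \<and> h i = a + b" if "i < n" for i
  proof -
    have "h i \<in> span (A \<union> D)" using h V that by auto
    then show ?thesis unfolding span_Un by blast
  qed
  then obtain a b where ab: "\<And>i. i < n \<Longrightarrow> a i \<in> span A \<and> b i \<in> span D \<and> h i = a i + b i"
    by metis
  have zero: "c i = 0" if "(\<Sum>i<n. scale (c i) (b i)) = 0" "i < n" for c i
  proof -
    have "(\<Sum>i<n. scale (c i) (h i)) = (\<Sum>i<n. scale (c i) (a i)) + (\<Sum>i<n. scale (c i) (b i))"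
      unfolding sum.distrib[symmetric] by (rule sum.cong) (auto simp: ab scale_right_distrib)
    also have "\<dots> \<in> span A" using that(1) ab by (auto intro!: span_sum span_scale)
    finally show ?thesis using ind that(2) unfolding indep_mod_def by blast
  qed
  have inj: "inj_on b {..<n}"
  proof (rule inj_onI, rule ccontr)
    fix i j assume ij: "i \<in> {..<n}" "j \<in> {..<n}" "b i = b j" "i \<noteq> j"
    \<comment> \<open>Two equal values would satisfy the relation with coefficients 1 and -1.
      Injectivity matters because \<open>independent\<close> speaks about the set of values.\<close>
    define c where "c = (\<lambda>k. if k = i then 1 else if k = j then - 1 else 0 :: 'k)"
    have "(\<Sum>k<n. scale (c k) (b k)) = (\<Sum>k\<in>{i,j}. scale (c k) (b k))"
      using ij by (intro sum.mono_neutral_right) (auto simp: c_def)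
    also have "\<dots> = 0" using ij by (simp add: c_def)
    finally have "c i = 0" using zero ij by auto
    then show False by (simp add: c_def)
  qed
  have "independent (b ` {..<n})"
  proof (rule independent_if_scalars_zero)
    fix f x assume s: "(\<Sum>x\<in>b ` {..<n}. scale (f x) x) = 0" and x: "x \<in> b ` {..<n}"
    have "(\<Sum>i<n. scale (f (b i)) (b i)) = 0" using s by (simp add: sum.reindex[OF inj])
    then show "f x = 0" using zero[of "f \<circ> b"] x by auto
  qed simp
  moreover have "b ` {..<n} \<subseteq> span D" using ab by auto
  ultimately have "card (b ` {..<n}) \<le> card D" using independent_span_bound[OF fin] by blast
  then show ?thesis by (simp add: card_image[OF inj])
qed

lemma reldim_basis:
  assumes B: "independent B" and AB: "A \<subseteq> B"
  shows "reldim (span B) (span A) = (if finite (B - A) then enat (card (B - A)) else \<infinity>)"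
proof -
  let ?S = "{enat n | n. \<exists>h. (\<forall>i<n. h i \<in> span B) \<and> indep_mod (span A) n h}"
  have low: "enat (card C) \<in> ?S" if C: "finite C" "C \<subseteq> B - A" for C
  proof -
    obtain h where h: "bij_betw h {..<card C} C"
      using ex_bij_betw_nat_finite[OF C(1)] by (auto simp: atLeast0LessThan)
    have "\<forall>i<card C. h i \<in> span B"
      using h C by (auto simp: bij_betw_def intro!: span_base)
    then show ?thesis using indep_mod_basis[OF B AB h C(2)] by blast
  qed
  show ?thesis
  proof (cases "finite (B - A)")
    case True
    have "reldim (span B) (span A) \<le> enat (card (B - A))"
      unfolding reldim_def
    proof (rule Sup_least, clarify)
      fix n h assume "\<forall>i<n. h i \<in> span B" "indep_mod (span A) n h"
      moreover have "A \<union> (B - A) = B" using AB by auto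
      ultimately show "enat n \<le> enat (card (B - A))"
        using indep_mod_le_card[OF True, of "span B" A n h] by simp
    qed
    moreover have "enat (card (B - A)) \<le> reldim (span B) (span A)"
      unfolding reldim_def by (rule Sup_upper) (use low True in blast)
    ultimately show ?thesis using True by simp
  next
    case False
    have "enat k \<le> reldim (span B) (span A)" for k
    proof -
      obtain C where "C \<subseteq> B - A" "finite C" "card C = k"
        using infinite_arbitrarily_large[OF False] by metis
      then show ?thesis unfolding reldim_def using low by (intro Sup_upper) blast
    qed
    then have "reldim (span B) (span A) = \<infinity>"
      by (metis Suc_ile_eq enat_ile linorder_not_less not_infinity_eq order_refl)
    then show ?thesis using False by simp
  qed
qed

lemma subspace_basis_extend:
  assumes "subspace V" "A \<subseteq> V" "independent A"
  obtains B where "A \<subseteq> B" "independent B" "span B = V"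
proof -
  obtain B where "A \<subseteq> B" "B \<subseteq> V" "independent B" "V \<subseteq> span B"
    using maximal_independent_subset_extend[OF assms(2,3)] by metis
  then show ?thesis using that span_minimal[OF _ assms(1)] by blast
qed

text \<open>Extend a basis of \<open>W\<close> to one of \<open>U\<close> and then to one of
  \<open>V\<close>; additivity becomes that of cardinalities of set differences, infinite ones
  included.\<close>

lemma reldim_tower:
  assumes "subspace W" "subspace U" "subspace V" "W \<subseteq> U" "U \<subseteq> V"
  shows "reldim V W = reldim V U + reldim U W"
proof -
  obtain A where A: "independent A" "span A = W"
    using subspace_basis_extend[OF assms(1) empty_subsetI independent_empty] by blast
  have AU: "A \<subseteq> U" using A(2) assms(4) span_superset by blast
  obtain C where C: "A \<subseteq> C" "independent C" "span C = U"
    using subspace_basis_extend[OF assms(2) AU A(1)] by blast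
  have CV: "C \<subseteq> V" using C(3) assms(5) span_superset by blast
  obtain B where B: "C \<subseteq> B" "independent B" "span B = V"
    using subspace_basis_extend[OF assms(3) CV C(2)] by blast
  have AB: "A \<subseteq> B" using C B by auto
  have un: "B - A = (B - C) \<union> (C - A)" and dj: "(B - C) \<inter> (C - A) = {}" using C B by auto
  show ?thesis
    using reldim_basis[OF B(2) AB] reldim_basis[OF B(2,1)] reldim_basis[OF C(2,1)]
    unfolding A B C by (auto simp: un card_Un_disjoint[OF _ _ dj])
qed

lemma reldim_self:
  assumes "subspace V"
  shows "reldim V V = 0"
proof -
  obtain A where A: "independent A" "span A = V"
    using subspace_basis_extend[OF assms empty_subsetI independent_empty] by blast
  show ?thesis using reldim_basis[OF A(1) order_refl] A by (simp add: zero_enat_def)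
qed

text \<open>\<open>f\<close> induces an isomorphism of quotients: \<open>iff\<close> makes the
  induced map well defined and injective, \<open>surj\<close> makes it onto. Later \<open>f\<close>
  is an inclusion, a reflection of coefficients or a matrix.\<close>

lemma reldim_map:
  assumes add: "\<And>x y. f (x + y) = f x + f y" and scale: "\<And>c x. f (scale c x) = scale c (f x)"
    and V: "subspace V" and W': "subspace W'"
    and maps: "\<And>x. x \<in> V \<Longrightarrow> f x \<in> V'"
    and iff: "\<And>x. x \<in> V \<Longrightarrow> f x \<in> W' \<longleftrightarrow> x \<in> W"
    and surj: "\<And>y. y \<in> V' \<Longrightarrow> \<exists>x\<in>V. f x - y \<in> W'"
  shows "reldim V W = reldim V' W'"
proof -
  have zero: "f 0 = 0" using scale[of 0 0] by simp
  have fsum: "f (\<Sum>i<n. scale (c i) (h i)) = (\<Sum>i<n. scale (c i) (f (h i)))" for c h and n :: nat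
    by (induction n) (auto simp: zero add scale)
  have inV: "(\<Sum>i<n. scale (c i) (h i)) \<in> V" if "\<forall>i<n. h i \<in> V" for c h and n :: nat
    using that by (intro subspace_sum[OF V] subspace_scale[OF V]) auto
  have "(\<exists>h. (\<forall>i<n. h i \<in> V) \<and> indep_mod W n h) \<longleftrightarrow> (\<exists>h. (\<forall>i<n. h i \<in> V') \<and> indep_mod W' n h)" for n
  proof
    assume "\<exists>h. (\<forall>i<n. h i \<in> V) \<and> indep_mod W n h"
    then obtain h where h: "\<forall>i<n. h i \<in> V" "indep_mod W n h" by blast
    have "indep_mod W' n (f \<circ> h)"
      using h(2) iff[OF inV[OF h(1)]] unfolding indep_mod_def by (simp add: fsum)
    then show "\<exists>h. (\<forall>i<n. h i \<in> V') \<and> indep_mod W' n h" using h maps by (intro exI[of _ "f \<circ> h"]) auto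
  next
    assume "\<exists>h. (\<forall>i<n. h i \<in> V') \<and> indep_mod W' n h"
    then obtain h where h: "\<forall>i<n. h i \<in> V'" "indep_mod W' n h" by blast
    then have "\<forall>i. \<exists>x. i < n \<longrightarrow> x \<in> V \<and> f x - h i \<in> W'" using surj by blast
    then obtain g where g: "\<And>i. i < n \<Longrightarrow> g i \<in> V \<and> f (g i) - h i \<in> W'" by metis
    have "indep_mod W n g" unfolding indep_mod_def
    proof (intro allI impI)
      fix c i assume c: "(\<Sum>i<n. scale (c i) (g i)) \<in> W" and i: "i < n"
      have 1: "(\<Sum>i<n. scale (c i) (f (g i))) \<in> W'"
        using c iff[OF inV[of n g c]] g by (simp add: fsum)
      have 2: "(\<Sum>i<n. scale (c i) (f (g i) - h i)) \<in> W'"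
        using g by (intro subspace_sum[OF W'] subspace_scale[OF W']) auto
      have "(\<Sum>i<n. scale (c i) (h i)) \<in> W'"
        using subspace_diff[OF W' 1 2] by (simp add: scale_right_diff_distrib sum_subtractf)
      then show "c i = 0" using h(2) i unfolding indep_mod_def by blast
    qed
    then show "\<exists>h. (\<forall>i<n. h i \<in> V) \<and> indep_mod W n h" using g by blast
  qed
  then show ?thesis unfolding reldim_def by simp
qed

end

subsection \<open>Cokernels of polynomial matrices\<close>

interpretation P2: relative_dimension "\<lambda>(c::'k::field) (h::'k poly poly). smult [:c:] h"
  by unfold_locales (simp_all add: smult_add_right mult.commute flip: smult_add_left)

text \<open>Vectors of length \<open>N\<close> are encoded as polynomials of degree less than
  \<open>N\<close>, so that images of Sylvester matrices and members of ideals live in one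
  type.\<close>

definition lowdeg :: "nat \<Rightarrow> 'c::comm_ring_1 poly set" where
  "lowdeg N = {w. \<forall>j\<ge>N. coeff w j = 0}"

definition mact :: "'c::comm_ring_1 mat \<Rightarrow> 'c poly \<Rightarrow> 'c poly" where
  "mact A w = (\<Sum>i<dim_row A. monom (\<Sum>j<dim_col A. A $$ (i, j) * coeff w j) i)"

lemma coeff_sum_monom: "coeff (\<Sum>i<n. monom (a i) i) k = (if k < n then a k else 0)"
  by (simp add: coeff_sum)

lemma coeff_mact:
  assumes "A \<in> carrier_mat N N"
  shows "coeff (mact A w) i = (if i < N then \<Sum>j<N. A $$ (i, j) * coeff w j else 0)"
  using assms unfolding mact_def coeff_sum_monom by auto

lemma mact_lowdeg: "A \<in> carrier_mat N N \<Longrightarrow> mact A w \<in> lowdeg N"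
  by (simp add: lowdeg_def coeff_mact)

lemma mact_add: "A \<in> carrier_mat N N \<Longrightarrow> mact A (v + w) = mact A v + mact A w"
  by (rule poly_eqI) (simp add: coeff_mact ring_distribs sum.distrib)

lemma mact_smult: "A \<in> carrier_mat N N \<Longrightarrow> mact A (smult c w) = smult c (mact A w)"
  by (rule poly_eqI) (simp add: coeff_mact sum_distrib_left mult_ac)

lemma mact_mult:
  assumes "A \<in> carrier_mat N N" "B \<in> carrier_mat N N"
  shows "mact (A * B) w = mact A (mact B w)"
proof (rule poly_eqI)
  fix i
  have AB: "A * B \<in> carrier_mat N N" using assms by auto
  show "coeff (mact (A * B) w) i = coeff (mact A (mact B w)) i"
  proof (cases "i < N")
    case True
    have "(\<Sum>j<N. (A * B) $$ (i, j) * coeff w j) = (\<Sum>j<N. \<Sum>k<N. A $$ (i, k) * B $$ (k, j) * coeff w j)"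
      using assms True
      by (intro sum.cong) (auto simp: scalar_prod_def sum_distrib_right atLeast0LessThan)
    also have "\<dots> = (\<Sum>k<N. \<Sum>j<N. A $$ (i, k) * B $$ (k, j) * coeff w j)" by (rule sum.swap)
    finally show ?thesis
      using True by (simp add: coeff_mact[OF AB] coeff_mact[OF assms(1)] coeff_mact[OF assms(2)]
          sum_distrib_left mult_ac)
  qed (simp add: coeff_mact[OF AB] coeff_mact[OF assms(1)])
qed

lemma mact_scalar:
  assumes "w \<in> lowdeg N" shows "mact (c \<cdot>\<^sub>m 1\<^sub>m N) w = smult c w"
proof (rule poly_eqI)
  fix i
  have C: "c \<cdot>\<^sub>m 1\<^sub>m N \<in> carrier_mat N N" by auto
  show "coeff (mact (c \<cdot>\<^sub>m 1\<^sub>m N) w) i = coeff (smult c w) i"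
  proof (cases "i < N")
    case True
    have "(\<Sum>j<N. (c \<cdot>\<^sub>m 1\<^sub>m N) $$ (i, j) * coeff w j) = (\<Sum>j<N. if j = i then c * coeff w j else 0)"
      using True by (intro sum.cong) auto
    then show ?thesis using True by (simp add: coeff_mact[OF C])
  qed (use assms in \<open>simp add: coeff_mact[OF C] lowdeg_def\<close>)
qed

lemma mact_adj:
  assumes "A \<in> carrier_mat N N" "h \<in> lowdeg N"
  shows "mact A (mact (adj_mat A) h) = smult (det A) h" "mact (adj_mat A) (mact A h) = smult (det A) h"
  using adj_mat[OF assms(1)] assms by (simp_all add: mact_scalar flip: mact_mult)

lemma mact_inj:
  fixes A :: "'c::idom mat"
  assumes "A \<in> carrier_mat N N" "det A \<noteq> 0" "v \<in> lowdeg N" "w \<in> lowdeg N" "mact A v = mact A w"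
  shows "v = w"
proof -
  have "smult (det A) v = smult (det A) w" using mact_adj(2)[OF assms(1)] assms by metis
  then have "smult (det A) (v - w) = 0" by (simp add: smult_diff_right)
  then show ?thesis using assms(2) by simp
qed

lemma subspace_lowdeg: "P2.subspace (lowdeg N)"
  by (rule P2.subspaceI) (auto simp: lowdeg_def)

text \<open>The vectors that enter the image of \<open>A\<close> once polynomials not vanishing at
  \<open>u\<close> are inverted; \<open>reldim\<close> modulo this set measures the localized
  cokernel.\<close>

definition locim :: "nat \<Rightarrow> 'k::field \<Rightarrow> 'k poly mat \<Rightarrow> 'k poly poly set" where
  "locim N u A = {h \<in> lowdeg N. \<exists>q w. poly q u \<noteq> 0 \<and> smult q h = mact A w}"

lemma subspace_locim:
  fixes A :: "'k::field poly mat"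
  assumes A: "A \<in> carrier_mat N N" shows "P2.subspace (locim N u A)"
proof (rule P2.subspaceI)
  show "0 \<in> locim N u A" unfolding locim_def
    using mact_smult[OF A, of 0 0] by (auto simp: lowdeg_def intro!: exI[of _ "1::'k poly"] exI[of _ "0::'k poly poly"])
next
  fix x y assume xy: "x \<in> locim N u A" "y \<in> locim N u A"
  then obtain q v r w where "poly q u \<noteq> 0" "smult q x = mact A v" "poly r u \<noteq> 0" "smult r y = mact A w"
    unfolding locim_def by auto
  then have "poly (q * r) u \<noteq> 0" "smult (q * r) (x + y) = mact A (smult r v + smult q w)"
    by (simp_all add: mact_add[OF A] mact_smult[OF A] smult_add_right)
      (metis mult.commute smult_smult)
  moreover have "x + y \<in> lowdeg N" using xy by (auto simp: locim_def lowdeg_def)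
  ultimately show "x + y \<in> locim N u A" unfolding locim_def by blast
next
  fix c x assume x: "x \<in> locim N u A"
  then obtain q v where "poly q u \<noteq> 0" "smult q x = mact A v" unfolding locim_def by auto
  moreover have "smult q (smult [:c:] x) = smult [:c:] (smult q x)" by (simp add: mult.commute)
  ultimately have "poly q u \<noteq> 0" "smult q (smult [:c:] x) = mact A (smult [:c:] v)"
    by (simp_all only: mact_smult[OF A] simp_thms)
  moreover have "smult [:c:] x \<in> lowdeg N" using x by (auto simp: locim_def lowdeg_def)
  ultimately show "smult [:c:] x \<in> locim N u A" unfolding locim_def by blast
qed

text \<open>The functional, read as a map to the line of scalar multiples of 1, induces an
  isomorphism of the quotient by its kernel onto that line.\<close>

lemma reldim_kernel:
  fixes \<phi> :: "'k::field poly poly \<Rightarrow> 'k"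
  assumes V: "P2.subspace V"
    and add: "\<And>x y. \<phi> (x + y) = \<phi> x + \<phi> y" and scale: "\<And>c x. \<phi> (smult [:c:] x) = c * \<phi> x"
    and e: "e \<in> V" "\<phi> e \<noteq> 0"
  shows "P2.reldim V {h \<in> V. \<phi> h = 0} = enat 1"
proof -
  have zero: "\<phi> 0 = 0" using scale[of 0 0] by simp
  have sub: "P2.subspace {h \<in> V. \<phi> h = 0}"
    using V by (auto simp: P2.subspace_def add scale zero)
  define f where "f = (\<lambda>h. smult [:\<phi> h:] (1 :: 'k poly poly))"
  have "P2.reldim V {h \<in> V. \<phi> h = 0} = P2.reldim (P2.span {1 :: 'k poly poly}) (P2.span {})"
  proof (rule P2.reldim_map[where f = f])
    show "\<exists>x\<in>V. f x - y \<in> P2.span {}" if y: "y \<in> P2.span {1}" for y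
    proof -
      obtain c where c: "y = smult [:c:] 1" using y by (auto simp: P2.span_singleton)
      have "smult [:c / \<phi> e:] e \<in> V" using P2.subspace_scale[OF V e(1)] by blast
      moreover have "f (smult [:c / \<phi> e:] e) = y" using e(2) unfolding f_def scale c by simp
      ultimately show ?thesis by (intro bexI[of _ "smult [:c / \<phi> e:] e"]) auto
    qed
    show "f (x + y) = f x + f y" for x y by (simp add: f_def add flip: smult_add_left)
    show "f (smult [:c:] x) = smult [:c:] (f x)" for c x by (simp add: f_def scale)
    show "f x \<in> P2.span {1}" for x by (auto simp: f_def P2.span_singleton)
    show "f x \<in> P2.span {} \<longleftrightarrow> x \<in> {h \<in> V. \<phi> h = 0}" if "x \<in> V" for x
      using that by (auto simp: f_def)
  qed (simp_all add: V)
  also have "\<dots> = enat 1"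
    by (subst P2.reldim_basis) (auto simp: P2.dependent_def)
  finally show ?thesis .
qed

text \<open>At \<open>u\<close> the rows of \<open>A\<close> satisfy a linear relation with
  coefficients \<open>z\<close>, so the combination of the rows with these coefficients is divisible
  by t - u. Replacing row \<open>j0\<close> by the quotient gives \<open>B\<close>, and
  \<open>D\<close> undoes the replacement. One linear factor of the determinant is split off in this
  way without diagonalizing \<open>A\<close>.\<close>

lemma factor_singular_matrix:
  fixes A :: "'k::field poly mat"
  assumes A: "A \<in> carrier_mat N N" and sing: "poly (det A) u = 0"
  obtains D B z j0 where "D \<in> carrier_mat N N" "B \<in> carrier_mat N N" "A = D * B" "j0 < N" "z j0 \<noteq> 0"
    "det D = smult (inverse (z j0)) [:-u, 1:]"
    "\<And>w. (\<Sum>i<N. smult (z i) (coeff (mact D w) i)) = [:-u, 1:] * coeff w j0"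
    "\<And>w i. i < N \<Longrightarrow> i \<noteq> j0 \<Longrightarrow> coeff (mact D w) i = coeff w i"
proof -
  have ev: "comm_ring_hom (\<lambda>p :: 'k poly. poly p u)" by unfold_locales auto
  let ?A0 = "map_mat (\<lambda>p. poly p u) A"
  have A0: "transpose_mat ?A0 \<in> carrier_mat N N" using A by auto
  have "det (transpose_mat ?A0) = 0"
    using sing det_transpose[of ?A0 N] A by (simp add: comm_ring_hom.hom_det[OF ev])
  then obtain v where v: "v \<in> carrier_vec N" "v \<noteq> 0\<^sub>v N" "transpose_mat ?A0 *\<^sub>v v = 0\<^sub>v N"
    using det_0_iff_vec_prod_zero[OF A0] by auto
  define z where "z = (\<lambda>i. v $ i)"
  obtain j0 where j0: "j0 < N" "z j0 \<noteq> 0"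
    using v(1,2) unfolding z_def by (metis eq_vecI carrier_vecD index_zero_vec)
  have vanish: "poly (\<Sum>i<N. smult (z i) (A $$ (i, j))) u = 0" if j: "j < N" for j
  proof -
    have "(transpose_mat ?A0 *\<^sub>v v) $ j = 0" using v(3) j by simp
    moreover have "(transpose_mat ?A0 *\<^sub>v v) $ j = (\<Sum>i<N. poly (A $$ (i, j)) u * z i)"
      using A v(1) j by (simp add: scalar_prod_def z_def atLeast0LessThan)
    ultimately show ?thesis by (simp add: poly_sum mult.commute)
  qed
  define r where "r = (\<lambda>j. (\<Sum>i<N. smult (z i) (A $$ (i, j))) div [:-u, 1:])"
  have r: "[:-u, 1:] * r j = (\<Sum>i<N. smult (z i) (A $$ (i, j)))" if "j < N" for j
    using vanish[OF that] unfolding poly_eq_0_iff_dvd r_def by (rule dvd_mult_div_cancel)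
  \<comment> \<open>Row \<open>j0\<close> of \<open>D\<close> expresses row \<open>j0\<close> of
    \<open>A\<close> through the quotient \<open>r\<close> and the other rows, which requires
    dividing the relation by \<open>z j0\<close>.\<close>
  define D where "D = mat N N (\<lambda>(i, j). if i = j0 then (if j = j0 then smult (inverse (z j0)) [:-u, 1:]
      else [:- (z j / z j0):]) else if i = j then 1 else 0)"
  define B where "B = mat N N (\<lambda>(i, j). if i = j0 then r j else A $$ (i, j))"
  have D: "D \<in> carrier_mat N N" and B: "B \<in> carrier_mat N N" by (auto simp: D_def B_def)
  have Drow: "(\<Sum>j<N. D $$ (j0, j) * x j) =
      smult (inverse (z j0)) ([:-u, 1:] * x j0 - (\<Sum>j\<in>{..<N}-{j0}. smult (z j) (x j)))" for x
  proof -
    have "(\<Sum>j<N. D $$ (j0, j) * x j) = D $$ (j0, j0) * x j0 + (\<Sum>j\<in>{..<N}-{j0}. D $$ (j0, j) * x j)"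
      using j0 by (subst sum.remove[of _ j0]) auto
    also have "(\<Sum>j\<in>{..<N}-{j0}. D $$ (j0, j) * x j) = (\<Sum>j\<in>{..<N}-{j0}. - smult (inverse (z j0)) (smult (z j) (x j)))"
      using j0 by (intro sum.cong) (auto simp: D_def field_simps)
    finally show ?thesis using j0
      by (simp add: D_def smult_diff_right sum_negf smult_sum2 mult_smult_left del: smult_smult smult_pCons mult_pCons_left)
  qed
  have Drow': "(\<Sum>j<N. D $$ (i, j) * x j) = x i" if "i < N" "i \<noteq> j0" for x i
  proof -
    have "(\<Sum>j<N. D $$ (i, j) * x j) = (\<Sum>j<N. if j = i then x j else 0)"
      using that by (intro sum.cong) (auto simp: D_def)
    then show ?thesis using that by simp
  qed
  have "A = D * B"
  proof (rule eq_matI)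
    fix i j assume ij: "i < dim_row (D * B)" "j < dim_col (D * B)"
    then have iN: "i < N" and jN: "j < N" using D B by auto
    have DB: "(D * B) $$ (i, j) = (\<Sum>k<N. D $$ (i, k) * B $$ (k, j))"
      using D B iN jN by (simp add: scalar_prod_def atLeast0LessThan)
    show "A $$ (i, j) = (D * B) $$ (i, j)"
    proof (cases "i = j0")
      case True
      have "(\<Sum>k\<in>{..<N}-{j0}. smult (z k) (B $$ (k, j))) = (\<Sum>k\<in>{..<N}-{j0}. smult (z k) (A $$ (k, j)))"
        using jN by (intro sum.cong) (auto simp: B_def)
      moreover have "[:-u, 1:] * B $$ (j0, j) = smult (z j0) (A $$ (j0, j)) + (\<Sum>k\<in>{..<N}-{j0}. smult (z k) (A $$ (k, j)))"
        using r[OF jN] jN j0(1) sum.remove[of "{..<N}" j0 "\<lambda>k. smult (z k) (A $$ (k, j))"] by (simp add: B_def)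
      ultimately show ?thesis unfolding DB unfolding True Drow using j0 by simp
    next
      case False
      then show ?thesis unfolding DB using Drow'[OF iN False] iN jN by (simp add: B_def)
    qed
  qed (use A D B in auto)
  moreover have "det D = smult (inverse (z j0)) [:-u, 1:]"
  proof -
    define b where "b = vec N (\<lambda>j. D $$ (j0, j))"
    have b: "b \<in> carrier_vec N" by (simp add: b_def)
    \<comment> \<open>The transpose of \<open>D\<close> is the identity with column
      \<open>j0\<close> replaced by \<open>b\<close>, so Cramer's rule yields its determinant as the
      entry of \<open>b\<close> at \<open>j0\<close>.\<close>
    have "transpose_mat D = replace_col (1\<^sub>m N) (1\<^sub>m N *\<^sub>v b) j0"
      using j0 b by (intro eq_matI) (auto simp: replace_col_def D_def b_def)
    then have "det (transpose_mat D) = b $ j0"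
      using cramer_lemma_mat[OF _ b j0(1), of "1\<^sub>m N"] by simp
    then show ?thesis using det_transpose[OF D] j0 by (simp add: b_def D_def)
  qed
  moreover have "(\<Sum>i<N. smult (z i) (coeff (mact D w) i)) = [:-u, 1:] * coeff w j0" for w
  proof -
    have "(\<Sum>i<N. smult (z i) (coeff (mact D w) i)) = smult (z j0) (coeff (mact D w) j0)
        + (\<Sum>i\<in>{..<N}-{j0}. smult (z i) (coeff (mact D w) i))"
      using j0 by (subst sum.remove[of _ j0]) auto
    also have "(\<Sum>i\<in>{..<N}-{j0}. smult (z i) (coeff (mact D w) i)) = (\<Sum>i\<in>{..<N}-{j0}. smult (z i) (coeff w i))"
      by (intro sum.cong) (auto simp: coeff_mact[OF D] Drow')
    finally show ?thesis using j0 by (simp add: coeff_mact[OF D] Drow del: mult_pCons_left)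
  qed
  moreover have "coeff (mact D w) i = coeff w i" if "i < N" "i \<noteq> j0" for w i
    using that by (simp add: coeff_mact[OF D] Drow')
  ultimately show ?thesis using that D B j0 by blast
qed

text \<open>Induction on the order. If \<open>det A\<close> vanishes at \<open>u\<close>, split A =
  D B: the image of \<open>D\<close> is the hyperplane \<open>H\<close> cut out by the relation at
  \<open>u\<close>, and \<open>D\<close> carries the quotient belonging to \<open>B\<close>
  isomorphically to \<open>H\<close> modulo \<open>locim N u A\<close>. Each factor t - u thus
  contributes one dimension.\<close>

lemma reldim_locim:
  fixes A :: "'k::field poly mat"
  assumes "A \<in> carrier_mat N N" "det A \<noteq> 0"
  shows "P2.reldim (lowdeg N) (locim N u A) = enat (order u (det A))"
  using assms
proof (induction "order u (det A)" arbitrary: A)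
  case 0
  then have "poly (det A) u \<noteq> 0" by (metis order_root)
  \<comment> \<open>The determinant itself serves as denominator \<open>q\<close>, and the adjugate
    supplies \<open>w\<close>.\<close>
  then have "\<exists>q w. poly q u \<noteq> 0 \<and> smult q h = mact A w" if "h \<in> lowdeg N" for h
    using mact_adj(1)[OF 0(2) that] by metis
  then have "locim N u A = lowdeg N" unfolding locim_def by blast
  then show ?case using 0(1) P2.reldim_self[OF subspace_lowdeg] by (simp add: zero_enat_def)
next
  case (Suc n)
  note A = Suc.prems(1)
  have "poly (det A) u = 0" using Suc(2) by (metis nat.distinct(1) order_root)
  then show ?case
  proof (rule factor_singular_matrix[OF A])
  fix D B z j0
  assume D: "D \<in> carrier_mat N N" and B: "B \<in> carrier_mat N N" and AD: "A = D * B"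
    and j0: "j0 < N" "z j0 \<noteq> 0" and detD: "det D = smult (inverse (z j0)) [:-u, 1:]"
    and zeta: "\<And>w. (\<Sum>i<N. smult (z i) (coeff (mact D w) i)) = [:-u, 1:] * coeff w j0"
    and Drow: "\<And>w i. i < N \<Longrightarrow> i \<noteq> j0 \<Longrightarrow> coeff (mact D w) i = coeff w i"
  have dets: "det A = det D * det B" unfolding AD by (rule det_mult[OF D B])
  have nz: "det D \<noteq> 0" "det B \<noteq> 0" using Suc.prems(2) dets by auto
  have "order u (det D) = 1"
  proof -
    have "order u (smult (inverse (z j0)) [:-u, 1:]) = order u [:-u, 1:]"
      using j0 by (intro order_smult) auto
    also have "\<dots> = 1" using order_power_n_n[of u 1] by simp
    finally show ?thesis unfolding detD .
  qed
  then have n: "n = order u (det B)" using Suc(2) order_mult[of "det D" "det B" u] nz dets by simp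
  define \<phi> where "\<phi> = (\<lambda>h :: 'k poly poly. poly (\<Sum>i<N. smult (z i) (coeff h i)) u)"
  define H where "H = {h \<in> lowdeg N. \<phi> h = 0}"
  have add: "\<phi> (x + y) = \<phi> x + \<phi> y" for x y
    by (simp add: \<phi>_def poly_sum sum.distrib ring_distribs)
  have scale: "\<phi> (smult q x) = poly q u * \<phi> x" for q x
    by (simp add: \<phi>_def poly_sum sum_distrib_left mult_ac)
  have H1: "P2.reldim (lowdeg N) H = enat 1" unfolding H_def
  proof (rule reldim_kernel[OF subspace_lowdeg add])
    show "\<phi> (smult [:c:] x) = c * \<phi> x" for c x by (simp add: scale)
    have "\<phi> (monom 1 j0) = (\<Sum>i<N. if i = j0 then z i else 0)"
      unfolding \<phi>_def poly_sum by (intro sum.cong) auto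
    then show "\<phi> (monom 1 j0) \<noteq> 0" using j0 by simp
    show "monom 1 j0 \<in> lowdeg N" using j0 by (auto simp: lowdeg_def)
  qed
  have subH: "P2.subspace H"
  proof (rule P2.subspaceI)
    show "0 \<in> H" using scale[of 0 0] by (simp add: H_def lowdeg_def)
    show "x + y \<in> H" if "x \<in> H" "y \<in> H" for x y using that add by (simp add: H_def lowdeg_def)
    show "smult [:c:] x \<in> H" if "x \<in> H" for c x using that scale by (simp add: H_def lowdeg_def)
  qed
  have \<phi>D: "\<phi> (mact D w) = 0" for w unfolding \<phi>_def zeta by simp
  have inH: "mact D w \<in> H" for w unfolding H_def using \<phi>D mact_lowdeg[OF D] by simp
  have JH: "locim N u A \<subseteq> H"
  proof
    fix h assume "h \<in> locim N u A"
    then obtain q w where h: "h \<in> lowdeg N" "poly q u \<noteq> 0" "smult q h = mact D (mact B w)"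
      unfolding locim_def AD mact_mult[OF D B] by auto
    have "poly q u * \<phi> h = 0" using \<phi>D[of "mact B w"] h(3) scale[of q h] by simp
    then show "h \<in> H" using h unfolding H_def by auto
  qed
  have "P2.reldim (lowdeg N) (locim N u B) = P2.reldim H (locim N u A)"
  proof (rule P2.reldim_map[where f = "mact D"])
    show "mact D x \<in> locim N u A \<longleftrightarrow> x \<in> locim N u B" if x: "x \<in> lowdeg N" for x
    proof
      assume "x \<in> locim N u B"
      then obtain q w where "poly q u \<noteq> 0" "smult q x = mact B w" unfolding locim_def by auto
      then have "poly q u \<noteq> 0" "smult q (mact D x) = mact A w"
        unfolding AD mact_mult[OF D B] mact_smult[OF D, symmetric] by auto
      then show "mact D x \<in> locim N u A" using mact_lowdeg[OF D] unfolding locim_def by blast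
    next
      assume "mact D x \<in> locim N u A"
      then obtain q w where q: "poly q u \<noteq> 0" "smult q (mact D x) = mact D (mact B w)"
        unfolding locim_def AD mact_mult[OF D B] by auto
      have "smult q x \<in> lowdeg N" using x by (auto simp: lowdeg_def)
      then have "smult q x = mact B w"
        by (rule mact_inj[OF D nz(1)]) (simp_all add: mact_smult[OF D] q(2) mact_lowdeg[OF B])
      then show "x \<in> locim N u B" using x q(1) unfolding locim_def by blast
    qed
    show "\<exists>x\<in>lowdeg N. mact D x - y \<in> locim N u A" if y: "y \<in> H" for y
    proof -
      have y': "y \<in> lowdeg N" "poly (\<Sum>i<N. smult (z i) (coeff y i)) u = 0"
        using y unfolding H_def \<phi>_def by auto
      then obtain s where s: "(\<Sum>i<N. smult (z i) (coeff y i)) = [:-u, 1:] * s"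
        unfolding poly_eq_0_iff_dvd by blast
      \<comment> \<open>A preimage of \<open>y\<close> under \<open>D\<close>: all coordinates are
        kept except \<open>j0\<close>, which becomes the quotient of the relation by t - u.\<close>
      define x where "x = (\<Sum>i<N. monom (if i = j0 then s else coeff y i) i)"
      have cx: "coeff x i = (if i < N then if i = j0 then s else coeff y i else 0)" for i
        unfolding x_def coeff_sum_monom ..
      have other: "coeff (mact D x) i = coeff y i" if "i < N" "i \<noteq> j0" for i
        using Drow[OF that, of x] that by (simp add: cx)
      have "(\<Sum>i<N. smult (z i) (coeff (mact D x) i)) = (\<Sum>i<N. smult (z i) (coeff y i))"
        unfolding zeta s using j0 by (simp add: cx)
      moreover have "(\<Sum>i\<in>{..<N}-{j0}. smult (z i) (coeff (mact D x) i)) = (\<Sum>i\<in>{..<N}-{j0}. smult (z i) (coeff y i))"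
        using other by (intro sum.cong) auto
      ultimately have "smult (z j0) (coeff (mact D x) j0) = smult (z j0) (coeff y j0)"
        using j0(1) by (simp add: sum.remove[of "{..<N}" j0])
      then have "smult (z j0) (coeff (mact D x) j0 - coeff y j0) = 0" by (simp add: smult_diff_right)
      then have at_j0: "coeff (mact D x) j0 = coeff y j0" using j0(2) by simp
      have "mact D x = y"
      proof (rule poly_eqI)
        fix i
        show "coeff (mact D x) i = coeff y i"
          using other[of i] at_j0 y'(1) mact_lowdeg[OF D, of x]
          by (cases "i < N"; cases "i = j0") (simp_all add: lowdeg_def)
      qed
      moreover have "x \<in> lowdeg N" unfolding lowdeg_def by (simp add: cx)
      ultimately show ?thesis using P2.subspace_0[OF subspace_locim[OF A]] by (intro bexI[of _ x]) auto
    qed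
    show "mact D x \<in> H" for x by (rule inH)
  qed (rule mact_add[OF D] mact_smult[OF D] subspace_lowdeg subspace_locim[OF A])+
  then have "P2.reldim H (locim N u A) = enat n" using Suc(1)[OF n B nz(2)] n by simp
  then show ?case
    using P2.reldim_tower[OF subspace_locim[OF A] subH subspace_lowdeg JH] H1 Suc(2)[symmetric]
    by (auto simp: H_def)
  qed
qed

subsection \<open>The Sylvester matrix\<close>

definition reflect_below :: "nat \<Rightarrow> 'c::comm_ring_1 poly \<Rightarrow> 'c poly" where
  "reflect_below N h = (\<Sum>i<N. monom (coeff h (N - 1 - i)) i)"

lemma coeff_reflect_below: "coeff (reflect_below N h) i = (if i < N then coeff h (N - 1 - i) else 0)"
  unfolding reflect_below_def coeff_sum_monom ..

lemma reflect_below_lowdeg: "reflect_below N h \<in> lowdeg N"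
  by (simp add: lowdeg_def coeff_reflect_below)

lemma reflect_below_reflect_below: "h \<in> lowdeg N \<Longrightarrow> reflect_below N (reflect_below N h) = h"
  by (rule poly_eqI) (auto simp: coeff_reflect_below lowdeg_def)

text \<open>Rows of the Sylvester matrix list coefficients from the top degree downwards, hence the
  reflections.\<close>

lemma mact_sylvester:
  fixes f g :: "'c::comm_ring_1 poly"
  defines "m \<equiv> degree f" and "n \<equiv> degree g"
  shows "mact (transpose_mat (sylvester_mat f g)) w =
    reflect_below (m + n) ((\<Sum>j<n. monom (coeff w j) (n - 1 - j)) * f
       + (\<Sum>j\<in>{n..<m+n}. monom (coeff w j) (m + n - 1 - j)) * g)"
proof (rule poly_eqI)
  fix i
  let ?N = "m + n"
  have C: "transpose_mat (sylvester_mat f g) \<in> carrier_mat ?N ?N"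
    using sylvester_carrier_mat[of f g] by (simp add: m_def n_def)
  show "coeff (mact (transpose_mat (sylvester_mat f g)) w) i = coeff (reflect_below (m + n)
       ((\<Sum>j<n. monom (coeff w j) (n - 1 - j)) * f
       + (\<Sum>j\<in>{n..<m+n}. monom (coeff w j) (m + n - 1 - j)) * g)) i"
  proof (cases "i < ?N")
    case True
    have ent: "transpose_mat (sylvester_mat f g) $$ (i, j) * coeff w j =
        (if j < n then coeff (monom (coeff w j) (n - 1 - j) * f) (?N - 1 - i)
         else coeff (monom (coeff w j) (?N - 1 - j) * g) (?N - 1 - i))" if j: "j < ?N" for j
    proof -
      have "transpose_mat (sylvester_mat f g) $$ (i, j) = sylvester_mat f g $$ (j, i)"
        using True j by (simp add: m_def n_def)
      also have "\<dots> = (if j < n then if j \<le> i \<and> i - j \<le> m then coeff f (m + j - i) else 0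
         else if j - n \<le> i \<and> i \<le> j then coeff g (j - i) else 0)"
        unfolding m_def n_def by (rule sylvester_index_mat) (use True j in \<open>auto simp: m_def n_def\<close>)
      also have "\<dots> * coeff w j = (if j < n then coeff (monom (coeff w j) (n - 1 - j) * f) (?N - 1 - i)
         else coeff (monom (coeff w j) (?N - 1 - j) * g) (?N - 1 - i))"
      proof (cases "j < n")
        case jn: True
        have "coeff f (m + j - i) = 0" if "i < j" using that by (intro coeff_eq_0) (simp add: m_def)
        moreover have "?N - 1 - i - (n - 1 - j) = m + j - i" if "n - 1 - j \<le> ?N - 1 - i" "i \<le> m + j"
          using that jn True by simp
        ultimately show ?thesis using jn True by (auto simp: coeff_monom_mult)
      next
        case jn: False
        have "coeff g (j - i) = 0" if "j - n > i" using that by (intro coeff_eq_0) (simp add: n_def)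
        moreover have "?N - 1 - i - (?N - 1 - j) = j - i" if "i \<le> j" using that jn j by simp
        ultimately show ?thesis using jn True j by (auto simp: coeff_monom_mult)
      qed
      finally show ?thesis .
    qed
    have "(\<Sum>j<?N. transpose_mat (sylvester_mat f g) $$ (i, j) * coeff w j) =
        (\<Sum>j<?N. if j < n then coeff (monom (coeff w j) (n - 1 - j) * f) (?N - 1 - i)
         else coeff (monom (coeff w j) (?N - 1 - j) * g) (?N - 1 - i))"
      using ent by (intro sum.cong) auto
    also have "\<dots> = (\<Sum>j\<in>{..<n} \<union> {n..<?N}. if j < n then coeff (monom (coeff w j) (n - 1 - j) * f) (?N - 1 - i)
         else coeff (monom (coeff w j) (?N - 1 - j) * g) (?N - 1 - i))"
      by (rule sum.cong) auto
    also have "\<dots> =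
        (\<Sum>j<n. coeff (monom (coeff w j) (n - 1 - j) * f) (?N - 1 - i))
        + (\<Sum>j\<in>{n..<?N}. coeff (monom (coeff w j) (?N - 1 - j) * g) (?N - 1 - i))"
      by (subst sum.union_disjoint) auto
    finally show ?thesis using True
      by (simp add: coeff_mact[OF C] coeff_reflect_below sum_distrib_right coeff_sum)
  qed (simp add: coeff_mact[OF C] coeff_reflect_below)
qed

lemma sylvester_vector:
  fixes f g p q :: "'c::comm_ring_1 poly"
  assumes "p \<in> lowdeg (degree g)" "q \<in> lowdeg (degree f)"
  obtains w where
    "mact (transpose_mat (sylvester_mat f g)) w = reflect_below (degree f + degree g) (p * f + q * g)"
proof -
  let ?m = "degree f" and ?n = "degree g"
  \<comment> \<open>The first \<open>degree g\<close> entries hold \<open>p\<close>, the remaining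
    ones \<open>q\<close>, both in descending order of degree.\<close>
  define w where "w = (\<Sum>j<?m + ?n. monom (if j < ?n then coeff p (?n - 1 - j) else coeff q (?m + ?n - 1 - j)) j)"
  have w: "coeff w j = (if j < ?m + ?n then if j < ?n then coeff p (?n - 1 - j) else coeff q (?m + ?n - 1 - j) else 0)" for j
    unfolding w_def coeff_sum_monom ..
  have p: "(\<Sum>j<?n. monom (coeff w j) (?n - 1 - j)) = p"
  proof (rule poly_eqI)
    fix k
    have "coeff (\<Sum>j<?n. monom (coeff w j) (?n - 1 - j)) k = (\<Sum>j<?n. if j = ?n - 1 - k \<and> k < ?n then coeff p k else 0)"
      unfolding coeff_sum by (intro sum.cong) (auto simp: w)
    also have "\<dots> = coeff p k" using assms(1) by (cases "k < ?n") (auto simp: lowdeg_def)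
    finally show "coeff (\<Sum>j<?n. monom (coeff w j) (?n - 1 - j)) k = coeff p k" .
  qed
  have q: "(\<Sum>j\<in>{?n..<?m+?n}. monom (coeff w j) (?m + ?n - 1 - j)) = q"
  proof (rule poly_eqI)
    fix k
    have "coeff (\<Sum>j\<in>{?n..<?m+?n}. monom (coeff w j) (?m + ?n - 1 - j)) k =
       (\<Sum>j\<in>{?n..<?m+?n}. if j = ?m + ?n - 1 - k \<and> k < ?m then coeff q k else 0)"
      unfolding coeff_sum by (intro sum.cong) (auto simp: w)
    also have "\<dots> = coeff q k" using assms(2) by (cases "k < ?m") (auto simp: lowdeg_def)
    finally show "coeff (\<Sum>j\<in>{?n..<?m+?n}. monom (coeff w j) (?m + ?n - 1 - j)) k = coeff q k" .
  qed
  show thesis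
  proof
    show "mact (transpose_mat (sylvester_mat f g)) w = reflect_below (?m + ?n) (p * f + q * g)"
      unfolding mact_sylvester p q ..
  qed
qed

text \<open>The vector \<open>w\<close> lists the coefficients of both cofactors. The last clause
  turns nonzero kernel vectors into nontrivial relations between \<open>f\<close> and
  \<open>g\<close>.\<close>

lemma sylvester_image:
  fixes f g :: "'c::comm_ring_1 poly"
  obtains p q where "p \<in> lowdeg (degree g)" "q \<in> lowdeg (degree f)"
    "mact (transpose_mat (sylvester_mat f g)) w = reflect_below (degree f + degree g) (p * f + q * g)"
    "w \<in> lowdeg (degree f + degree g) \<Longrightarrow> w \<noteq> 0 \<Longrightarrow> p \<noteq> 0 \<or> q \<noteq> 0"
proof -
  let ?m = "degree f" and ?n = "degree g"
  let ?p = "\<Sum>j<?n. monom (coeff w j) (?n - 1 - j)"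
  let ?q = "\<Sum>j\<in>{?n..<?m+?n}. monom (coeff w j) (?m + ?n - 1 - j)"
  have p: "coeff ?p k = (if k < ?n then coeff w (?n - 1 - k) else 0)" for k
  proof -
    have "coeff ?p k = (\<Sum>j<?n. if j = ?n - 1 - k \<and> k < ?n then coeff w (?n - 1 - k) else 0)"
      unfolding coeff_sum by (intro sum.cong) auto
    then show ?thesis by auto
  qed
  have q: "coeff ?q k = (if k < ?m then coeff w (?m + ?n - 1 - k) else 0)" for k
  proof -
    have "coeff ?q k = (\<Sum>j\<in>{?n..<?m+?n}. if j = ?m + ?n - 1 - k \<and> k < ?m then coeff w (?m + ?n - 1 - k) else 0)"
      unfolding coeff_sum by (intro sum.cong) auto
    then show ?thesis by auto
  qed
  show thesis
  proof
    show "?p \<in> lowdeg ?n" unfolding lowdeg_def mem_Collect_eq p by simp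
    show "?q \<in> lowdeg ?m" unfolding lowdeg_def mem_Collect_eq q by simp
    show "mact (transpose_mat (sylvester_mat f g)) w = reflect_below (?m + ?n) (?p * f + ?q * g)"
      by (rule mact_sylvester)
    show "?p \<noteq> 0 \<or> ?q \<noteq> 0" if w: "w \<in> lowdeg (?m + ?n)" "w \<noteq> 0"
    proof (rule ccontr)
      assume "\<not> (?p \<noteq> 0 \<or> ?q \<noteq> 0)"
      then have *: "\<And>k. coeff ?p k = 0" "\<And>k. coeff ?q k = 0" by auto
      have "coeff w j = 0" for j
      proof (cases "j < ?n")
        case True
        then show ?thesis using *(1)[of "?n - 1 - j"] unfolding p by (simp split: if_splits)
      next
        case False
        then show ?thesis using *(2)[of "?m + ?n - 1 - j"] w(1) unfolding q lowdeg_def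
          by (cases "j < ?m + ?n") (simp_all split: if_splits)
      qed
      then show False using w(2) by (simp add: poly_eq_iff)
    qed
  qed
qed

lemma lowdeg_degree: "h \<in> lowdeg N \<Longrightarrow> h \<noteq> 0 \<Longrightarrow> degree h < N"
  unfolding lowdeg_def by (metis (mono_tags, lifting) leading_coeff_0_iff mem_Collect_eq not_le)

lemma lowdegI: "h = 0 \<or> degree h < N \<Longrightarrow> h \<in> lowdeg N"
  by (auto simp: lowdeg_def coeff_eq_0)

lemma lowdeg_combination:
  fixes f g :: "'c::comm_ring_1 poly"
  assumes "p \<in> lowdeg (degree g)" "q \<in> lowdeg (degree f)"
  shows "p * f + q * g \<in> lowdeg (degree f + degree g)"
proof -
  have "p = 0 \<or> degree (p * f) < degree f + degree g"
    using lowdeg_degree[OF assms(1)] degree_mult_le[of p f] by linarith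
  then have 1: "p * f \<in> lowdeg (degree f + degree g)" by (intro lowdegI) auto
  have "q = 0 \<or> degree (q * g) < degree f + degree g"
    using lowdeg_degree[OF assms(2)] degree_mult_le[of q g] by linarith
  then have 2: "q * g \<in> lowdeg (degree f + degree g)" by (intro lowdegI) auto
  show ?thesis using 1 2 by (auto simp: lowdeg_def)
qed

lemma sylvester_det: "det (transpose_mat (sylvester_mat f g)) = resultant f g"
  unfolding resultant_def by (rule det_transpose[OF sylvester_carrier_mat])

text \<open>The Sylvester matrix after its adjugate is multiplication by the resultant; apply this
  to the reflection of the constant 1. The degree hypothesis excludes the empty matrix, whose
  determinant is 1.\<close>

lemma resultant_in_ideal:
  fixes f g :: "'c::comm_ring_1 poly"
  assumes "degree f + degree g > 0"
  shows "\<exists>p q. [:resultant f g:] = p * f + q * g"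
proof -
  let ?N = "degree f + degree g"
  let ?S = "transpose_mat (sylvester_mat f g)"
  have S: "?S \<in> carrier_mat ?N ?N" using sylvester_carrier_mat[of f g] by simp
  let ?e = "monom 1 (?N - 1) :: 'c poly"
  have "?e \<in> lowdeg ?N" using assms by (auto simp: lowdeg_def)
  from mact_adj(1)[OF S this] have *: "mact ?S (mact (adj_mat ?S) ?e) = smult (resultant f g) ?e"
    by (simp add: sylvester_det)
  obtain p q where pq: "p \<in> lowdeg (degree g)" "q \<in> lowdeg (degree f)"
    "mact ?S (mact (adj_mat ?S) ?e) = reflect_below ?N (p * f + q * g)"
    by (rule sylvester_image)
  have "p * f + q * g = reflect_below ?N (smult (resultant f g) ?e)"
    using lowdeg_combination[OF pq(1,2)] pq(3) * by (metis reflect_below_reflect_below)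
  also have "\<dots> = [:resultant f g:]"
    by (rule poly_eqI) (use assms in \<open>auto simp: coeff_reflect_below coeff_pCons split: nat.splits\<close>)
  finally show ?thesis by metis
qed

lemma resultant_0_imp_relation:
  fixes f g :: "'c::idom poly"
  assumes "resultant f g = 0"
  shows "\<exists>p q. p \<in> lowdeg (degree g) \<and> q \<in> lowdeg (degree f) \<and> (p \<noteq> 0 \<or> q \<noteq> 0) \<and> p * f + q * g = 0"
proof -
  let ?N = "degree f + degree g"
  let ?S = "transpose_mat (sylvester_mat f g)"
  have S: "?S \<in> carrier_mat ?N ?N" using sylvester_carrier_mat[of f g] by simp
  obtain v where v: "v \<in> carrier_vec ?N" "v \<noteq> 0\<^sub>v ?N" "?S *\<^sub>v v = 0\<^sub>v ?N"
    using det_0_iff_vec_prod_zero[OF S] assms sylvester_det[of f g] by auto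
  define w where "w = (\<Sum>j<?N. monom (v $ j) j)"
  have cw: "coeff w j = (if j < ?N then v $ j else 0)" for j unfolding w_def coeff_sum_monom ..
  have w: "w \<in> lowdeg ?N" by (simp add: lowdeg_def cw)
  have "w \<noteq> 0" using v(1,2) cw by (metis eq_vecI carrier_vecD coeff_0 index_zero_vec)
  have "mact ?S w = 0"
  proof (rule poly_eqI)
    fix i
    have "(\<Sum>j<?N. ?S $$ (i, j) * coeff w j) = (?S *\<^sub>v v) $ i" if "i < ?N"
      using that v(1) by (simp add: scalar_prod_def cw atLeast0LessThan)
    then show "coeff (mact ?S w) i = coeff 0 i" using v(3) by (simp add: coeff_mact[OF S])
  qed
  obtain p q where pq: "p \<in> lowdeg (degree g)" "q \<in> lowdeg (degree f)"
    "mact ?S w = reflect_below ?N (p * f + q * g)" "w \<in> lowdeg ?N \<Longrightarrow> w \<noteq> 0 \<Longrightarrow> p \<noteq> 0 \<or> q \<noteq> 0"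
    using sylvester_image[where f = f and g = g and w = w] by blast
  have "p * f + q * g = reflect_below ?N 0"
    using lowdeg_combination[OF pq(1,2)] pq(3) \<open>mact ?S w = 0\<close> by (metis reflect_below_reflect_below)
  also have "\<dots> = 0" by (rule poly_eqI) (simp add: coeff_reflect_below)
  finally show ?thesis using pq w \<open>w \<noteq> 0\<close> by blast
qed

text \<open>Pseudo-division multiplies \<open>h\<close> by a power of the leading coefficient, which
  the same power of \<open>c\<close> cancels.\<close>

lemma division_unit_lead:
  fixes f h :: "'c::comm_ring_1 poly"
  assumes "lead_coeff f * c = 1"
  shows "\<exists>s r. h = s * f + r \<and> r \<in> lowdeg (degree f)"
proof -
  have f0: "f \<noteq> 0" using assms by auto
  obtain q r where qr: "pseudo_divmod h f = (q, r)" by force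
  let ?k = "Suc (degree h) - degree f"
  have *: "smult (lead_coeff f ^ ?k) h = f * q + r" "r = 0 \<or> degree r < degree f"
    using pseudo_divmod[OF f0 qr] by auto
  have "h = smult (c ^ ?k) (smult (lead_coeff f ^ ?k) h)"
    using assms by (simp add: power_mult_distrib[symmetric] mult.commute)
  also have "\<dots> = smult (c ^ ?k) q * f + smult (c ^ ?k) r"
    unfolding *(1) by (simp add: smult_add_right mult.commute)
  finally have "h = smult (c ^ ?k) q * f + smult (c ^ ?k) r" .
  moreover have "smult (c ^ ?k) r \<in> lowdeg (degree f)"
    using *(2) by (auto simp: lowdeg_def coeff_eq_0)
  ultimately show ?thesis by blast
qed

text \<open>Contraction of the ideal \<open>(f, g)\<close> localized along the whole line \<open>inner variable = u\<close>.\<close>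

definition locideal :: "'k::field \<Rightarrow> 'k poly poly \<Rightarrow> 'k poly poly \<Rightarrow> 'k poly poly set" where
  "locideal u f g = {h. \<exists>q p r. poly q u \<noteq> 0 \<and> smult q h = p * f + r * g}"

lemma subspace_locideal: "P2.subspace (locideal u f g)"
proof (rule P2.subspaceI)
  have "poly 1 u \<noteq> 0 \<and> smult 1 0 = 0 * f + 0 * g" by simp
  then show "0 \<in> locideal u f g" unfolding locideal_def by blast
next
  fix x y assume "x \<in> locideal u f g" "y \<in> locideal u f g"
  then obtain q p r q' p' r' where "poly q u \<noteq> 0" "smult q x = p * f + r * g"
    "poly q' u \<noteq> 0" "smult q' y = p' * f + r' * g" unfolding locideal_def by blast
  moreover have "smult (q * q') (x + y) = smult q' (smult q x) + smult q (smult q' y)"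
    by (simp add: smult_add_right mult.commute)
  ultimately have "poly (q * q') u \<noteq> 0" "smult (q * q') (x + y) = (smult q' p + smult q p') * f + (smult q' r + smult q r') * g"
    by (auto simp: ring_distribs smult_add_right)
  then show "x + y \<in> locideal u f g" unfolding locideal_def by blast
next
  fix c x assume "x \<in> locideal u f g"
  then obtain q p r where q: "poly q u \<noteq> 0" "smult q x = p * f + r * g" unfolding locideal_def by blast
  have "smult q (smult [:c:] x) = smult [:c:] (smult q x)" by (simp add: mult.commute)
  also have "\<dots> = smult [:c:] p * f + smult [:c:] r * g" unfolding q(2) by (simp add: smult_add_right)
  finally show "smult [:c:] x \<in> locideal u f g" using q(1) unfolding locideal_def by blast
qed

lemma locideal_combination: "p * f + r * g \<in> locideal u f g"
proof -
  have "poly 1 u \<noteq> 0 \<and> smult 1 (p * f + r * g) = p * f + r * g" by simp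
  then show ?thesis unfolding locideal_def by blast
qed

text \<open>The unit leading coefficient makes division by \<open>f\<close> possible. It gives every
  class a representative of degree below \<open>?N\<close> and bounds the cofactors of such a
  representative, so that membership in the ideal becomes membership in the image of the Sylvester
  matrix.\<close>

lemma reldim_locideal:
  fixes f g :: "'k::field poly poly"
  assumes lc: "lead_coeff f * c = 1" and res: "resultant f g \<noteq> 0"
  shows "P2.reldim UNIV (locideal u f g) = enat (order u (resultant f g))"
proof -
  let ?N = "degree f + degree g"
  let ?S = "transpose_mat (sylvester_mat f g)"
  have S: "?S \<in> carrier_mat ?N ?N" using sylvester_carrier_mat[of f g] by simp
  have f0: "f \<noteq> 0" using lc by auto
  have degf: "degree (p * f) = degree p + degree f" if "p \<noteq> 0" for p using that f0 by (rule degree_mult_eq)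
  \<comment> \<open>Replace \<open>r\<close> by its remainder modulo \<open>f\<close>. The other
    cofactor is then bounded by the degree of the sum, since multiplication by \<open>f\<close> adds
    degrees exactly.\<close>
  have red: "\<exists>p' r'. p' \<in> lowdeg (degree g) \<and> r' \<in> lowdeg (degree f) \<and> p * f + r * g = p' * f + r' * g"
    if h: "p * f + r * g \<in> lowdeg ?N" for p r
  proof -
    obtain s r' where r': "r = s * f + r'" "r' \<in> lowdeg (degree f)" using division_unit_lead[OF lc] by blast
    have eq: "p * f + r * g = (p + s * g) * f + r' * g" unfolding r'(1) by (simp add: algebra_simps)
    have "r' * g \<in> lowdeg ?N" using lowdeg_combination[OF _ r'(2), of 0 g] by (simp add: lowdeg_def)
    then have "(p + s * g) * f \<in> lowdeg ?N" using h unfolding eq by (auto simp: lowdeg_def)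
    then have "p + s * g \<in> lowdeg (degree g)"
      using lowdeg_degree[of "(p + s * g) * f" ?N] degf[of "p + s * g"] f0 by (intro lowdegI) auto
    then show ?thesis using r'(2) eq by blast
  qed
  have "P2.reldim UNIV (locideal u f g) = P2.reldim (lowdeg ?N) (lowdeg ?N \<inter> locideal u f g)"
  proof (rule P2.reldim_map[where f = "\<lambda>x. x", symmetric])
    show "\<exists>x\<in>lowdeg ?N. x - y \<in> locideal u f g" for y
    proof -
      obtain s r where y: "y = s * f + r" "r \<in> lowdeg (degree f)" using division_unit_lead[OF lc] by blast
      have "r - y = (- s) * f + 0 * g" using y by simp
      then have "r - y \<in> locideal u f g" using locideal_combination by metis
      moreover have "r \<in> lowdeg ?N" using y(2) by (auto simp: lowdeg_def)
      ultimately show ?thesis by blast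
    qed
  qed (auto simp: subspace_lowdeg subspace_locideal)
  also have "\<dots> = P2.reldim (lowdeg ?N) (locim ?N u ?S)"
  proof (rule P2.reldim_map[where f = "reflect_below ?N"])
    show "reflect_below ?N (x + y) = reflect_below ?N x + reflect_below ?N y" for x y :: "'k poly poly"
      by (rule poly_eqI) (simp add: coeff_reflect_below)
    show sm: "reflect_below ?N (smult [:a:] x) = smult [:a:] (reflect_below ?N x)" for a and x :: "'k poly poly"
      by (rule poly_eqI) (simp add: coeff_reflect_below)
    have sm: "reflect_below ?N (smult q x) = smult q (reflect_below ?N x)" for q and x :: "'k poly poly"
      by (rule poly_eqI) (simp add: coeff_reflect_below)
    show "reflect_below ?N x \<in> locim ?N u ?S \<longleftrightarrow> x \<in> lowdeg ?N \<inter> locideal u f g" if x: "x \<in> lowdeg ?N" for x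
    proof
      assume "reflect_below ?N x \<in> locim ?N u ?S"
      then obtain q w where q: "poly q u \<noteq> 0" "reflect_below ?N (smult q x) = mact ?S w"
        unfolding locim_def sm by auto
      obtain p r where pr: "p \<in> lowdeg (degree g)" "r \<in> lowdeg (degree f)"
        "mact ?S w = reflect_below ?N (p * f + r * g)" by (rule sylvester_image)
      have "smult q x \<in> lowdeg ?N" using x by (auto simp: lowdeg_def)
      then have "smult q x = p * f + r * g"
        using q(2) pr(3) lowdeg_combination[OF pr(1,2)] by (metis reflect_below_reflect_below)
      then show "x \<in> lowdeg ?N \<inter> locideal u f g" using x q(1) unfolding locideal_def by blast
    next
      assume "x \<in> lowdeg ?N \<inter> locideal u f g"
      then obtain q p r where q: "poly q u \<noteq> 0" "smult q x = p * f + r * g" unfolding locideal_def by blast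
      have "smult q x \<in> lowdeg ?N" using x by (auto simp: lowdeg_def)
      then obtain p' r' where pr: "p' \<in> lowdeg (degree g)" "r' \<in> lowdeg (degree f)" "smult q x = p' * f + r' * g"
        using red[of p r] q(2) by auto
      obtain w where w: "mact ?S w = reflect_below ?N (p' * f + r' * g)"
        using sylvester_vector[OF pr(1,2)] by blast
      have "smult q (reflect_below ?N x) = mact ?S w" unfolding w pr(3)[symmetric] sm ..
      then show "reflect_below ?N x \<in> locim ?N u ?S"
        using q(1) reflect_below_lowdeg unfolding locim_def by blast
    qed
    show "\<exists>x\<in>lowdeg ?N. reflect_below ?N x - y \<in> locim ?N u ?S" if "y \<in> lowdeg ?N" for y
      using reflect_below_reflect_below[OF that] reflect_below_lowdeg P2.subspace_0[OF subspace_locim[OF S]]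
      by (intro bexI[of _ "reflect_below ?N y"]) auto
  qed (auto simp: subspace_lowdeg subspace_locim[OF S] reflect_below_lowdeg)
  also have "\<dots> = enat (order u (resultant f g))"
    using reldim_locim[OF S] res by (simp add: sylvester_det)
  finally show ?thesis .
qed

subsection \<open>Decomposition of a fibre into points\<close>

definition is_ideal :: "'c::comm_ring_1 set \<Rightarrow> bool" where
  "is_ideal Q \<longleftrightarrow> 0 \<in> Q \<and> (\<forall>x\<in>Q. \<forall>y\<in>Q. x + y \<in> Q) \<and> (\<forall>x\<in>Q. \<forall>r. r * x \<in> Q)"

lemma ideal_add: "is_ideal Q \<Longrightarrow> x \<in> Q \<Longrightarrow> y \<in> Q \<Longrightarrow> x + y \<in> Q"
  and ideal_mult: "is_ideal Q \<Longrightarrow> x \<in> Q \<Longrightarrow> r * x \<in> Q"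
  and ideal_mult': "is_ideal Q \<Longrightarrow> x \<in> Q \<Longrightarrow> x * r \<in> Q"
  and ideal_0: "is_ideal Q \<Longrightarrow> 0 \<in> Q"
  unfolding is_ideal_def by (auto simp: mult.commute)

lemma ideal_minus: "is_ideal Q \<Longrightarrow> x \<in> Q \<Longrightarrow> - x \<in> Q"
  using ideal_mult[of Q x "- 1"] by simp

lemma ideal_diff: "is_ideal Q \<Longrightarrow> x \<in> Q \<Longrightarrow> y \<in> Q \<Longrightarrow> x - y \<in> Q"
  using ideal_add[of Q x "- y"] ideal_minus[of Q y] by simp

lemma ideal_power_add:
  assumes Q: "is_ideal Q" "x \<in> Q" "z ^ n \<in> Q" shows "(x + z) ^ n \<in> Q"
proof -
  have "(x + z) ^ n - z ^ n = (x + z - z) * (\<Sum>i<n. z ^ (n - Suc i) * (x + z) ^ i)"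
    by (rule power_diff_sumr2)
  then have "(x + z) ^ n = x * (\<Sum>i<n. z ^ (n - Suc i) * (x + z) ^ i) + z ^ n" by (simp add: diff_eq_eq)
  then show ?thesis using ideal_add[OF Q(1) ideal_mult'[OF Q(1,2)] Q(3)] by metis
qed

lemma ideal_INT: "(\<And>c. is_ideal (J c)) \<Longrightarrow> is_ideal (\<Inter>c\<in>S. J c)"
  by (simp add: is_ideal_def)

lemma ideal_subspace:
  fixes Q :: "'k::field poly poly set"
  assumes "is_ideal Q" shows "P2.subspace Q"
proof (rule P2.subspaceI)
  show "smult [:c:] x \<in> Q" if "x \<in> Q" for c x
    using ideal_mult[OF assms that, of "[:[:c:]:]"] by simp
qed (use assms in \<open>auto intro: ideal_0 ideal_add\<close>)

definition lin_inner :: "'k::field \<Rightarrow> 'k poly poly" where "lin_inner a = [:[:-a, 1:]:]"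
definition lin_outer :: "'k::field \<Rightarrow> 'k poly poly" where "lin_outer c = [:[:-c:], 1:]"

definition val2 :: "'k::field poly poly \<Rightarrow> 'k \<Rightarrow> 'k \<Rightarrow> 'k" where "val2 q a b = poly (poly q [:b:]) a"

lemma val2_simps [simp]:
  "val2 (p * q) a b = val2 p a b * val2 q a b" "val2 (p + q) a b = val2 p a b + val2 q a b"
  "val2 (p ^ n) a b = val2 p a b ^ n" "val2 1 a b = 1" "val2 0 a b = 0"
  "val2 (lin_outer c) a b = b - c" "val2 (lin_inner c) a b = a - c"
  by (simp_all add: val2_def lin_outer_def lin_inner_def poly_power)

lemma val2_prod [simp]: "val2 (\<Prod>c\<in>S. h c) a b = (\<Prod>c\<in>S. val2 (h c) a b)"
  by (induction S rule: infinite_finite_induct) auto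

lemma expand_at_point:
  obtains y w where "q = [:[:val2 q a b:]:] + lin_inner a * y + lin_outer b * w"
proof -
  have "poly (q - [:poly q [:b:]:]) [:b:] = 0" by simp
  then obtain w where w: "q - [:poly q [:b:]:] = [:-[:b:], 1:] * w" unfolding poly_eq_0_iff_dvd by blast
  have "poly (poly q [:b:] - [:val2 q a b:]) a = 0" by (simp add: val2_def)
  then obtain y where y: "poly q [:b:] - [:val2 q a b:] = [:-a, 1:] * y" unfolding poly_eq_0_iff_dvd by blast
  have "q = [:poly q [:b:]:] + lin_outer b * w" using w by (simp add: lin_outer_def algebra_simps)
  also have "[:poly q [:b:]:] = [:[:val2 q a b:] + [:-a, 1:] * y:]" using y by (metis diff_eq_eq add.commute)
  also have "\<dots> = [:[:val2 q a b:]:] + lin_inner a * [:y:]" by (simp add: lin_inner_def)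
  finally show thesis using that by blast
qed

text \<open>Modulo \<open>Q\<close> the expansion of \<open>q\<close> at (a, c) is its nonzero value
  plus a multiple of \<open>lin_outer c\<close>. Multiplying by \<open>r\<close> kills that multiple
  and leaves a nonzero scalar times \<open>r\<close>.\<close>

lemma ideal_strip:
  fixes Q :: "'k::field poly poly set"
  assumes Q: "is_ideal Q" and U: "lin_inner a \<in> Q" and r: "lin_outer c * r \<in> Q"
    and q: "q \<in> Q" "val2 q a c \<noteq> 0"
  shows "r \<in> Q"
proof -
  obtain y w where qe: "q = [:[:val2 q a c:]:] + lin_inner a * y + lin_outer c * w" by (rule expand_at_point)
  have "[:[:val2 q a c:]:] * r = r * q - (y * r) * lin_inner a - w * (lin_outer c * r)"
    by (subst (2) qe) (simp add: algebra_simps)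
  also have "\<dots> \<in> Q"
    by (rule ideal_diff[OF Q ideal_diff[OF Q ideal_mult[OF Q q(1)] ideal_mult[OF Q U]] ideal_mult[OF Q r]])
  finally have "[:[:inverse (val2 q a c):]:] * ([:[:val2 q a c:]:] * r) \<in> Q" by (rule ideal_mult[OF Q])
  moreover have "[:[:inverse (val2 q a c):]:] * ([:[:val2 q a c:]:] * r) = r"
    using q(2) by (simp add: pCons_one flip: mult.assoc)
  ultimately show ?thesis by simp
qed

lemma ideal_strip_product:
  fixes Q :: "'k::field poly poly set"
  assumes Q: "is_ideal Q" "lin_inner a \<in> Q" and Z: "finite Z"
    and r: "(\<Prod>c\<in>Z. lin_outer c ^ e c) * r \<in> Q" and q: "\<And>c. c \<in> Z \<Longrightarrow> \<exists>q\<in>Q. val2 q a c \<noteq> 0"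
  shows "r \<in> Q"
  using Z r q
proof (induction Z arbitrary: r rule: finite_induct)
  case (insert c Z)
  obtain q where q: "q \<in> Q" "val2 q a c \<noteq> 0" using insert(5)[of c] by auto
  have strip: "s \<in> Q" if "lin_outer c ^ k * s \<in> Q" for k s
    using that
  proof (induction k)
    case (Suc k)
    then have "lin_outer c * (lin_outer c ^ k * s) \<in> Q" by (simp add: mult_ac)
    then show ?case using Suc.IH ideal_strip[OF Q _ q] by blast
  qed simp
  have "lin_outer c ^ e c * ((\<Prod>c\<in>Z. lin_outer c ^ e c) * r) \<in> Q"
    using insert(1,2,4) by (simp add: mult_ac)
  then show ?case using strip insert by blast
qed simp

text \<open>A Nullstellensatz on one fibre. Modulo \<open>lin_inner a\<close>, the product in
  \<open>D\<close> shows that only the points (a, c) can be common zeros, and \<open>q\<close>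
  excludes these; so 1 lies in the sum of \<open>Q\<close> and the ideal of
  \<open>lin_inner a\<close>. Nilpotency of \<open>lin_inner a\<close> modulo \<open>Q\<close> then
  moves 1 into \<open>Q\<close>.\<close>

lemma unit_ideal_criterion:
  fixes Q :: "'k::field poly poly set"
  assumes Q: "is_ideal Q" and N: "lin_inner a ^ N \<in> Q" and Z: "finite Z"
    and D: "(\<Prod>c\<in>Z. lin_outer c ^ e c) - lin_inner a * y \<in> Q"
    and q: "\<And>c. c \<in> Z \<Longrightarrow> \<exists>q\<in>Q. val2 q a c \<noteq> 0"
  shows "1 \<in> Q"
proof -
  define Q' where "Q' = {q + lin_inner a * y | q y. q \<in> Q}"
  have Q'I: "q + lin_inner a * y \<in> Q'" if "q \<in> Q" for q y using that unfolding Q'_def by blast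
  have ideal: "is_ideal Q'" unfolding is_ideal_def
  proof (intro conjI ballI allI)
    show "0 \<in> Q'" using Q'I[OF ideal_0[OF Q], of 0] by simp
    show "x + z \<in> Q'" if "x \<in> Q'" "z \<in> Q'" for x z
    proof -
      obtain q v where x: "x = q + lin_inner a * v" "q \<in> Q" using \<open>x \<in> Q'\<close> unfolding Q'_def by blast
      obtain q' v' where z: "z = q' + lin_inner a * v'" "q' \<in> Q" using \<open>z \<in> Q'\<close> unfolding Q'_def by blast
      have "x + z = (q + q') + lin_inner a * (v + v')" unfolding x z by (simp add: algebra_simps)
      then show ?thesis using Q'I ideal_add[OF Q x(2) z(2)] by metis
    qed
    show "r * x \<in> Q'" if "x \<in> Q'" for x r
    proof -
      obtain q v where *: "x = q + lin_inner a * v" "q \<in> Q" using \<open>x \<in> Q'\<close> unfolding Q'_def by blast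
      have "r * x = r * q + lin_inner a * (r * v)" unfolding * by (simp add: algebra_simps)
      then show ?thesis using Q'I ideal_mult[OF Q *(2)] by metis
    qed
  qed
  have sub: "Q \<subseteq> Q'" using Q'I[of _ 0] by auto
  have "1 \<in> Q'"
  proof (rule ideal_strip_product[OF ideal _ Z])
    show "lin_inner a \<in> Q'" using Q'I[OF ideal_0[OF Q], of 1] by simp
    show "(\<Prod>c\<in>Z. lin_outer c ^ e c) * 1 \<in> Q'" using Q'I[OF D, of y] by simp
    show "\<exists>q\<in>Q'. val2 q a c \<noteq> 0" if "c \<in> Z" for c using q[OF that] sub by blast
  qed
  then obtain q y where *: "1 = q + lin_inner a * y" "q \<in> Q" unfolding Q'_def by blast
  have "(lin_inner a * y) ^ N \<in> Q" unfolding power_mult_distrib by (rule ideal_mult'[OF Q N])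
  then have "(q + lin_inner a * y) ^ N \<in> Q" by (rule ideal_power_add[OF Q *(2)])
  then show ?thesis by (simp flip: *(1))
qed

definition pointideal :: "'k::field \<Rightarrow> 'k \<Rightarrow> 'k poly poly \<Rightarrow> 'k poly poly \<Rightarrow> 'k poly poly set" where
  "pointideal a b f g = {h. in_loc_ideal f g a b h}"

lemma pointideal_iff: "h \<in> pointideal a b f g \<longleftrightarrow> (\<exists>q u v. val2 q a b \<noteq> 0 \<and> q * h = u * f + v * g)"
  unfolding pointideal_def in_loc_ideal_def val2_def by simp

lemma aff_imult_reldim: "aff_imult f g a b = P2.reldim UNIV (pointideal a b f g)"
  unfolding aff_imult_def P2.reldim_def P2.indep_mod_def pointideal_def by simp

lemma is_ideal_pointideal: "is_ideal (pointideal a b f g)"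
  unfolding is_ideal_def
proof (intro conjI ballI allI)
  show "0 \<in> pointideal a b f g" unfolding pointideal_iff by (rule exI[of _ 1], rule exI[of _ 0], rule exI[of _ 0]) simp
next
  fix x y assume "x \<in> pointideal a b f g" "y \<in> pointideal a b f g"
  then obtain q u v q' u' v' where *: "val2 q a b \<noteq> 0" "q * x = u * f + v * g"
    "val2 q' a b \<noteq> 0" "q' * y = u' * f + v' * g" unfolding pointideal_iff by blast
  have "(q * q') * (x + y) = q' * (q * x) + q * (q' * y)" by (simp add: algebra_simps)
  also have "\<dots> = (q' * u + q * u') * f + (q' * v + q * v') * g" unfolding * by (simp add: algebra_simps)
  finally have "(q * q') * (x + y) = (q' * u + q * u') * f + (q' * v + q * v') * g" .
  moreover have "val2 (q * q') a b \<noteq> 0" using * by simp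
  ultimately show "x + y \<in> pointideal a b f g" unfolding pointideal_iff by blast
next
  fix x r assume "x \<in> pointideal a b f g"
  then obtain q u v where *: "val2 q a b \<noteq> 0" "q * x = u * f + v * g" unfolding pointideal_iff by blast
  have "q * (r * x) = r * (q * x)" by (simp add: algebra_simps)
  also have "\<dots> = (r * u) * f + (r * v) * g" unfolding * by (simp add: algebra_simps)
  finally show "r * x \<in> pointideal a b f g" using *(1) unfolding pointideal_iff by blast
qed

lemma pointideal_saturated:
  assumes "val2 q a b \<noteq> 0" "q * h \<in> pointideal a b f g" shows "h \<in> pointideal a b f g"
proof -
  obtain p u v where *: "val2 p a b \<noteq> 0" "p * (q * h) = u * f + v * g"
    using assms(2) unfolding pointideal_iff by blast
  then have "val2 (p * q) a b \<noteq> 0 \<and> (p * q) * h = u * f + v * g" using assms(1) by (simp add: mult_ac)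
  then show ?thesis unfolding pointideal_iff by blast
qed

lemma is_ideal_locideal: "is_ideal (locideal a f g)"
  unfolding is_ideal_def
proof (intro conjI ballI allI)
  show "0 \<in> locideal a f g" "\<And>x y. x \<in> locideal a f g \<Longrightarrow> y \<in> locideal a f g \<Longrightarrow> x + y \<in> locideal a f g"
    using subspace_locideal[of a f g] unfolding P2.subspace_def by blast+
  fix x r assume "x \<in> locideal a f g"
  then obtain q p s where *: "poly q a \<noteq> 0" "smult q x = p * f + s * g" unfolding locideal_def by blast
  have "smult q (r * x) = r * smult q x" by simp
  also have "\<dots> = (r * p) * f + (r * s) * g" unfolding * by (simp add: algebra_simps)
  finally show "r * x \<in> locideal a f g" using *(1) unfolding locideal_def by blast
qed

lemma locideal_subset: "locideal a f g \<subseteq> pointideal a b f g"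
proof
  fix h assume "h \<in> locideal a f g"
  then obtain q p s where *: "poly q a \<noteq> 0" "smult q h = p * f + s * g" unfolding locideal_def by blast
  then have "val2 [:q:] a b \<noteq> 0 \<and> [:q:] * h = p * f + s * g" by (simp add: val2_def)
  then show "h \<in> pointideal a b f g" unfolding pointideal_iff by blast
qed

text \<open>Multiplication by \<open>k\<close> maps everything into \<open>K\<close> and is the
  identity modulo \<open>I\<close>, so \<open>K\<close> modulo the intersection has the dimension of
  the whole ring modulo \<open>I\<close>.\<close>

lemma reldim_Int_comaximal:
  fixes I K :: "'k::field poly poly set"
  assumes "is_ideal I" "is_ideal K" "i \<in> I" "k \<in> K" "i + k = 1"
  shows "P2.reldim UNIV (I \<inter> K) = P2.reldim UNIV I + P2.reldim UNIV K"
proof -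
  have IK: "is_ideal (I \<inter> K)" using assms(1,2) unfolding is_ideal_def by blast
  have "P2.reldim K (I \<inter> K) = P2.reldim UNIV I"
  proof (rule P2.reldim_map[where f = "\<lambda>x. x"])
    show "\<exists>x\<in>K. x - y \<in> I" for y
    proof (rule bexI)
      have k: "k = 1 - i" using assms(5) by (simp add: eq_diff_eq add.commute)
      have "k * y - y = (- y) * i" unfolding k by (simp add: algebra_simps)
      then show "k * y - y \<in> I" using ideal_mult[OF assms(1,3)] by metis
      show "k * y \<in> K" by (rule ideal_mult'[OF assms(2,4)])
    qed
  qed (auto simp: ideal_subspace assms)
  moreover have "P2.reldim UNIV (I \<inter> K) = P2.reldim UNIV K + P2.reldim K (I \<inter> K)"
    by (rule P2.reldim_tower) (auto simp: ideal_subspace assms IK)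
  ultimately show ?thesis by (simp add: add.commute)
qed

text \<open>Chinese remainder theorem on the fibre over the inner coordinate \<open>a\<close>: the hypotheses say that
  \<open>f\<close> and \<open>g\<close> have no common zeros on this line besides the points \<open>(a, c)\<close>, \<open>c \<in> Z\<close>.\<close>

lemma reldim_locideal_sum:
  fixes f g :: "'k::field poly poly"
  assumes N: "lin_inner a ^ N \<in> locideal a f g" and Z: "finite Z"
    and D: "(\<Prod>c\<in>Z. lin_outer c ^ e c) = p * f + r * g + lin_inner a * y"
  shows "P2.reldim UNIV (locideal a f g) = (\<Sum>c\<in>Z. aff_imult f g a c)"
proof -
  let ?I = "locideal a f g" and ?J = "\<lambda>c. pointideal a c f g"
  let ?D = "\<Prod>c\<in>Z. lin_outer c ^ e c"
  note id0 = is_ideal_locideal[of a f g]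
  have fg: "p * f + r * g \<in> ?I" by (rule locideal_combination)
  \<comment> \<open>If \<open>h\<close> lies in every point ideal, then for each (a, c) some
    multiplier that is nonzero there carries \<open>h\<close> into \<open>?I\<close>. The criterion
    makes the ideal of all multipliers the unit ideal, so 1 is a multiplier.\<close>
  have J0: "?I = (\<Inter>c\<in>Z. ?J c)"
  proof (rule subset_antisym[OF _ subsetI])
    fix h assume h: "h \<in> (\<Inter>c\<in>Z. ?J c)"
    have "1 \<in> {q. q * h \<in> ?I}"
    proof (rule unit_ideal_criterion[where N = N, OF _ _ Z])
      show "is_ideal {q. q * h \<in> ?I}"
        using id0 unfolding is_ideal_def by (auto simp: ring_distribs mult.assoc)
      show "lin_inner a ^ N \<in> {q. q * h \<in> ?I}" using ideal_mult'[OF id0 N] by simp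
      show "?D - lin_inner a * y \<in> {q. q * h \<in> ?I}"
        unfolding D using ideal_mult'[OF id0 fg] by simp
      show "\<exists>q\<in>{q. q * h \<in> ?I}. val2 q a c \<noteq> 0" if "c \<in> Z" for c
        using h that unfolding pointideal_iff using locideal_combination
        by (metis (mono_tags, lifting) INT_E mem_Collect_eq pointideal_iff)
    qed
    then show "h \<in> ?I" by simp
  qed (use locideal_subset in blast)
  \<comment> \<open>\<open>?D\<close> is nilpotent modulo \<open>?I\<close>: by \<open>D\<close> it
    is a member of \<open>?I\<close> plus a multiple of the nilpotent
    \<open>lin_inner a\<close>.\<close>
  have "?D ^ N \<in> ?I"
    unfolding D using ideal_power_add[OF id0 fg] ideal_mult'[OF id0 N, of "y ^ N"]
    by (simp add: power_mult_distrib)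
  \<comment> \<open>At (a, c) the factors belonging to the other points do not vanish and can be
    cancelled.\<close>
  then have Xc: "lin_outer c ^ (e c * N) \<in> ?J c" if c: "c \<in> Z" for c
  proof -
    have "?D = (\<Prod>c'\<in>Z-{c}. lin_outer c' ^ e c') * lin_outer c ^ e c"
      using prod.remove[OF Z c, of "\<lambda>c. lin_outer c ^ e c"] by (simp add: mult.commute)
    then have "(\<Prod>c'\<in>Z-{c}. lin_outer c' ^ e c') ^ N * lin_outer c ^ (e c * N) = ?D ^ N"
      by (simp add: power_mult_distrib power_mult)
    then have "(\<Prod>c'\<in>Z-{c}. lin_outer c' ^ e c') ^ N * lin_outer c ^ (e c * N) \<in> ?J c"
      using subsetD[OF locideal_subset \<open>?D ^ N \<in> ?I\<close>] by simp
    then show ?thesis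
      by (rule pointideal_saturated[rotated]) (use Z in auto)
  qed
  have "P2.reldim UNIV (\<Inter>c\<in>S. ?J c) = (\<Sum>c\<in>S. aff_imult f g a c)" if "S \<subseteq> Z" for S
    using finite_subset[OF that Z] that
  proof (induction S rule: finite_induct)
    case empty
    show ?case by (simp add: P2.reldim_self P2.subspace_UNIV)
  next
    case (insert c S)
    let ?K = "\<Inter>c\<in>S. ?J c"
    have K: "is_ideal ?K" by (rule ideal_INT[OF is_ideal_pointideal])
    \<comment> \<open>The two ideals are comaximal: the one of \<open>c\<close> contains a power of
      \<open>lin_outer c\<close>, which is nonzero at the points of \<open>S\<close>, and
      \<open>?K\<close> contains a product of powers of \<open>lin_outer\<close> over
      \<open>S\<close>.\<close>
    have "1 \<in> {i + k | i k. i \<in> ?J c \<and> k \<in> ?K}"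
    proof (rule unit_ideal_criterion[where N = N, OF _ _ insert(1)])
      let ?Q = "{i + k | i k. i \<in> ?J c \<and> k \<in> ?K}"
      have QI: "i \<in> ?Q" if "i \<in> ?J c" for i using that ideal_0[OF K] by (intro CollectI exI[of _ i] exI[of _ 0]) auto
      have QK: "k \<in> ?Q" if "k \<in> ?K" for k
        using that ideal_0[OF is_ideal_pointideal[of a c f g]] by (intro CollectI exI[of _ 0] exI[of _ k]) auto
      show "is_ideal ?Q" unfolding is_ideal_def
      proof (intro conjI ballI allI)
        show "0 \<in> ?Q" by (rule QK[OF ideal_0[OF K]])
        show "x + y \<in> ?Q" if xy: "x \<in> ?Q" "y \<in> ?Q" for x y
        proof -
          obtain i k where x: "x = i + k" "i \<in> ?J c" "k \<in> ?K" using xy(1) by blast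
          obtain i' k' where y: "y = i' + k'" "i' \<in> ?J c" "k' \<in> ?K" using xy(2) by blast
          have "x + y = (i + i') + (k + k')" unfolding x y by simp
          moreover have "i + i' \<in> ?J c" by (rule ideal_add[OF is_ideal_pointideal x(2) y(2)])
          moreover have "k + k' \<in> ?K" by (rule ideal_add[OF K x(3) y(3)])
          ultimately show ?thesis by blast
        qed
        show "t * x \<in> ?Q" if x: "x \<in> ?Q" for t x
        proof -
          obtain i k where *: "x = i + k" "i \<in> ?J c" "k \<in> ?K" using x by blast
          have "t * x = t * i + t * k" unfolding * by (simp add: ring_distribs)
          then show ?thesis using ideal_mult[OF is_ideal_pointideal *(2)] ideal_mult[OF K *(3)] by blast
        qed
      qed
      show "lin_inner a ^ N \<in> ?Q" using QI N locideal_subset by blast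
      have "(\<Prod>c\<in>S. lin_outer c ^ (e c * N)) \<in> ?J c'" if c': "c' \<in> S" for c'
        unfolding prod.remove[OF insert(1) c'] by (rule ideal_mult'[OF is_ideal_pointideal Xc]) (use c' insert in auto)
      then show "(\<Prod>c\<in>S. lin_outer c ^ (e c * N)) - lin_inner a * 0 \<in> ?Q" by (intro QK) auto
      show "\<exists>q\<in>?Q. val2 q a c' \<noteq> 0" if "c' \<in> S" for c'
        by (rule bexI[OF _ QI[OF Xc]]) (use that insert in auto)
    qed
    then obtain i k where ik: "i \<in> ?J c" "k \<in> ?K" "1 = i + k" by blast
    show ?case
      using reldim_Int_comaximal[OF is_ideal_pointideal K ik(1,2) ik(3)[symmetric]] insert
      by (simp add: aff_imult_reldim)
  qed
  then show ?thesis unfolding J0 by blast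
qed

lemma sum_aff_imult_resultant:
  fixes f g :: "'k::field poly poly"
  assumes lc: "lead_coeff f * c0 = 1" and res: "resultant f g \<noteq> 0" and Z: "finite Z"
    and D: "(\<Prod>c\<in>Z. lin_outer c ^ e c) = p * f + r * g + lin_inner a * y"
  shows "(\<Sum>c\<in>Z. aff_imult f g a c) = enat (order a (resultant f g))"
proof -
  have "\<exists>N. lin_inner a ^ N \<in> locideal a f g"
  proof (cases "degree f + degree g = 0")
    \<comment> \<open>Two constants have resultant 1, which says nothing about the ideal they
      generate; here \<open>f\<close> itself is a unit.\<close>
    case True
    then obtain c1 where "f = [:c1:]" by (metis add_is_0 degree_eq_zeroE)
    then have "[:c0:] * f + 0 * g = 1" using lc by (simp add: mult.commute pCons_one)
    then show ?thesis using locideal_combination[of "[:c0:]" f 0 g a] by (intro exI[of _ 0]) simp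
  next
    case False
    then have "degree f + degree g > 0" by simp
    from resultant_in_ideal[OF this] obtain p r where pr: "[:resultant f g:] = p * f + r * g" by blast
    obtain n q where q: "resultant f g = [:-a, 1:] ^ n * q" "\<not> [:-a, 1:] dvd q"
      using order_decomp[OF res] by blast
    \<comment> \<open>The resultant lies in the ideal, and its cofactor \<open>q\<close> does not
      vanish at \<open>a\<close>, so it is an admissible denominator.\<close>
    have "smult q (lin_inner a ^ n) = [:resultant f g:]"
      unfolding q(1) by (simp add: lin_inner_def poly_const_pow mult.commute)
    then have "lin_inner a ^ n \<in> locideal a f g"
      using q(2) pr unfolding locideal_def poly_eq_0_iff_dvd[symmetric] by (auto simp: poly_eq_0_iff_dvd)
    then show ?thesis by blast
  qed
  then obtain N where "lin_inner a ^ N \<in> locideal a f g" by blast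
  from reldim_locideal_sum[OF this Z D] show ?thesis using reldim_locideal[OF lc res] by simp
qed

text \<open>At a common zero the ideal is proper, so 1 alone is an independent family. This ensures
  that every line through a base point has positive order and is counted.\<close>

lemma aff_imult_pos:
  fixes f g :: "'a::field poly poly"
  assumes "val2 f a b = 0" "val2 g a b = 0" shows "aff_imult f g a b \<noteq> 0"
proof -
  have "1 \<notin> pointideal a b f g" using assms by (auto simp: pointideal_iff)
  have "(\<forall>i<1. 1 \<in> (UNIV :: 'a poly poly set)) \<and> P2.indep_mod (pointideal a b f g) 1 (\<lambda>_. 1)"
    unfolding P2.indep_mod_def
  proof (intro conjI allI impI UNIV_I)
    fix c i assume h: "(\<Sum>i<1::nat. smult [:c i:] 1) \<in> pointideal a b f g" and i: "i < (1::nat)"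
    then have "[:[:inverse (c 0):]:] * smult [:c 0:] 1 \<in> pointideal a b f g"
      by (intro ideal_mult[OF is_ideal_pointideal]) simp
    moreover have "[:[:inverse (c 0):]:] * smult [:c 0:] 1 = (1 :: 'a poly poly)" if "c 0 \<noteq> 0"
      using that by (simp add: pCons_one)
    ultimately have "c 0 = 0" using \<open>1 \<notin> pointideal a b f g\<close> by metis
    then show "c i = 0" using i by simp
  qed
  then have "enat 1 \<in> {enat n | n. \<exists>h. (\<forall>i<n. h i \<in> (UNIV :: 'a poly poly set)) \<and> P2.indep_mod (pointideal a b f g) n h}"
    by (intro CollectI exI[of _ 1] conjI[OF refl] exI[of _ "\<lambda>_. 1"])
  then have "enat 1 \<le> aff_imult f g a b"
    unfolding aff_imult_reldim P2.reldim_def by (rule Sup_upper)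
  then show ?thesis by (auto simp: zero_enat_def)
qed

subsection \<open>Gradings\<close>

text \<open>Weights are integers, so that the weight \<open>n - i\<close> of the \<open>i\<close>-th coefficient of a form of weight
  \<open>n\<close> needs no side condition \<open>i \<le> n\<close>.\<close>

definition const_wt :: "int \<Rightarrow> 'c::zero \<Rightarrow> bool" where
  "const_wt n c \<longleftrightarrow> n = 0 \<or> c = 0"

definition poly_wt :: "(int \<Rightarrow> 'c::zero \<Rightarrow> bool) \<Rightarrow> int \<Rightarrow> 'c poly \<Rightarrow> bool" where
  "poly_wt P n p \<longleftrightarrow> (\<forall>i. P (n - int i) (coeff p i))"

text \<open>The variable carries weight 0 here and weight 1 in \<open>poly_wt\<close>; the six
  indeterminates are of the first kind, t1, t2 and t3 of the second.\<close>

definition coeff_wt :: "(int \<Rightarrow> 'c::zero \<Rightarrow> bool) \<Rightarrow> int \<Rightarrow> 'c poly \<Rightarrow> bool" where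
  "coeff_wt P n p \<longleftrightarrow> (\<forall>i. P n (coeff p i))"

locale grading =
  fixes P :: "int \<Rightarrow> 'c::comm_ring_1 \<Rightarrow> bool"
  assumes zero: "P n 0" and one: "P 0 1"
    and add: "P n a \<Longrightarrow> P n b \<Longrightarrow> P n (a + b)"
    and uminus: "P n a \<Longrightarrow> P n (- a)"
    and mult: "P m a \<Longrightarrow> P n b \<Longrightarrow> P (m + n) (a * b)"
begin

lemma sum: "(\<And>x. x \<in> A \<Longrightarrow> P n (f x)) \<Longrightarrow> P n (sum f A)"
  by (induction A rule: infinite_finite_induct) (auto simp: zero add)

lemma prod: "(\<And>x. x \<in> A \<Longrightarrow> P (w x) (f x)) \<Longrightarrow> P (sum w A) (prod f A)"
  by (induction A rule: infinite_finite_induct) (auto simp: one mult)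

lemma diff: "P n a \<Longrightarrow> P n b \<Longrightarrow> P n (a - b)"
  using add[of n a "- b"] uminus by simp

text \<open>In the Leibniz expansion every permutation gives a product of the same weight, since
  permuting the columns does not change the sum of \<open>c\<close>.\<close>

lemma det:
  assumes A: "A \<in> carrier_mat N N"
    and w: "\<And>i j. i < N \<Longrightarrow> j < N \<Longrightarrow> P (c j - r i) (A $$ (i, j))"
  shows "P ((\<Sum>j<N. c j) - (\<Sum>i<N. r i)) (det A)"
proof -
  have "P ((\<Sum>j<N. c j) - (\<Sum>i<N. r i)) (of_int (sign p) * (\<Prod>i = 0..<N. A $$ (i, p i)))"
    if p: "p permutes {0..<N}" for p
  proof -
    have "P (\<Sum>i = 0..<N. c (p i) - r i) (\<Prod>i = 0..<N. A $$ (i, p i))"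
      using permutes_in_image[OF p] by (intro prod w) auto
    also have "(\<Sum>i = 0..<N. c (p i) - r i) = (\<Sum>j<N. c j) - (\<Sum>i<N. r i)"
      using sum.permute[OF p, of c] by (simp add: sum_subtractf o_def atLeast0LessThan)
    finally have "P ((\<Sum>j<N. c j) - (\<Sum>i<N. r i)) (\<Prod>i = 0..<N. A $$ (i, p i))" .
    then show ?thesis by (cases p rule: sign_cases) (auto intro: uminus)
  qed
  then show ?thesis using A unfolding det_def by (auto intro!: sum)
qed

lemma poly_wt: "grading (poly_wt P)"
proof
  show "poly_wt P 0 1" unfolding poly_wt_def by (auto simp: one zero coeff_1)
  show "poly_wt P (m + n) (a * b)" if "poly_wt P m a" "poly_wt P n b" for m n a b
    unfolding poly_wt_def coeff_mult
  proof (intro allI sum)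
    fix i j :: nat assume "j \<in> {..i}"
    then have "m + n - int i = (m - int j) + (n - int (i - j))" by auto
    then show "P (m + n - int i) (coeff a j * coeff b (i - j))"
      using that unfolding poly_wt_def by (metis mult)
  qed
qed (auto simp: poly_wt_def zero add uminus)

lemma coeff_wt: "grading (coeff_wt P)"
proof
  show "coeff_wt P 0 1" unfolding coeff_wt_def by (auto simp: one zero coeff_1)
  show "coeff_wt P (m + n) (a * b)" if "coeff_wt P m a" "coeff_wt P n b" for m n a b
    unfolding coeff_wt_def coeff_mult using that unfolding coeff_wt_def by (intro allI sum mult) auto
qed (auto simp: coeff_wt_def zero add uminus)

end

lemma grading_const_wt: "grading (const_wt :: int \<Rightarrow> 'c::comm_ring_1 \<Rightarrow> bool)"
  by unfold_locales (auto simp: const_wt_def)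

definition hom2 :: "nat \<Rightarrow> 'c::zero poly poly \<Rightarrow> bool" where
  "hom2 d c \<longleftrightarrow> (\<forall>i j. coeff (coeff c j) i \<noteq> 0 \<longrightarrow> i + j = d)"

lemma hom2_wt: "hom2 d c \<longleftrightarrow> poly_wt (poly_wt const_wt) (int d) c"
proof -
  have "int d - int j - int i = 0 \<longleftrightarrow> i + j = d" for i j by linarith
  then show ?thesis unfolding hom2_def poly_wt_def const_wt_def by blast
qed

lemma hom3_wt: "hom3 d s \<longleftrightarrow> poly_wt (poly_wt (poly_wt const_wt)) (int d) s"
proof -
  have "int d - int k - int j - int i = 0 \<longleftrightarrow> i + j + k = d" for i j k by linarith
  then show ?thesis unfolding hom3_def poly_wt_def const_wt_def by blast
qed

lemma grading2: "grading (poly_wt (poly_wt (const_wt :: int \<Rightarrow> 'c::comm_ring_1 \<Rightarrow> bool)))"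
  by (intro grading.poly_wt grading_const_wt)

lemma grading3: "grading (poly_wt (poly_wt (poly_wt (const_wt :: int \<Rightarrow> 'c::comm_ring_1 \<Rightarrow> bool))))"
  by (intro grading.poly_wt grading_const_wt)

lemma hom3_add: "hom3 d p \<Longrightarrow> hom3 d q \<Longrightarrow> hom3 d (p + q)" for p :: "'c::comm_ring_1 poly poly poly"
  unfolding hom3_wt by (rule grading.add[OF grading3])

lemma hom3_diff: "hom3 d p \<Longrightarrow> hom3 d q \<Longrightarrow> hom3 d (p - q)" for p :: "'c::comm_ring_1 poly poly poly"
  unfolding hom3_wt by (rule grading.diff[OF grading3])

lemma hom3_mult: "hom3 d p \<Longrightarrow> hom3 e q \<Longrightarrow> hom3 (d + e) (p * q)" for p :: "'c::comm_ring_1 poly poly poly"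
  unfolding hom3_wt of_nat_add by (rule grading.mult[OF grading3])

lemma hom3_smult: "hom3 d p \<Longrightarrow> hom3 d (smult [:[:c:]:] p)" for p :: "'c::comm_ring_1 poly poly poly"
  unfolding hom3_def by (simp add: coeff_pCons) (metis mult_zero_right)

lemma hom3_0: "hom3 d 0"
  by (simp add: hom3_def)

lemma hom3_sum: "(\<And>x. x \<in> A \<Longrightarrow> hom3 d (f x)) \<Longrightarrow> hom3 d (sum f A)" for f :: "'b \<Rightarrow> 'c::comm_ring_1 poly poly poly"
  by (induction A rule: infinite_finite_induct) (auto intro: hom3_add hom3_0)

lemma hom2_mult: "hom2 d p \<Longrightarrow> hom2 e q \<Longrightarrow> hom2 (d + e) (p * q)" for p :: "'c::comm_ring_1 poly poly"
  unfolding hom2_wt of_nat_add by (rule grading.mult[OF grading2])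

lemma ev3_altdef: "ev3 H (a1, a2, a3) = (\<Sum>k\<le>degree H. \<Sum>j\<le>degree (coeff H k). \<Sum>i\<le>degree (coeff (coeff H k) j).
    coeff (coeff (coeff H k) j) i * a1 ^ i * a2 ^ j * a3 ^ k)"
proof -
  have 1: "poly H [:[:a3:]:] = (\<Sum>k\<le>degree H. coeff H k * [:[:a3 ^ k:]:])"
    by (subst poly_altdef) (simp add: poly_const_pow)
  have 2: "poly (poly H [:[:a3:]:]) [:a2:] = (\<Sum>k\<le>degree H. poly (coeff H k) [:a2:] * [:a3 ^ k:])"
    unfolding 1 by (simp add: poly_sum)
  have 3: "poly (poly (poly H [:[:a3:]:]) [:a2:]) a1 = (\<Sum>k\<le>degree H. poly (poly (coeff H k) [:a2:]) a1 * a3 ^ k)"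
    unfolding 2 by (simp add: poly_sum mult.commute)
  have 4: "poly (poly c [:a2:]) a1 = (\<Sum>j\<le>degree c. poly (coeff c j) a1 * a2 ^ j)" for c
    by (subst poly_altdef) (simp add: poly_const_pow poly_sum mult.commute)
  show ?thesis unfolding ev3_def prod.case 3 unfolding 4
    by (simp add: sum_distrib_right poly_altdef[of "coeff _ _" a1])
qed

lemma ev3_scale:
  assumes "hom3 d H"
  shows "ev3 H (l * a1, l * a2, l * a3) = l ^ d * ev3 H (a1, a2, a3)"
proof -
  have "coeff (coeff (coeff H k) j) i * (l * a1) ^ i * (l * a2) ^ j * (l * a3) ^ k =
     l ^ d * (coeff (coeff (coeff H k) j) i * a1 ^ i * a2 ^ j * a3 ^ k)" for i j k
  proof (cases "coeff (coeff (coeff H k) j) i = 0")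
    case False
    then have "d = i + j + k" using assms unfolding hom3_def by auto
    then show ?thesis by (simp add: power_add power_mult_distrib mult_ac)
  qed simp
  then show ?thesis unfolding ev3_altdef sum_distrib_left by simp
qed

subsection \<open>Independence of the affine chart\<close>

text \<open>Denominators are forms not vanishing at \<open>p\<close>, so that no affine chart is involved.\<close>

definition hlocal :: "'k::field poly poly poly \<Rightarrow> 'k poly poly poly \<Rightarrow> 'k \<times> 'k \<times> 'k \<Rightarrow> 'k poly poly poly \<Rightarrow> bool" where
  "hlocal f g p h \<longleftrightarrow> (\<exists>d q u v. hom3 d q \<and> ev3 q p \<noteq> 0 \<and> q * h = u * f + v * g)"

text \<open>All members of a family share one degree \<open>d\<close>, so that their linear
  combinations are again forms. The degree is not fixed in advance, since lifting a family from a
  chart may require a large one.\<close>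

definition hmult :: "'k::field poly poly poly \<Rightarrow> 'k poly poly poly \<Rightarrow> 'k \<times> 'k \<times> 'k \<Rightarrow> enat" where
  "hmult f g p = Sup {enat n | n. \<exists>d h. (\<forall>i<n. hom3 d (h i)) \<and>
     (\<forall>c :: nat \<Rightarrow> 'k. hlocal f g p (\<Sum>i<n. smult [:[:c i:]:] (h i)) \<longrightarrow> (\<forall>i<n. c i = 0))}"

lemma hmult_scale:
  assumes "l \<noteq> 0" shows "hmult f g (l * a1, l * a2, l * a3) = hmult f g (a1, a2, a3)"
proof -
  have "hlocal f g (l * a1, l * a2, l * a3) = hlocal f g (a1, a2, a3)"
    unfolding hlocal_def fun_eq_iff using assms by (metis ev3_scale mult_eq_0_iff power_not_zero)
  then show ?thesis unfolding hmult_def by simp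
qed

text \<open>The common properties of the three dehomogenizations. Lifts exist in all large degrees,
  so several lifts can be given matching degrees; an identity between forms of one degree can then
  be checked in the chart by \<open>inj\<close>.\<close>

locale chart =
  fixes \<phi> :: "'k::field poly poly poly \<Rightarrow> 'k poly poly" and pt :: "'k \<times> 'k \<times> 'k" and a b :: 'k
  assumes add: "\<phi> (p + q) = \<phi> p + \<phi> q" and mult: "\<phi> (p * q) = \<phi> p * \<phi> q"
    and scale: "\<phi> (smult [:[:c:]:] p) = smult [:c:] (\<phi> p)"
    and lift: "\<exists>d0. \<forall>d\<ge>d0. \<exists>H. hom3 d H \<and> \<phi> H = h"
    and inj: "hom3 d H \<Longrightarrow> \<phi> H = 0 \<Longrightarrow> H = 0"
    and eval: "val2 (\<phi> H) a b = ev3 H pt"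
begin

lemma zero: "\<phi> 0 = 0" using scale[of 0 0] by simp

lemma diff: "\<phi> (p - q) = \<phi> p - \<phi> q" using add[of "p - q" q] by simp

lemma sum: "\<phi> (sum h A) = (\<Sum>x\<in>A. \<phi> (h x))"
  by (induction A rule: infinite_finite_induct) (auto simp: zero add)

lemma hlocal_iff:
  assumes f: "hom3 df f" and g: "hom3 dg g" and h: "hom3 dh h"
  shows "hlocal f g pt h \<longleftrightarrow> in_loc_ideal (\<phi> f) (\<phi> g) a b (\<phi> h)"
proof
  assume "hlocal f g pt h"
  then obtain q u v where "ev3 q pt \<noteq> 0" "q * h = u * f + v * g" unfolding hlocal_def by blast
  then have "val2 (\<phi> q) a b \<noteq> 0" "\<phi> q * \<phi> h = \<phi> u * \<phi> f + \<phi> v * \<phi> g"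
    using eval[of q] by (simp_all flip: mult add)
  then show "in_loc_ideal (\<phi> f) (\<phi> g) a b (\<phi> h)" unfolding in_loc_ideal_def val2_def by blast
next
  assume "in_loc_ideal (\<phi> f) (\<phi> g) a b (\<phi> h)"
  then obtain q u v where q: "val2 q a b \<noteq> 0" "q * \<phi> h = u * \<phi> f + v * \<phi> g"
    unfolding in_loc_ideal_def val2_def by blast
  obtain nq where nq: "\<And>d. d \<ge> nq \<Longrightarrow> \<exists>H. hom3 d H \<and> \<phi> H = q" using lift by blast
  obtain nu where nu: "\<And>d. d \<ge> nu \<Longrightarrow> \<exists>H. hom3 d H \<and> \<phi> H = u" using lift by blast
  obtain nv where nv: "\<And>d. d \<ge> nv \<Longrightarrow> \<exists>H. hom3 d H \<and> \<phi> H = v" using lift by blast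
  \<comment> \<open>The degrees of the three lifts are chosen so that q' h, u' f and v' g are all
    forms of degree M + df + dg + dh, where \<open>inj\<close> applies.\<close>
  define M where "M = nq + nu + nv"
  obtain q' where q': "hom3 (M + df + dg) q'" "\<phi> q' = q" using nq[of "M + df + dg"] by (auto simp: M_def)
  obtain u' where u': "hom3 (M + dg + dh) u'" "\<phi> u' = u" using nu[of "M + dg + dh"] by (auto simp: M_def)
  obtain v' where v': "hom3 (M + df + dh) v'" "\<phi> v' = v" using nv[of "M + df + dh"] by (auto simp: M_def)
  have "hom3 (M + df + dg + dh) (q' * h - (u' * f + v' * g))"
    using hom3_mult[OF q'(1) h] hom3_mult[OF u'(1) f] hom3_mult[OF v'(1) g]
    by (intro hom3_diff hom3_add) (simp_all add: add.commute add.left_commute)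
  moreover have "\<phi> (q' * h - (u' * f + v' * g)) = 0"
    using q(2) by (simp add: diff add mult q' u' v')
  ultimately have "q' * h - (u' * f + v' * g) = 0" by (rule inj)
  then have "q' * h = u' * f + v' * g" by simp
  moreover have "ev3 q' pt \<noteq> 0" using q(1) eval[of q'] q'(2) by simp
  ultimately show "hlocal f g pt h" unfolding hlocal_def using q'(1) by blast
qed

lemma lift_family:
  fixes h :: "nat \<Rightarrow> 'k poly poly"
  shows "\<exists>d H. \<forall>i<n. hom3 d (H i) \<and> \<phi> (H i) = h i"
proof -
  have "\<forall>i. \<exists>d0. \<forall>d\<ge>d0. \<exists>H. hom3 d H \<and> \<phi> H = h i" using lift by blast
  then obtain d0 where d0: "\<And>i d. d \<ge> d0 i \<Longrightarrow> \<exists>H. hom3 d H \<and> \<phi> H = h i" by metis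
  have "d0 i \<le> (\<Sum>i<n. d0 i)" if "i < n" for i using that by (intro member_le_sum) auto
  then have "\<forall>i. \<exists>H. i < n \<longrightarrow> hom3 (\<Sum>i<n. d0 i) H \<and> \<phi> H = h i" using d0 by blast
  then obtain H where "\<forall>i. i < n \<longrightarrow> hom3 (\<Sum>i<n. d0 i) (H i) \<and> \<phi> (H i) = h i" by metis
  then show ?thesis by blast
qed

lemma aff_imult_eq_hmult:
  assumes f: "hom3 df f" and g: "hom3 dg g"
  shows "aff_imult (\<phi> f) (\<phi> g) a b = hmult f g pt"
proof -
  have key: "hlocal f g pt (\<Sum>i<n. smult [:[:c i:]:] (H i)) \<longleftrightarrow>
      in_loc_ideal (\<phi> f) (\<phi> g) a b (\<Sum>i<n. smult [:c i:] (\<phi> (H i)))"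
    if "\<forall>i<n. hom3 d (H i)" for n :: nat and d c H
    using hlocal_iff[OF f g, of d "\<Sum>i<n. smult [:[:c i:]:] (H i)"] that
    by (auto simp: sum scale intro!: hom3_sum hom3_smult)
  have "(\<exists>h :: nat \<Rightarrow> 'k poly poly. \<forall>c :: nat \<Rightarrow> 'k.
          in_loc_ideal (\<phi> f) (\<phi> g) a b (\<Sum>i<n. smult [:c i:] (h i)) \<longrightarrow> (\<forall>i<n. c i = 0)) \<longleftrightarrow>
     (\<exists>d h. (\<forall>i<n. hom3 d (h i)) \<and>
     (\<forall>c :: nat \<Rightarrow> 'k. hlocal f g pt (\<Sum>i<n. smult [:[:c i:]:] (h i)) \<longrightarrow> (\<forall>i<n. c i = 0)))" (is "?A \<longleftrightarrow> ?B") for n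
  proof
    assume ?A
    then obtain h :: "nat \<Rightarrow> 'k poly poly" where h: "\<And>c :: nat \<Rightarrow> 'k.
          in_loc_ideal (\<phi> f) (\<phi> g) a b (\<Sum>i<n. smult [:c i:] (h i)) \<Longrightarrow> (\<forall>i<n. c i = 0)" by blast
    obtain d H where H: "\<forall>i<n. hom3 d (H i) \<and> \<phi> (H i) = h i" using lift_family by blast
    then have hom: "\<forall>i<n. hom3 d (H i)" by blast
    have "\<forall>i<n. c i = 0" if c: "hlocal f g pt (\<Sum>i<n. smult [:[:c i:]:] (H i))" for c :: "nat \<Rightarrow> 'k"
    proof -
      have "(\<Sum>i<n. smult [:c i:] (\<phi> (H i))) = (\<Sum>i<n. smult [:c i:] (h i))"
        using H by (intro sum.cong) auto
      then show ?thesis using c h[of c] unfolding key[OF hom] by simp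
    qed
    then show ?B using hom by blast
  next
    assume ?B
    then obtain d H where hom: "\<forall>i<n. hom3 d (H i)" and
      H: "\<forall>c :: nat \<Rightarrow> 'k. hlocal f g pt (\<Sum>i<n. smult [:[:c i:]:] (H i)) \<longrightarrow> (\<forall>i<n. c i = 0)" by blast
    show ?A using H unfolding key[OF hom] by (intro exI[of _ "\<lambda>i. \<phi> (H i)"])
  qed
  then show ?thesis unfolding aff_imult_def hmult_def by simp
qed

end

section \<open>The three affine charts\<close>

definition poly3 :: "nat \<Rightarrow> (nat \<Rightarrow> nat \<Rightarrow> nat \<Rightarrow> 'c::comm_ring_1) \<Rightarrow> 'c poly poly poly" where
  "poly3 d F = (\<Sum>k<Suc d. monom (\<Sum>j<Suc d. monom (\<Sum>i<Suc d. monom (if i + j + k = d then F i j k else 0) i) j) k)"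

lemma coeff_poly3: "coeff (coeff (coeff (poly3 d F) k) j) i = (if i + j + k = d then F i j k else 0)"
proof -
  have "coeff (coeff (coeff (poly3 d F) k) j) i =
     (if k < Suc d then if j < Suc d then if i < Suc d then if i + j + k = d then F i j k else 0 else 0 else 0 else 0)"
    unfolding poly3_def by (simp only: coeff_sum_monom if_distrib[of "\<lambda>p. coeff p _"] coeff_0 cong: if_cong)
  then show ?thesis by auto
qed

lemma hom3_poly3: "hom3 d (poly3 d F)"
  unfolding hom3_def coeff_poly3 by auto

lemma poly2_bounded: "\<exists>d0. \<forall>i j. coeff (coeff h j) i \<noteq> 0 \<longrightarrow> i + j \<le> d0" for h :: "'c::zero poly poly"
proof -
  have "i + j \<le> (\<Sum>j\<le>degree h. degree (coeff h j)) + degree h" if "coeff (coeff h j) i \<noteq> 0" for i j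
  proof -
    have j: "j \<le> degree h" using that by (intro le_degree) auto
    have "i \<le> degree (coeff h j)" using that by (rule le_degree)
    also have "\<dots> \<le> (\<Sum>j\<le>degree h. degree (coeff h j))" using j by (intro member_le_sum) auto
    finally show ?thesis using j by simp
  qed
  then show ?thesis by blast
qed

lemma poly_1_single: "(\<And>i. i \<noteq> m \<Longrightarrow> coeff p i = 0) \<Longrightarrow> poly p 1 = coeff p m"
  for p :: "'c::comm_semiring_1 poly"
proof -
  assume "\<And>i. i \<noteq> m \<Longrightarrow> coeff p i = 0"
  then have "p = monom (coeff p m) m" by (intro poly_eqI) auto
  then show ?thesis by (metis mult.right_neutral poly_monom power_one)
qed

definition dehom1 :: "'c::comm_ring_1 poly poly poly \<Rightarrow> 'c poly poly" where
  "dehom1 f = map_poly (map_poly (\<lambda>c. poly c 1)) f"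
definition dehom2 :: "'c::comm_ring_1 poly poly poly \<Rightarrow> 'c poly poly" where
  "dehom2 f = map_poly (\<lambda>c. poly c 1) f"
definition dehom3 :: "'c::comm_ring_1 poly poly poly \<Rightarrow> 'c poly poly" where
  "dehom3 f = poly f 1"

lemma ring_hom_poly_1: "comm_ring_hom (\<lambda>c :: 'c::comm_ring_1 poly. poly c 1)"
  by unfold_locales auto

lemma ring_hom_map_poly: "comm_ring_hom h \<Longrightarrow> comm_ring_hom (map_poly h)"
proof -
  assume "comm_ring_hom h"
  then interpret map_poly_comm_ring_hom h unfolding map_poly_comm_ring_hom_def .
  show ?thesis by unfold_locales
qed

lemma comm_ring_hom_laws:
  assumes "comm_ring_hom h" shows "h (x + y) = h x + h y" "h (x * y) = h x * h y"
proof -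
  interpret comm_ring_hom h by fact
  show "h (x + y) = h x + h y" "h (x * y) = h x * h y" by (rule hom_add hom_mult)+
qed

lemma comm_ring_hom_poly:
  assumes "comm_ring_hom h" shows "h (poly p x) = poly (map_poly h p) (h x)"
proof -
  interpret comm_ring_hom h by fact
  show ?thesis by simp
qed

lemma map_poly_const: "f 0 = 0 \<Longrightarrow> map_poly f [:c:] = [:f c:]"
  by (rule poly_eqI) (simp add: coeff_map_poly coeff_pCons split: nat.split)

lemma coeff_dehom1:
  assumes "hom3 d H" shows "coeff (coeff (dehom1 H) k) j = (if j + k \<le> d then coeff (coeff (coeff H k) j) (d - j - k) else 0)"
proof -
  have "coeff (coeff (dehom1 H) k) j = poly (coeff (coeff H k) j) 1"
    by (simp add: dehom1_def coeff_map_poly)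
  also have "\<dots> = coeff (coeff (coeff H k) j) (d - j - k)"
    by (rule poly_1_single) (use assms in \<open>force simp: hom3_def\<close>)
  also have "\<dots> = (if j + k \<le> d then coeff (coeff (coeff H k) j) (d - j - k) else 0)"
    using assms unfolding hom3_def by force
  finally show ?thesis .
qed

lemma coeff_poly_const_1: "coeff (poly p 1) i = poly (map_poly (\<lambda>c. coeff c i) p) 1" for p :: "'c::comm_ring_1 poly poly"
proof -
  have "coeff (poly p 1) i = (\<Sum>j\<le>degree p. coeff (coeff p j) i)" by (subst poly_altdef) (simp add: coeff_sum)
  also have "\<dots> = (\<Sum>j\<le>degree (map_poly (\<lambda>c. coeff c i) p). coeff (coeff p j) i)"
  proof (rule sum.mono_neutral_right)
    show "\<forall>j\<in>{..degree p} - {..degree (map_poly (\<lambda>c. coeff c i) p)}. coeff (coeff p j) i = 0"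
      using coeff_eq_0[of "map_poly (\<lambda>c. coeff c i) p"] by (auto simp: coeff_map_poly)
  qed (auto simp: degree_map_poly_le)
  finally show ?thesis by (subst poly_altdef) (simp add: coeff_map_poly)
qed

lemma coeff_dehom2:
  assumes "hom3 d H" shows "coeff (coeff (dehom2 H) k) i = (if i + k \<le> d then coeff (coeff (coeff H k) (d - i - k)) i else 0)"
proof -
  have "coeff (coeff (dehom2 H) k) i = poly (map_poly (\<lambda>c. coeff c i) (coeff H k)) 1"
    by (simp add: dehom2_def coeff_map_poly coeff_poly_const_1)
  also have "\<dots> = coeff (map_poly (\<lambda>c. coeff c i) (coeff H k)) (d - i - k)"
    by (rule poly_1_single) (use assms in \<open>force simp: hom3_def coeff_map_poly\<close>)
  also have "\<dots> = (if i + k \<le> d then coeff (coeff (coeff H k) (d - i - k)) i else 0)"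
    using assms unfolding hom3_def by (force simp: coeff_map_poly)
  finally show ?thesis .
qed

lemma coeff_dehom3:
  assumes "hom3 d H" shows "coeff (coeff (dehom3 H) j) i = (if i + j \<le> d then coeff (coeff (coeff H (d - i - j)) j) i else 0)"
proof -
  have "coeff (coeff (dehom3 H) j) i = poly (map_poly (\<lambda>c. coeff c i) (map_poly (\<lambda>c. coeff c j) H)) 1"
    by (simp add: dehom3_def coeff_poly_const_1)
  also have "\<dots> = coeff (map_poly (\<lambda>c. coeff c i) (map_poly (\<lambda>c. coeff c j) H)) (d - i - j)"
    by (rule poly_1_single) (use assms in \<open>force simp: hom3_def coeff_map_poly\<close>)
  also have "\<dots> = (if i + j \<le> d then coeff (coeff (coeff H (d - i - j)) j) i else 0)"
    using assms unfolding hom3_def by (force simp: coeff_map_poly)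
  finally show ?thesis .
qed

lemma chart1: "chart dehom1 (1, a2, a3) a2 (a3 :: 'k::field)"
proof -
  have r1: "comm_ring_hom (\<lambda>c :: 'k poly. poly c 1)" by (rule ring_hom_poly_1)
  have r2: "comm_ring_hom (map_poly (\<lambda>c :: 'k poly. poly c 1))" by (rule ring_hom_map_poly[OF r1])
  have r3: "comm_ring_hom (dehom1 :: 'k poly poly poly \<Rightarrow> _)"
    using ring_hom_map_poly[OF r2] unfolding dehom1_def[abs_def] .
  show ?thesis
  proof
    show "dehom1 (p + q) = dehom1 p + dehom1 q" "dehom1 (p * q) = dehom1 p * dehom1 q" for p q :: "'k poly poly poly"
      by (rule comm_ring_hom_laws[OF r3])+
    show "dehom1 (smult [:[:c:]:] p) = smult [:c:] (dehom1 p)" for c and p :: "'k poly poly poly"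
      by (rule poly_eqI, rule poly_eqI) (simp add: dehom1_def coeff_map_poly)
    show "\<exists>d0. \<forall>d\<ge>d0. \<exists>H. hom3 d H \<and> dehom1 H = h" for h :: "'k poly poly"
    proof -
      obtain d0 where d0: "\<forall>i j. coeff (coeff h j) i \<noteq> 0 \<longrightarrow> i + j \<le> d0" using poly2_bounded by blast
      have "dehom1 (poly3 d (\<lambda>i j k. coeff (coeff h k) j)) = h" if "d \<ge> d0" for d
        by (rule poly_eqI, rule poly_eqI) (use d0 that in \<open>force simp: coeff_dehom1[OF hom3_poly3] coeff_poly3\<close>)
      then show ?thesis using hom3_poly3 by blast
    qed
    show "H = 0" if "hom3 d H" "dehom1 H = 0" for d and H :: "'k poly poly poly"
    proof (rule poly_eqI, rule poly_eqI, rule poly_eqI)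
      fix k j i
      show "coeff (coeff (coeff H k) j) i = coeff (coeff (coeff 0 k) j) i"
        using coeff_dehom1[OF that(1), of k j] that unfolding hom3_def
        by (cases "i + j + k = d") auto
    qed
    show "val2 (dehom1 H) a2 a3 = ev3 H (1, a2, a3)" for H :: "'k poly poly poly"
      using comm_ring_hom_poly[OF r1, of "poly H [:[:a3:]:]" "[:a2:]"] comm_ring_hom_poly[OF r2, of H "[:[:a3:]:]"]
      by (simp add: ev3_def val2_def dehom1_def map_poly_const)
  qed
qed

lemma chart2: "chart dehom2 (a1, 1, a3) a1 (a3 :: 'k::field)"
proof -
  have r2: "comm_ring_hom (\<lambda>c :: 'k poly poly. poly c 1)" by (rule ring_hom_poly_1)
  have r3: "comm_ring_hom (dehom2 :: 'k poly poly poly \<Rightarrow> _)"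
    using ring_hom_map_poly[OF r2] unfolding dehom2_def[abs_def] .
  show ?thesis
  proof
    show "dehom2 (p + q) = dehom2 p + dehom2 q" "dehom2 (p * q) = dehom2 p * dehom2 q" for p q :: "'k poly poly poly"
      by (rule comm_ring_hom_laws[OF r3])+
    show "dehom2 (smult [:[:c:]:] p) = smult [:c:] (dehom2 p)" for c and p :: "'k poly poly poly"
      by (rule poly_eqI, rule poly_eqI) (simp add: dehom2_def coeff_map_poly)
    show "\<exists>d0. \<forall>d\<ge>d0. \<exists>H. hom3 d H \<and> dehom2 H = h" for h :: "'k poly poly"
    proof -
      obtain d0 where d0: "\<forall>i j. coeff (coeff h j) i \<noteq> 0 \<longrightarrow> i + j \<le> d0" using poly2_bounded by blast
      have "dehom2 (poly3 d (\<lambda>i j k. coeff (coeff h k) i)) = h" if "d \<ge> d0" for d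
        by (rule poly_eqI, rule poly_eqI) (use d0 that in \<open>force simp: coeff_dehom2[OF hom3_poly3] coeff_poly3\<close>)
      then show ?thesis using hom3_poly3 by blast
    qed
    show "H = 0" if "hom3 d H" "dehom2 H = 0" for d and H :: "'k poly poly poly"
    proof (rule poly_eqI, rule poly_eqI, rule poly_eqI)
      fix k j i
      show "coeff (coeff (coeff H k) j) i = coeff (coeff (coeff 0 k) j) i"
        using coeff_dehom2[OF that(1), of k i] that unfolding hom3_def
        by (cases "i + j + k = d") auto
    qed
    show "val2 (dehom2 H) a1 a3 = ev3 H (a1, 1, a3)" for H :: "'k poly poly poly"
      using comm_ring_hom_poly[OF r2, of H "[:[:a3:]:]"]
      by (simp add: ev3_def val2_def dehom2_def pCons_one)
  qed
qed

lemma chart3: "chart dehom3 (a1, a2, 1) a1 (a2 :: 'k::field)"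
proof
  show "dehom3 (smult [:[:c:]:] p) = smult [:c:] (dehom3 p)" for c and p :: "'k poly poly poly"
    by (simp add: dehom3_def)
  show "\<exists>d0. \<forall>d\<ge>d0. \<exists>H. hom3 d H \<and> dehom3 H = h" for h :: "'k poly poly"
  proof -
    obtain d0 where d0: "\<forall>i j. coeff (coeff h j) i \<noteq> 0 \<longrightarrow> i + j \<le> d0" using poly2_bounded by blast
    have "dehom3 (poly3 d (\<lambda>i j k. coeff (coeff h j) i)) = h" if "d \<ge> d0" for d
      by (rule poly_eqI, rule poly_eqI) (use d0 that in \<open>force simp: coeff_dehom3[OF hom3_poly3] coeff_poly3\<close>)
    then show ?thesis using hom3_poly3 by blast
  qed
  show "H = 0" if "hom3 d H" "dehom3 H = 0" for d and H :: "'k poly poly poly"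
  proof (rule poly_eqI, rule poly_eqI, rule poly_eqI)
    fix k j i
    show "coeff (coeff (coeff H k) j) i = coeff (coeff (coeff 0 k) j) i"
      using coeff_dehom3[OF that(1), of j i] that unfolding hom3_def
      by (cases "i + j + k = d") auto
  qed
  show "val2 (dehom3 H) a1 a2 = ev3 H (a1, a2, 1)" for H :: "'k poly poly poly"
    by (simp add: ev3_def val2_def dehom3_def pCons_one)
qed (simp_all add: dehom3_def)

text \<open>\<open>proj_imult\<close> takes the first available chart in the order t3, t2, t1,
  whereas the count along lines sets t2 or t1 to 1; \<open>hmult\<close> mediates between charts and
  between representatives of a point.\<close>

lemma proj_imult_eq_hmult:
  assumes f: "hom3 df f" and g: "hom3 dg g" and p: "(p1, p2, p3) \<noteq> (0, 0, 0)"
  shows "proj_imult f g (p1, p2, p3) = hmult f g (p1, p2, p3)"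
proof -
  consider "p3 \<noteq> 0" | "p3 = 0" "p2 \<noteq> 0" | "p3 = 0" "p2 = 0" "p1 \<noteq> 0" using p by auto
  then show ?thesis
  proof cases
    case 1
    then have "proj_imult f g (p1, p2, p3) = aff_imult (dehom3 f) (dehom3 g) (p1 / p3) (p2 / p3)"
      by (simp add: proj_imult_def dehom3_def)
    also have "\<dots> = hmult f g (p1 / p3, p2 / p3, 1)" by (rule chart.aff_imult_eq_hmult[OF chart3 f g])
    also have "\<dots> = hmult f g (p3 * (p1 / p3), p3 * (p2 / p3), p3 * 1)" using 1 by (rule hmult_scale[symmetric])
    finally show ?thesis using 1 by simp
  next
    case 2
    then have "proj_imult f g (p1, p2, p3) = aff_imult (dehom2 f) (dehom2 g) (p1 / p2) (p3 / p2)"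
      by (simp add: proj_imult_def dehom2_def)
    also have "\<dots> = hmult f g (p1 / p2, 1, p3 / p2)" by (rule chart.aff_imult_eq_hmult[OF chart2 f g])
    also have "\<dots> = hmult f g (p2 * (p1 / p2), p2 * 1, p2 * (p3 / p2))" using 2(2) by (rule hmult_scale[symmetric])
    finally show ?thesis using 2 by simp
  next
    case 3
    then have "proj_imult f g (p1, p2, p3) = aff_imult (dehom1 f) (dehom1 g) (p2 / p1) (p3 / p1)"
      by (simp add: proj_imult_def dehom1_def)
    also have "\<dots> = hmult f g (1, p2 / p1, p3 / p1)" by (rule chart.aff_imult_eq_hmult[OF chart1 f g])
    also have "\<dots> = hmult f g (p1 * 1, p1 * (p2 / p1), p1 * (p3 / p1))" using 3(3) by (rule hmult_scale[symmetric])
    finally show ?thesis using 3 by simp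
  qed
qed

subsection \<open>Binary forms and their greatest common divisor\<close>

lemma proots_linear: "proots [:-x, 1:] = {#x#}" for x :: "'a::idom"
  using proots_linear_factor[of "- x"] by (simp only: minus_minus)

lemma alg_closed_split:
  fixes p :: "'a::alg_closed_field poly"
  assumes "p \<noteq> 0"
  shows "p = smult (lead_coeff p) (\<Prod>x\<in>#proots p. [:-x, 1:])"
proof -
  obtain A where A: "p = smult (lead_coeff p) (\<Prod>x\<in>#A. [:-x, 1:])"
    using alg_closed_imp_factorization[OF assms] by auto
  have nz: "0 \<notin># image_mset (\<lambda>x. [:-x, 1:]) A" by auto
  have "proots p = proots (\<Prod>x\<in>#A. [:-x, 1:])" using assms by (subst A) simp
  also have "\<dots> = (\<Sum>x\<in>#A. proots [:-x, 1:])" using proots_prod_mset[OF nz] by (simp add: image_mset.compositionality o_def)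
  also have "\<dots> = A" by (simp only: proots_linear) simp
  finally show "p = smult (lead_coeff p) (\<Prod>x\<in>#proots p. [:-x, 1:])"
    using A by simp
qed

lemma alg_closed_dvdI:
  fixes p q :: "'a::alg_closed_field poly"
  assumes "p \<noteq> 0" "q \<noteq> 0" "\<And>x. order x p \<le> order x q"
  shows "p dvd q"
proof -
  have "proots p \<subseteq># proots q" using assms by (intro mset_subset_eqI) simp
  then have "(\<Prod>x\<in>#proots p. [:-x, 1:]) dvd (\<Prod>x\<in>#proots q. [:-x, 1:])"
    by (intro prod_mset_subset_imp_dvd image_mset_subseteq_mono)
  then have "smult (lead_coeff p) (\<Prod>x\<in>#proots p. [:-x, 1:]) dvd smult (lead_coeff q) (\<Prod>x\<in>#proots q. [:-x, 1:])"
    using assms by (simp add: smult_dvd_iff dvd_smult)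
  then show ?thesis using alg_closed_split assms by metis
qed

text \<open>Two affine views of a binary form: the zeros of \<open>spec2\<close> are the lines t1 =
  a t2, and the order of \<open>spec1\<close> at 0 belongs to the remaining line t2 = 0.\<close>

definition spec2 :: "'c::comm_ring_1 poly poly \<Rightarrow> 'c poly" where "spec2 c = poly c 1"
definition spec1 :: "'c::comm_ring_1 poly poly \<Rightarrow> 'c poly" where "spec1 c = map_poly (\<lambda>p. poly p 1) c"

lemma ring_hom_spec2: "comm_ring_hom (spec2 :: 'c::comm_ring_1 poly poly \<Rightarrow> 'c poly)"
  unfolding spec2_def[abs_def] by (rule ring_hom_poly_1)

lemma ring_hom_spec1: "comm_ring_hom (spec1 :: 'c::comm_ring_1 poly poly \<Rightarrow> 'c poly)"
  unfolding spec1_def[abs_def] by (intro ring_hom_map_poly ring_hom_poly_1)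

lemma spec_mult: "spec2 (p * q) = spec2 p * spec2 q" "spec1 (p * q) = spec1 p * spec1 q"
  by (rule comm_ring_hom_laws[OF ring_hom_spec2] comm_ring_hom_laws[OF ring_hom_spec1])+

lemma coeff_spec2: "hom2 n c \<Longrightarrow> coeff (spec2 c) i = (if i \<le> n then coeff (coeff c (n - i)) i else 0)"
proof -
  assume c: "hom2 n c"
  have "coeff (spec2 c) i = poly (map_poly (\<lambda>c. coeff c i) c) 1"
    by (simp add: spec2_def coeff_poly_const_1)
  also have "\<dots> = coeff (map_poly (\<lambda>c. coeff c i) c) (n - i)"
    by (rule poly_1_single) (use c in \<open>force simp: hom2_def coeff_map_poly\<close>)
  also have "\<dots> = (if i \<le> n then coeff (coeff c (n - i)) i else 0)"
    using c unfolding hom2_def by (force simp: coeff_map_poly)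
  finally show ?thesis .
qed

lemma coeff_spec1: "hom2 n c \<Longrightarrow> coeff (spec1 c) j = (if j \<le> n then coeff (coeff c j) (n - j) else 0)"
proof -
  assume c: "hom2 n c"
  have "coeff (spec1 c) j = poly (coeff c j) 1" by (simp add: spec1_def coeff_map_poly)
  also have "\<dots> = coeff (coeff c j) (n - j)"
    by (rule poly_1_single) (use c in \<open>force simp: hom2_def\<close>)
  also have "\<dots> = (if j \<le> n then coeff (coeff c j) (n - j) else 0)"
    using c unfolding hom2_def by force
  finally show ?thesis .
qed

lemma hom2_eqI:
  assumes "hom2 n c" "hom2 n c'" "spec2 c = spec2 c'" shows "c = c'"
proof (rule poly_eqI, rule poly_eqI)
  fix j i
  show "coeff (coeff c j) i = coeff (coeff c' j) i"
  proof (cases "i + j = n")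
    case True
    then have "n - i = j" "i \<le> n" by auto
    then show ?thesis using coeff_spec2[OF assms(1), of i] coeff_spec2[OF assms(2), of i] assms(3) by simp
  next
    case False
    then show ?thesis using assms(1,2) unfolding hom2_def by metis
  qed
qed

lemma hom2_nonzero: "hom2 n c \<Longrightarrow> c \<noteq> 0 \<Longrightarrow> spec2 c \<noteq> 0 \<and> spec1 c \<noteq> 0 \<and> degree (spec2 c) \<le> n"
proof -
  assume c: "hom2 n c" "c \<noteq> 0"
  then obtain j i where ji: "coeff (coeff c j) i \<noteq> 0" by (metis poly_eqI coeff_0)
  then have "i + j = n" using c(1) unfolding hom2_def by auto
  then have "coeff (spec2 c) i \<noteq> 0" "coeff (spec1 c) j \<noteq> 0"
    using ji by (auto simp: coeff_spec2[OF c(1)] coeff_spec1[OF c(1)] simp flip: \<open>i + j = n\<close>)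
  moreover have "degree (spec2 c) \<le> n" by (rule degree_le) (simp add: coeff_spec2[OF c(1)])
  ultimately show ?thesis by auto
qed

text \<open>The coefficients of \<open>spec1\<close> are those of \<open>spec2\<close> read
  backwards from \<open>n\<close>, so vanishing low coefficients of the one are missing top
  coefficients of the other.\<close>

lemma order_spec1:
  assumes "hom2 n c" "c \<noteq> 0"
  shows "order 0 (spec1 (c :: 'k::field poly poly)) = n - degree (spec2 c)"
proof -
  let ?d = "degree (spec2 c)"
  note nz = hom2_nonzero[OF assms]
  have co: "coeff (spec1 c) j = coeff (spec2 c) (n - j)" if "j \<le> n" for j
    using that by (simp add: coeff_spec2[OF assms(1)] coeff_spec1[OF assms(1)])
  have "monom 1 k dvd spec1 c \<longleftrightarrow> k \<le> n - ?d" for k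
  proof
    assume k: "k \<le> n - ?d"
    have "coeff (spec1 c) i = 0" if "i < k" for i
      using that k co[of i] by (simp add: coeff_eq_0)
    then show "monom 1 k dvd spec1 c" by (simp add: monom_1_dvd_iff')
  next
    assume "monom 1 k dvd spec1 c"
    then have "coeff (spec1 c) (n - ?d) = 0" if "n - ?d < k" using that by (simp add: monom_1_dvd_iff')
    moreover have "coeff (spec1 c) (n - ?d) = lead_coeff (spec2 c)" using co[of "n - ?d"] nz by simp
    ultimately show "k \<le> n - ?d" using nz by (metis leading_coeff_0_iff not_le)
  qed
  then have "k \<le> order 0 (spec1 c) \<longleftrightarrow> k \<le> n - ?d" for k
    using nz order_divides[of 0 k "spec1 c"] by (simp add: monom_altdef)
  then show ?thesis by (metis le_antisym order_refl)
qed

definition binary_form :: "nat \<Rightarrow> 'c::comm_ring_1 poly \<Rightarrow> 'c poly poly" where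
  "binary_form n q = (\<Sum>j<Suc n. monom (monom (coeff q (n - j)) (n - j)) j)"

lemma coeff_binary_form: "coeff (coeff (binary_form n q) j) i = (if i + j = n then coeff q i else 0)"
  unfolding binary_form_def coeff_sum_monom by auto

lemma hom2_binary_form: "hom2 n (binary_form n q)"
  unfolding hom2_def coeff_binary_form by auto

lemma spec2_binary_form: "degree q \<le> n \<Longrightarrow> spec2 (binary_form n q) = q"
  by (rule poly_eqI)
    (auto simp: coeff_spec2[OF hom2_binary_form] coeff_binary_form coeff_eq_0)

text \<open>The order condition at 0 bounds the degree of the quotient \<open>q\<close> of the
  \<open>spec2\<close> parts by n - m. Homogenizing \<open>q\<close> in that degree gives a
  cofactor, because forms of one degree are determined by \<open>spec2\<close>.\<close>

lemma hom2_dvd_iff: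
  fixes a b :: "'k::field poly poly"
  assumes a: "hom2 m a" "a \<noteq> 0" and b: "hom2 n b" "b \<noteq> 0"
    and dvd: "spec2 a dvd spec2 b" and ord: "order 0 (spec1 a) \<le> order 0 (spec1 b)"
  shows "a dvd b" "m \<le> n"
proof -
  obtain q where q: "spec2 b = spec2 a * q" using dvd by blast
  note nza = hom2_nonzero[OF a] and nzb = hom2_nonzero[OF b]
  have deg: "degree (spec2 b) = degree (spec2 a) + degree q"
    using q nzb by (metis degree_mult_eq mult_eq_0_iff)
  have "m - degree (spec2 a) \<le> n - degree (spec2 b)" using ord order_spec1[OF a] order_spec1[OF b] by simp
  then show mn: "m \<le> n" and dq: "a dvd b"
  proof -
    assume *: "m - degree (spec2 a) \<le> n - degree (spec2 b)"
    then show mn: "m \<le> n" using nza nzb deg by linarith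
    have dq: "degree q \<le> n - m" using * nza nzb deg by linarith
    have "hom2 n (a * binary_form (n - m) q)"
      using hom2_mult[OF a(1) hom2_binary_form, of "n - m" q] mn by simp
    then have "a * binary_form (n - m) q = b"
      using b(1) by (rule hom2_eqI) (simp add: spec_mult spec2_binary_form[OF dq] q)
    then show "a dvd b" by (metis dvd_triv_left)
  qed
qed

lemma tdeg2_hom2:
  assumes "hom2 n c" "c \<noteq> 0" shows "tdeg2 c = n"
proof -
  obtain j i where ji: "coeff (coeff c j) i \<noteq> 0" using assms(2) by (metis poly_eqI coeff_0)
  then have "{i + j | i j. coeff (coeff c j) i \<noteq> 0} = {n}" using assms(1) unfolding hom2_def by blast
  then show ?thesis unfolding tdeg2_def by simp
qed

section \<open>Homogeneity by substitution, and common divisors of forms\<close>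

definition sub :: "('c::comm_ring_1 \<Rightarrow> 'd::comm_ring_1) \<Rightarrow> 'd \<Rightarrow> 'c poly \<Rightarrow> 'd" where
  "sub h x p = poly (map_poly h p) x"

lemma ring_hom_sub:
  assumes "comm_ring_hom h" shows "comm_ring_hom (sub h x)"
proof -
  interpret h: comm_ring_hom "map_poly h" by (rule ring_hom_map_poly[OF assms])
  show ?thesis unfolding sub_def by unfold_locales (simp_all add: h.hom_add h.hom_mult)
qed

lemma sub_altdef:
  assumes "comm_ring_hom h" shows "sub h x p = (\<Sum>i\<le>degree p. h (coeff p i) * x ^ i)"
proof -
  interpret h: comm_ring_hom h by fact
  have "sub h x p = (\<Sum>i\<le>degree (map_poly h p). h (coeff p i) * x ^ i)"
    unfolding sub_def by (subst poly_altdef) (simp add: coeff_map_poly)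
  also have "\<dots> = (\<Sum>i\<le>degree p. h (coeff p i) * x ^ i)"
  proof (rule sum.mono_neutral_left)
    show "\<forall>i\<in>{..degree p} - {..degree (map_poly h p)}. h (coeff p i) * x ^ i = 0"
      using coeff_eq_0[of "map_poly h p"] by (auto simp: coeff_map_poly)
  qed (auto simp: degree_map_poly_le)
  finally show ?thesis .
qed

text \<open>Substituting \<open>t1 := z t1\<close>, \<open>t2 := z t2\<close> turns forms of degree \<open>n\<close> into multiples of \<open>z ^ n\<close>.\<close>

definition homogenize2 :: "'c::comm_ring_1 poly poly \<Rightarrow> 'c poly poly poly" where
  "homogenize2 = sub (sub (\<lambda>a. [:[:[:a:]:]:]) (monom [:[:0, 1:]:] 1)) (monom (monom 1 1) 1)"

lemma ring_hom_const: "comm_ring_hom (\<lambda>c :: 'c::comm_ring_1. [:c:])"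
  by unfold_locales (simp_all add: pCons_one)

lemma ring_hom_comp: "comm_ring_hom g \<Longrightarrow> comm_ring_hom h \<Longrightarrow> comm_ring_hom (\<lambda>x. g (h x))"
proof -
  assume "comm_ring_hom g" "comm_ring_hom h"
  then interpret g: comm_ring_hom g + h: comm_ring_hom h by simp_all
  show ?thesis by unfold_locales (simp_all add: h.hom_add h.hom_mult g.hom_add g.hom_mult)
qed

lemma ring_hom_homogenize2: "comm_ring_hom (homogenize2 :: 'c::comm_ring_1 poly poly \<Rightarrow> _)"
  unfolding homogenize2_def
  by (intro ring_hom_sub ring_hom_comp[OF ring_hom_const] ring_hom_const)

lemma homogenize2_altdef: "homogenize2 c =
   (\<Sum>j\<le>degree c. \<Sum>i\<le>degree (coeff c j). monom (monom (monom (coeff (coeff c j) i) i) j) (i + j))"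
proof -
  have h: "comm_ring_hom (\<lambda>a :: 'a. [:[:[:a:]:]:])"
    by (intro ring_hom_comp[OF ring_hom_const] ring_hom_const)
  have x: "[:[:[:a:]:]:] * monom [:[:0, 1:]:] 1 ^ i * monom (monom 1 1) 1 ^ j =
      monom (monom (monom a i) j) (i + j)" for a :: 'a and i j
  proof -
    have y: "smult a ([:0, 1:] ^ i) = monom a i" by (simp only: monom_altdef)
    have "[:[:[:a:]:]:] * monom [:[:0, 1:]:] 1 ^ i = monom [:smult a ([:0, 1:] ^ i):] i"
      by (simp add: monom_power smult_monom poly_const_pow)
    then have "[:[:[:a:]:]:] * monom [:[:0, 1:]:] 1 ^ i * monom (monom 1 1) 1 ^ j =
        monom [:monom a i:] i * monom (monom 1 j) j"
      unfolding y by (simp add: monom_power)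
    then show ?thesis by (simp add: mult_monom smult_monom)
  qed
  show ?thesis
    unfolding homogenize2_def sub_altdef[OF ring_hom_sub[OF h]] sub_altdef[OF h] sum_distrib_right x ..
qed

lemma coeff_homogenize2:
  "coeff (coeff (coeff (homogenize2 c) k) j) i = (if i + j = k then coeff (coeff c j) i else 0)"
proof -
  have "coeff (coeff (coeff (homogenize2 c) k) j) i =
    (\<Sum>j'\<le>degree c. \<Sum>i'\<le>degree (coeff c j'). if j' = j then if i' = i then if i' + j' = k then coeff (coeff c j') i' else 0 else 0 else 0)"
    unfolding homogenize2_altdef coeff_sum by (intro sum.cong refl) auto
  also have "\<dots> = (\<Sum>j'\<le>degree c. if j' = j then \<Sum>i'\<le>degree (coeff c j'). if i' = i then if i' + j' = k then coeff (coeff c j') i' else 0 else 0 else 0)"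
    by (intro sum.cong) auto
  also have "\<dots> = (if i + j = k then coeff (coeff c j) i else 0)"
    by (auto simp: not_le coeff_eq_0)
  finally show ?thesis .
qed

lemma hom2_iff_homogenize2: "hom2 n c \<longleftrightarrow> homogenize2 c = monom c n"
proof
  assume c: "hom2 n c"
  show "homogenize2 c = monom c n"
    by (rule poly_eqI, rule poly_eqI, rule poly_eqI) (use c in \<open>auto simp: hom2_def coeff_homogenize2\<close>)
next
  assume "homogenize2 c = monom c n"
  then have "coeff (coeff (coeff (monom c n) (i + j)) j) i = coeff (coeff c j) i" for i j
    using coeff_homogenize2[of c "i + j" j i] by simp
  then show "hom2 n c" unfolding hom2_def by (metis coeff_0 coeff_monom)
qed

text \<open>Multiplying t1 and t2 by a new variable z turns the product into a multiple of z^n.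
  Order at 0 and degree in z are additive and both add up to \<open>n\<close>, so they agree for
  each factor, which then contains a single power of z.\<close>

lemma hom2_divisor:
  fixes c w :: "'k::field poly poly"
  assumes r: "hom2 n (c * w)" "c * w \<noteq> 0" shows "\<exists>m. hom2 m c"
proof -
  let ?h = homogenize2
  have inj: "?h c = 0 \<Longrightarrow> c = 0" for c :: "'k poly poly"
    using coeff_homogenize2[of c] by (intro poly_eqI) (metis coeff_0)
  have prod: "?h c * ?h w = monom (c * w) n"
    using r(1) unfolding hom2_iff_homogenize2 comm_ring_hom_laws(2)[OF ring_hom_homogenize2] .
  have nz: "?h c \<noteq> 0" "?h w \<noteq> 0" using r(2) inj by auto
  have "order 0 (?h c) + order 0 (?h w) = n"
    using order_mult[of "?h c" "?h w" 0] r(2) unfolding prod by simp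
  moreover have "degree (?h c) + degree (?h w) = n"
    using degree_mult_eq[OF nz] r(2) unfolding prod by (simp add: degree_monom_eq)
  moreover have "order 0 (?h c) \<le> degree (?h c)" "order 0 (?h w) \<le> degree (?h w)"
    using nz by (auto intro: order_degree)
  ultimately have eq: "order 0 (?h c) = degree (?h c)" by linarith
  let ?m = "degree (?h c)"
  have "[:-0, 1:] ^ ?m dvd ?h c" using order_1[of 0 "?h c"] eq by simp
  then have "monom 1 ?m dvd ?h c" by (simp add: monom_altdef)
  then have low: "coeff (?h c) k = 0" if "k < ?m" for k using that by (simp add: monom_1_dvd_iff')
  have "hom2 ?m c" unfolding hom2_def
  proof (intro allI impI)
    fix i j assume "coeff (coeff c j) i \<noteq> 0"
    then have "coeff (?h c) (i + j) \<noteq> 0" using coeff_homogenize2[of c "i + j" j i] by auto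
    then show "i + j = ?m" using low le_degree by (metis le_antisym not_le)
  qed
  then show ?thesis ..
qed

text \<open>Divisibility of forms is local: it is decided by the orders \<mu> at the lines t1 = a t2
  and \<nu> at t2 = 0. The form \<open>c0\<close> with exactly these orders is a greatest common
  divisor.\<close>

lemma tdeg2_gcd:
  fixes C :: "'a::alg_closed_field poly poly set" and \<mu> :: "'a \<Rightarrow> nat"
  assumes hom: "\<And>r. r \<in> C \<Longrightarrow> hom2 n r" and r0: "r0 \<in> C" "r0 \<noteq> 0"
    and \<mu>: "\<And>a k. (\<forall>r\<in>C. [:-a, 1:] ^ k dvd spec2 r) \<longleftrightarrow> k \<le> \<mu> a"
    and \<nu>: "\<And>k. (\<forall>r\<in>C. [:-0, 1:] ^ k dvd spec1 r) \<longleftrightarrow> k \<le> \<nu>"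
  shows "finite {a. \<mu> a \<noteq> 0}" "tdeg2 (SOME c. is_gcd_of C c) = \<nu> + (\<Sum>a\<in>{a. \<mu> a \<noteq> 0}. \<mu> a)"
proof -
  let ?A = "{a. \<mu> a \<noteq> 0}"
  note nz0 = hom2_nonzero[OF hom[OF r0(1)] r0(2)]
  have "?A \<subseteq> {a. poly (spec2 r0) a = 0}"
  proof
    fix a assume "a \<in> ?A"
    then have "[:-a, 1:] ^ 1 dvd spec2 r0" using \<mu>[where a = a and k = 1] r0(1) by simp
    then show "a \<in> {a. poly (spec2 r0) a = 0}" by (simp add: poly_eq_0_iff_dvd)
  qed
  then show fin: "finite ?A" using nz0 poly_roots_finite finite_subset by blast
  define G where "G = (\<Prod>a\<in>?A. [:-a, 1:] ^ \<mu> a)"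
  have G0: "G \<noteq> 0" unfolding G_def using fin by auto
  have degG: "degree G = (\<Sum>a\<in>?A. \<mu> a)"
    unfolding G_def by (subst degree_prod_eq_sum_degree) (auto simp: degree_power_eq)
  have ordG: "order x G = \<mu> x" for x
  proof -
    have "proots G = (\<Sum>a\<in>?A. repeat_mset (\<mu> a) {#a#})"
      unfolding G_def by (subst proots_prod) (simp_all only: proots_power proots_linear, simp_all)
    then have "count (proots G) x = (\<Sum>a\<in>?A. if a = x then \<mu> a else 0)"
      by (auto simp: count_sum intro!: sum.cong)
    also have "\<dots> = \<mu> x" using fin by (simp add: sum.delta)
    finally show ?thesis using G0 by simp
  qed
  \<comment> \<open>The excess of the formal degree over the degree of \<open>G\<close> puts exactly
    \<nu> zeros on the line t2 = 0.\<close>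
  define c0 where "c0 = binary_form (\<nu> + degree G) G"
  have c0: "hom2 (\<nu> + degree G) c0" "spec2 c0 = G"
    unfolding c0_def by (rule hom2_binary_form, simp add: spec2_binary_form)
  have c00: "c0 \<noteq> 0" using G0 c0(2) by (auto simp: spec2_def)
  have ord0: "order 0 (spec1 c0) = \<nu>" unfolding order_spec1[OF c0(1) c00] c0(2) by simp
  have div: "c0 dvd r" if r: "r \<in> C" for r
  proof (cases "r = 0")
    case False
    note nz = hom2_nonzero[OF hom[OF r] False]
    show ?thesis
    proof (rule hom2_dvd_iff(1)[OF c0(1) c00 hom[OF r] False])
      show "spec2 c0 dvd spec2 r" unfolding c0(2)
      proof (rule alg_closed_dvdI[OF G0])
        show "order x G \<le> order x (spec2 r)" for x
          unfolding ordG using \<mu>[of x "\<mu> x"] r nz order_divides[of x "\<mu> x" "spec2 r"] by auto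
      qed (use nz in simp)
      show "order 0 (spec1 c0) \<le> order 0 (spec1 r)"
        unfolding ord0 using \<nu>[of \<nu>] r nz order_divides[of 0 \<nu> "spec1 r"] by auto
    qed
  qed simp
  have greatest: "e dvd c0 \<and> (\<exists>m \<le> \<nu> + degree G. hom2 m e)" if e: "\<forall>r\<in>C. e dvd r" for e
  proof -
    obtain w where w: "r0 = e * w" using e r0(1) by blast
    then obtain m where m: "hom2 m e" using hom2_divisor[of n e w] hom[OF r0(1)] r0(2) by auto
    have e0: "e \<noteq> 0" using w r0(2) by auto
    note nz = hom2_nonzero[OF m e0]
    have d2: "spec2 e dvd spec2 r" and d1: "spec1 e dvd spec1 r" if "r \<in> C" for r
      using e that by (metis dvd_def spec_mult(1), metis dvd_def spec_mult(2) e that)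
    have "spec2 e dvd spec2 c0" unfolding c0(2)
    proof (rule alg_closed_dvdI[OF _ G0])
      show "order x (spec2 e) \<le> order x G" for x
        unfolding ordG \<mu>[symmetric] using d2 order_1 dvd_trans by blast
    qed (use nz in simp)
    moreover have "order 0 (spec1 e) \<le> order 0 (spec1 c0)"
      unfolding ord0 \<nu>[symmetric] using d1 order_1 dvd_trans by blast
    ultimately show ?thesis using hom2_dvd_iff[OF m e0 c0(1) c00] m by blast
  qed
  \<comment> \<open>The choice is only known to be some greatest common divisor, so its degree is
    compared with that of \<open>c0\<close> from both sides.\<close>
  define c where "c = (SOME c. is_gcd_of C c)"
  have "is_gcd_of C c0" unfolding is_gcd_of_def using div greatest by blast
  then have c: "is_gcd_of C c" unfolding c_def by (rule someI)
  then have "c0 dvd c" and cr: "\<forall>r\<in>C. c dvd r" using div unfolding is_gcd_of_def by blast+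
  obtain m where m: "m \<le> \<nu> + degree G" "hom2 m c" using greatest[OF cr] by blast
  have cnz: "c \<noteq> 0" using cr r0 by auto
  have "\<nu> + degree G \<le> m"
  proof (rule hom2_dvd_iff(2)[OF c0(1) c00 m(2) cnz])
    obtain w where w: "c = c0 * w" using \<open>c0 dvd c\<close> by blast
    show "spec2 c0 dvd spec2 c" unfolding w spec_mult by simp
    have "order 0 (spec1 c) = order 0 (spec1 c0) + order 0 (spec1 w)"
      using hom2_nonzero[OF m(2) cnz] unfolding w spec_mult by (intro order_mult) simp
    then show "order 0 (spec1 c0) \<le> order 0 (spec1 c)" by simp
  qed
  then show "tdeg2 (SOME c. is_gcd_of C c) = \<nu> + (\<Sum>a\<in>?A. \<mu> a)"
    using tdeg2_hom2[OF m(2) cnz] m(1) unfolding c_def degG by simp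
qed

subsection \<open>Substitution for the six indeterminates\<close>

lemma sub_const: "comm_ring_hom h \<Longrightarrow> sub h x [:c:] = h c"
  and sub_var: "comm_ring_hom h \<Longrightarrow> sub h x (monom 1 1) = x"
proof -
  assume "comm_ring_hom h"
  then interpret comm_ring_hom h .
  show "sub h x [:c:] = h c" by (simp add: sub_def map_poly_const)
  show "sub h x (monom 1 1) = x" by (simp add: sub_def poly_monom map_poly_monom)
qed

lemma sub_unique:
  assumes "comm_ring_hom H" shows "H p = sub (\<lambda>c. H [:c:]) (H (monom 1 1)) p"
proof -
  interpret comm_ring_hom H by fact
  have h: "comm_ring_hom (\<lambda>c. H [:c:])" by (rule ring_hom_comp[OF assms ring_hom_const])
  interpret s: comm_ring_hom "sub (\<lambda>c. H [:c:]) (H (monom 1 1))" by (rule ring_hom_sub[OF h])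
  show ?thesis
  proof (induction p)
    case (pCons a p)
    have e: "pCons a p = [:a:] + monom 1 1 * p" by (simp add: monom_Suc monom_0)
    show ?case
      unfolding e by (simp only: hom_add hom_mult s.hom_add s.hom_mult sub_const[OF h] sub_var[OF h] flip: pCons(2))
  qed (simp only: hom_zero s.hom_zero)
qed

definition sub6 :: "('c::comm_ring_1 \<Rightarrow> 'd::comm_ring_1) \<Rightarrow> (nat \<Rightarrow> 'd) \<Rightarrow> 'c poly6 \<Rightarrow> 'd" where
  "sub6 h Y = sub (sub (sub (sub (sub (sub h (Y 1)) (Y 2)) (Y 3)) (Y 4)) (Y 5)) (Y 6)"

lemma ring_hom_sub6: "comm_ring_hom h \<Longrightarrow> comm_ring_hom (sub6 h Y)"
  unfolding sub6_def by (intro ring_hom_sub)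

lemma sub6_const6: "comm_ring_hom h \<Longrightarrow> sub6 h Y (const6 c) = h c"
  unfolding sub6_def const6_def by (simp add: sub_const ring_hom_sub)

lemma sub6_var6: "comm_ring_hom h \<Longrightarrow> k \<in> {1..6} \<Longrightarrow> sub6 h Y (var6 k) = Y k"
proof -
  assume h: "comm_ring_hom h" and "k \<in> {1..6}"
  then have "k = 1 \<or> k = 2 \<or> k = 3 \<or> k = 4 \<or> k = 5 \<or> k = 6" by auto
  then show ?thesis unfolding sub6_def var6_def
    by (elim disjE) (simp_all add: sub_const sub_var ring_hom_sub h del: One_nat_def)
qed

lemma ring_hom_const6: "comm_ring_hom (const6 :: 'c::comm_ring_1 \<Rightarrow> _)"
  unfolding const6_def[abs_def] by (intro ring_hom_comp[OF ring_hom_const] ring_hom_const)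

lemma sub6_unique:
  assumes H: "comm_ring_hom H" shows "H p = sub6 (\<lambda>c. H (const6 c)) (\<lambda>k. H (var6 k)) p"
proof -
  note c = ring_hom_comp[OF _ ring_hom_const]
  show ?thesis
    unfolding sub6_def const6_def var6_def
    by (simp del: One_nat_def, subst sub_unique[OF H], subst sub_unique[OF c[OF H]], subst sub_unique[OF c[OF c[OF H]]],
      subst sub_unique[OF c[OF c[OF c[OF H]]]], subst sub_unique[OF c[OF c[OF c[OF c[OF H]]]]],
      subst sub_unique[OF c[OF c[OF c[OF c[OF c[OF H]]]]]], rule refl)
qed

text \<open>Induction over six nested layers is avoided: identities between substitutions are
  checked on constants and variables, by the universal property.\<close>

lemma ring_hom6_eqI:
  assumes "comm_ring_hom H" "comm_ring_hom H'" "\<And>c. H (const6 c) = H' (const6 c)"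
    "\<And>k. k \<in> {1..6} \<Longrightarrow> H (var6 k) = H' (var6 k)"
  shows "H p = H' p"
proof -
  have "sub6 (\<lambda>c. H (const6 c)) (\<lambda>k. H (var6 k)) = sub6 (\<lambda>c. H' (const6 c)) (\<lambda>k. H' (var6 k))"
    unfolding sub6_def using assms(3,4) by simp
  then show ?thesis using sub6_unique[OF assms(1)] sub6_unique[OF assms(2)] by metis
qed

definition map6 :: "('c::comm_ring_1 \<Rightarrow> 'd::comm_ring_1) \<Rightarrow> 'c poly6 \<Rightarrow> 'd poly6" where
  "map6 h = map_poly (map_poly (map_poly (map_poly (map_poly (map_poly h)))))"

lemma ring_hom_map6: "comm_ring_hom h \<Longrightarrow> comm_ring_hom (map6 h)"
  unfolding map6_def by (intro ring_hom_map_poly)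

lemma ring_hom_0: "comm_ring_hom h \<Longrightarrow> h 0 = 0" and ring_hom_1: "comm_ring_hom h \<Longrightarrow> h 1 = 1"
proof -
  assume "comm_ring_hom h"
  then interpret comm_ring_hom h .
  show "h 0 = 0" "h 1 = 1" by (rule hom_zero hom_one)+
qed

lemma map6_const6: "h 0 = 0 \<Longrightarrow> map6 h (const6 c) = const6 (h c)"
  unfolding map6_def const6_def by (simp add: map_poly_const)

lemma map6_var6: "h 0 = 0 \<Longrightarrow> h 1 = 1 \<Longrightarrow> map6 h (var6 k) = var6 k"
  unfolding map6_def var6_def by (auto simp: map_poly_const map_poly_monom)

lemma coeffs6_range: "coeffs6 R = range (\<lambda>(a, b, c, d, e, f).
    coeff (coeff (coeff (coeff (coeff (coeff R a) b) c) d) e) f)"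
  unfolding coeffs6_def by (auto simp: image_iff intro!: exI)

lemma coeffs6_map6: "h 0 = 0 \<Longrightarrow> coeffs6 (map6 h R) = h ` coeffs6 R"
  unfolding map6_def coeffs6_range image_image by (simp add: coeff_map_poly case_prod_unfold)

lemma const6_dvd_iff: "const6 x dvd R \<longleftrightarrow> (\<forall>r\<in>coeffs6 R. x dvd r)" for x :: "'c::idom"
  unfolding const6_def const_poly_dvd_iff coeffs6_range by (simp add: case_prod_unfold split_paired_all)

lemma coeffs6_nonzero: "R \<noteq> 0 \<Longrightarrow> \<exists>r\<in>coeffs6 R. r \<noteq> 0" for R :: "'c::idom poly6"
  using const6_dvd_iff[of 0 R] by (auto simp: const6_def)

lemma sub6_map6:
  assumes "comm_ring_hom h" "comm_ring_hom k" shows "sub6 k Y (map6 h R) = sub6 (\<lambda>c. k (h c)) Y R"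
  by (rule ring_hom6_eqI[OF ring_hom_comp[OF ring_hom_sub6[OF assms(2)] ring_hom_map6[OF assms(1)]] ring_hom_sub6[OF ring_hom_comp[OF assms(2,1)]]])
    (simp_all add: map6_const6 map6_var6 sub6_const6 sub6_var6 ring_hom_0 ring_hom_1 assms ring_hom_comp)

text \<open>As the \<open>Y k\<close> are algebraically independent over the ground field,
  coefficients cannot cancel to create a zero at a ground field point. For one factor, evaluation at
  \<open>E a\<close> gives a polynomial over the ground field, taken at the \<open>Y k\<close>,
  which vanishes only if all its coefficients do; higher powers follow by dividing out.\<close>

lemma order_transfer:
  fixes E :: "'a::field \<Rightarrow> 'f::field" and R :: "'a poly poly6"
  assumes E: "comm_ring_hom E" and inj: "\<And>p. sub6 E Y p = 0 \<Longrightarrow> p = 0"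
  shows "(\<forall>r\<in>coeffs6 R. [:-a, 1:] ^ m dvd r) \<longleftrightarrow> [:- E a, 1:] ^ m dvd sub6 (map_poly E) (\<lambda>k. [:Y k:]) R"
proof -
  let ?T = "sub6 (map_poly E) (\<lambda>k. [:Y k:])"
  interpret E: comm_ring_hom E by fact
  have mE: "comm_ring_hom (map_poly E)" by (rule ring_hom_map_poly[OF E])
  interpret T: comm_ring_hom ?T by (rule ring_hom_sub6[OF mE])
  have lin: "map_poly E [:-a, 1:] = [:- E a, 1:]"
  proof -
    have "map_poly E (pCons (- a) [:1:]) = pCons (E (- a)) (map_poly E [:1:])" by (rule map_poly_pCons) simp
    then show ?thesis by (simp only: map_poly_const[of E, OF E.hom_zero] E.hom_one E.hom_uminus)
  qed
  have pow: "map_poly E ([:-a, 1:] ^ k) = [:- E a, 1:] ^ k" for k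
  proof -
    interpret mE: comm_ring_hom "map_poly E" by (rule mE)
    show ?thesis by (simp only: mE.hom_power lin)
  qed
  have up: "[:- E a, 1:] ^ k dvd ?T R" if dvd: "\<forall>r\<in>coeffs6 R. [:-a, 1:] ^ k dvd r" for k and R :: "'a poly poly6"
  proof -
    obtain S where S: "R = const6 ([:-a, 1:] ^ k) * S" using dvd unfolding const6_dvd_iff[symmetric] by blast
    have "?T R = [:- E a, 1:] ^ k * ?T S" by (simp only: S T.hom_mult sub6_const6[OF mE] pow)
    then show ?thesis by (metis dvd_triv_left)
  qed
  have down: "\<forall>r\<in>coeffs6 R. [:-a, 1:] dvd r" if "[:- E a, 1:] dvd ?T R" for R :: "'a poly poly6"
  proof -
    have ev: "comm_ring_hom (\<lambda>p :: 'a poly. poly p a)" "comm_ring_hom (\<lambda>p :: 'f poly. poly p (E a))"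
      by (unfold_locales; simp)+
    have "poly (?T R) (E a) = sub6 E Y (map6 (\<lambda>p. poly p a) R)"
    proof (rule ring_hom6_eqI[of "\<lambda>R. poly (?T R) (E a)"])
      show "comm_ring_hom (\<lambda>R. poly (?T R) (E a))" by (rule ring_hom_comp[OF ev(2) ring_hom_sub6[OF mE]])
      show "comm_ring_hom (\<lambda>R. sub6 E Y (map6 (\<lambda>p. poly p a) R))"
        by (rule ring_hom_comp[OF ring_hom_sub6[OF E] ring_hom_map6[OF ev(1)]])
    qed (simp_all add: sub6_const6 sub6_var6 map6_const6 map6_var6 mE E)
    moreover have "poly (?T R) (E a) = 0" using that by (simp add: poly_eq_0_iff_dvd)
    ultimately have "map6 (\<lambda>p. poly p a) R = 0" using inj by metis
    then have "coeffs6 (map6 (\<lambda>p. poly p a) R) = {0}" unfolding coeffs6_def by auto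
    then have "(\<lambda>p. poly p a) ` coeffs6 R = {0}" using coeffs6_map6[of "\<lambda>p. poly p a" R] by simp
    then have "poly r a = 0" if "r \<in> coeffs6 R" for r using that by auto
    then show ?thesis by (simp add: poly_eq_0_iff_dvd)
  qed
  show ?thesis
  proof (induction m arbitrary: R)
    case (Suc m)
    show ?case
    proof
      assume T: "[:- E a, 1:] ^ Suc m dvd ?T R"
      then have "[:- E a, 1:] ^ m dvd ?T R" by (metis dvd_trans le_imp_power_dvd le_SucI le_refl)
      then have "const6 ([:-a, 1:] ^ m) dvd R" using Suc unfolding const6_dvd_iff by blast
      \<comment> \<open>The power \<open>m\<close> already divides all coefficients, so it can be
        cancelled and the case of one factor applied to \<open>S\<close>.\<close>
      then obtain S where S: "R = const6 ([:-a, 1:] ^ m) * S" by blast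
      have "?T R = [:- E a, 1:] ^ m * ?T S" by (simp only: S T.hom_mult sub6_const6[OF mE] pow)
      then have "[:- E a, 1:] ^ m * [:- E a, 1:] dvd [:- E a, 1:] ^ m * ?T S" using T by (simp add: mult.commute)
      then have "[:- E a, 1:] dvd ?T S" by (rule dvd_mult_cancel_left[THEN iffD1, THEN disjE]) auto
      then have "const6 [:-a, 1:] dvd S" using down unfolding const6_dvd_iff by blast
      moreover have "const6 ([:-a, 1:] ^ Suc m) = const6 ([:-a, 1:] ^ m) * const6 [:-a, 1:]"
        using comm_ring_hom_laws(2)[OF ring_hom_const6] by (metis power_Suc2)
      ultimately show "\<forall>r\<in>coeffs6 R. [:-a, 1:] ^ Suc m dvd r"
        unfolding const6_dvd_iff[symmetric] S by (simp add: mult_dvd_mono del: power_Suc)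
    qed (rule up)
  qed simp
qed

subsection \<open>The resultant of the generic members\<close>

definition iota6 :: "'a::field poly6 \<Rightarrow> 'a FF" where "iota6 p = to_ac (Fract p 1)"

lemma ring_hom_iota6: "comm_ring_hom (iota6 :: 'a::field poly6 \<Rightarrow> 'a FF)"
  unfolding iota6_def[abs_def]
  by unfold_locales (simp_all flip: Zero_fract_def One_fract_def to_ac_add to_ac_mult)

lemma iota6_eq_0: "iota6 p = 0 \<Longrightarrow> p = 0"
  unfolding iota6_def by (simp add: Zero_fract_def eq_fract)

lemma embK_iota6: "embK a = iota6 (const6 a)" and indetF_iota6: "indetF k = iota6 (var6 k)"
  by (simp_all add: embK_def indetF_def iota6_def)

lemma ring_hom_embK: "comm_ring_hom (embK :: 'a::field \<Rightarrow> 'a FF)"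
  unfolding embK_iota6[abs_def] by (rule ring_hom_comp[OF ring_hom_iota6 ring_hom_const6])

lemma embK_eq_0: "embK a = 0 \<longleftrightarrow> a = 0"
proof
  assume "embK a = 0"
  then have "const6 a = 0" unfolding embK_iota6 by (rule iota6_eq_0)
  then show "a = 0" by (simp add: const6_def)
qed (simp add: ring_hom_0[OF ring_hom_embK])

lemma embK_inj: "embK a = embK b \<longleftrightarrow> a = b"
proof -
  interpret comm_ring_hom embK by (rule ring_hom_embK)
  have "embK (a - b) = 0 \<longleftrightarrow> a - b = 0" by (rule embK_eq_0)
  then show ?thesis by (simp add: hom_minus)
qed

text \<open>\<open>m\<close> is the inverse of the transpose of \<open>l\<close>: when the forms are
  transformed by \<open>l\<close>, the indeterminates have to be transformed
  contragrediently.\<close>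

lemma inverse_transpose3:
  fixes l :: "nat \<Rightarrow> nat \<Rightarrow> 'a::field"
  assumes "det3 l \<noteq> 0"
  obtains m where "\<And>j k. j \<in> {1,2,3} \<Longrightarrow> k \<in> {1,2,3} \<Longrightarrow> (\<Sum>i\<in>{1,2,3}. l i j * m i k) = (if j = k then 1 else 0)"
    "\<And>i i'. i \<in> {1,2,3} \<Longrightarrow> i' \<in> {1,2,3} \<Longrightarrow> (\<Sum>k\<in>{1,2,3}. m i k * l i' k) = (if i = i' then 1 else 0)"
proof -
  \<comment> \<open>\<open>C i k\<close> is the cofactor of \<open>l i k\<close>.\<close>
  define C where "C = (\<lambda>(i :: nat) (k :: nat).
    if i = 1 then (if k = 1 then l 2 2 * l 3 3 - l 2 3 * l 3 2 else if k = 2 then l 2 3 * l 3 1 - l 2 1 * l 3 3 else l 2 1 * l 3 2 - l 2 2 * l 3 1)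
    else if i = 2 then (if k = 1 then l 1 3 * l 3 2 - l 1 2 * l 3 3 else if k = 2 then l 1 1 * l 3 3 - l 1 3 * l 3 1 else l 1 2 * l 3 1 - l 1 1 * l 3 2)
    else (if k = 1 then l 1 2 * l 2 3 - l 1 3 * l 2 2 else if k = 2 then l 1 3 * l 2 1 - l 1 1 * l 2 3 else l 1 1 * l 2 2 - l 1 2 * l 2 1))"
  have 1: "(\<Sum>i\<in>{1,2,3}. l i j * C i k) = (if j = k then det3 l else 0)" if "j \<in> {1,2,3}" "k \<in> {1,2,3}" for j k
    using that by (auto simp: C_def det3_def algebra_simps)
  have 2: "(\<Sum>k\<in>{1,2,3}. C i k * l i' k) = (if i = i' then det3 l else 0)" if "i \<in> {1,2,3}" "i' \<in> {1,2,3}" for i i'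
    using that by (auto simp: C_def det3_def algebra_simps)
  show thesis
  proof (rule that[of "\<lambda>i k. C i k / det3 l"])
    fix j k :: nat assume "j \<in> {1,2,3}" "k \<in> {1,2,3}"
    then show "(\<Sum>i\<in>{1,2,3}. l i j * (C i k / det3 l)) = (if j = k then 1 else 0)"
      using 1[of j k] assms by (simp only: times_divide_eq_right sum_divide_distrib[symmetric]) simp
  next
    fix i i' :: nat assume "i \<in> {1,2,3}" "i' \<in> {1,2,3}"
    then show "(\<Sum>k\<in>{1,2,3}. (C i k / det3 l) * l i' k) = (if i = i' then 1 else 0)"
      using 2[of i i'] assms by (simp only: times_divide_eq_left sum_divide_distrib[symmetric]) simp
  qed
qed

text \<open>Values of the indeterminates under which the generic members of the transformed system become
  those of the original one; they are again algebraically independent.\<close>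

lemma transformed_indeterminates:
  fixes l :: "nat \<Rightarrow> nat \<Rightarrow> 'a::field"
  assumes "det3 l \<noteq> 0"
  obtains Y :: "nat \<Rightarrow> 'a FF" where "\<And>p. sub6 embK Y p = 0 \<Longrightarrow> p = 0"
    "\<And>j. j \<in> {1,2,3} \<Longrightarrow> (\<Sum>i\<in>{1,2,3}. Y i * embK (l i j)) = indetF j"
    "\<And>j. j \<in> {1,2,3} \<Longrightarrow> (\<Sum>i\<in>{1,2,3}. Y (i + 3) * embK (l i j)) = indetF (j + 3)"
proof -
  obtain m where m1: "\<And>j k. j \<in> {1,2,3} \<Longrightarrow> k \<in> {1,2,3} \<Longrightarrow> (\<Sum>i\<in>{1,2,3}. l i j * m i k) = (if j = k then 1 else 0)"
    and m2: "\<And>i i'. i \<in> {1,2,3} \<Longrightarrow> i' \<in> {1,2,3} \<Longrightarrow> (\<Sum>k\<in>{1,2,3}. m i k * l i' k) = (if i = i' then 1 else 0)"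
    using inverse_transpose3[OF assms] by blast
  interpret i: comm_ring_hom "iota6 :: 'a poly6 \<Rightarrow> 'a FF" by (rule ring_hom_iota6)
  interpret c: comm_ring_hom "const6 :: 'a \<Rightarrow> 'a poly6" by (rule ring_hom_const6)
  \<comment> \<open>\<open>o3\<close> is the offset of a block of indeterminates, so that x and y
    are handled by one formula.\<close>
  define o3 where "o3 = (\<lambda>i :: nat. if i \<le> 3 then 0 else 3 :: nat)"
  define Xp :: "nat \<Rightarrow> 'a poly6" where "Xp = (\<lambda>i. \<Sum>k\<in>{1,2,3}. const6 (m (i - o3 i) k) * var6 (k + o3 i))"
  define Yp :: "nat \<Rightarrow> 'a poly6" where "Yp = (\<lambda>j. \<Sum>i\<in>{1,2,3}. const6 (l i (j - o3 j)) * var6 (i + o3 j))"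
  define Y where "Y = (\<lambda>i. iota6 (Xp i))"
  have lin: "(\<Sum>i\<in>{1,2,3}. Xp (i + e) * const6 (l i j)) = var6 (j + e)" if j: "j \<in> {1,2,3}" and e: "e = 0 \<or> e = 3" for j e
  proof -
    have o3: "o3 (i + e) = e" if "i \<in> {1,2,3}" for i using e that by (auto simp: o3_def)
    have "(\<Sum>i\<in>{1,2,3}. Xp (i + e) * const6 (l i j)) =
      (\<Sum>i\<in>{1,2,3}. \<Sum>k\<in>{1,2,3}. const6 (l i j * m i k) * var6 (k + e))"
    proof (rule sum.cong[OF refl])
      fix i :: nat assume "i \<in> {1,2,3}"
      then have "Xp (i + e) = (\<Sum>k\<in>{1,2,3}. const6 (m i k) * var6 (k + e))" unfolding Xp_def o3[OF \<open>i \<in> {1,2,3}\<close>] by simp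
      then show "Xp (i + e) * const6 (l i j) = (\<Sum>k\<in>{1,2,3}. const6 (l i j * m i k) * var6 (k + e))"
        by (simp only: sum_distrib_left c.hom_mult mult_ac)
    qed
    also have "\<dots> = (\<Sum>k\<in>{1,2,3}. const6 (\<Sum>i\<in>{1,2,3}. l i j * m i k) * var6 (k + e))"
      by (subst sum.swap) (simp only: c.hom_sum sum_distrib_right)
    also have "\<dots> = (\<Sum>k\<in>{1,2,3}. if j = k then var6 (k + e) else 0)"
      using m1[OF j] by (intro sum.cong refl) simp
    also have "\<dots> = var6 (j + e)" using j by (subst sum.delta') auto
    finally show ?thesis .
  qed
  show thesis
  proof (rule that[of Y])
    show "(\<Sum>i\<in>{1,2,3}. Y i * embK (l i j)) = indetF j" if "j \<in> {1,2,3}" for j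
      using arg_cong[OF lin[OF that, of 0], of iota6] unfolding Y_def embK_iota6 indetF_iota6
      by (simp only: i.hom_sum i.hom_mult add_0_right simp_thms)
    show "(\<Sum>i\<in>{1,2,3}. Y (i + 3) * embK (l i j)) = indetF (j + 3)" if "j \<in> {1,2,3}" for j
      using arg_cong[OF lin[OF that, of 3], of iota6] unfolding Y_def embK_iota6 indetF_iota6
      by (simp only: i.hom_sum i.hom_mult simp_thms)
    fix p assume p: "sub6 embK Y p = 0"
    have "sub6 embK Y p = iota6 (sub6 const6 Xp p)"
      by (rule ring_hom6_eqI[OF ring_hom_sub6[OF ring_hom_embK] ring_hom_comp[OF ring_hom_iota6 ring_hom_sub6[OF ring_hom_const6]]])
        (simp_all add: sub6_const6 sub6_var6 ring_hom_embK ring_hom_const6 embK_iota6 Y_def)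
    then have 0: "sub6 const6 Xp p = 0" using p iota6_eq_0 by metis
    \<comment> \<open>The inverse substitution recovers \<open>p\<close>, so the new values inherit
      algebraic independence.\<close>
    have "sub6 const6 Yp (sub6 const6 Xp p) = p"
    proof (rule ring_hom6_eqI[OF ring_hom_comp[OF ring_hom_sub6[OF ring_hom_const6] ring_hom_sub6[OF ring_hom_const6]]])
      show "comm_ring_hom (\<lambda>p :: 'a poly6. p)" by unfold_locales auto
      show "sub6 const6 Yp (sub6 const6 Xp (const6 c)) = const6 c" for c
        by (simp add: sub6_const6 ring_hom_const6)
      fix k :: nat assume k: "k \<in> {1..6}"
      define e where "e = o3 k"
      define i where "i = k - e"
      have ie: "i \<in> {1,2,3}" "k = i + e" "e = 0 \<or> e = 3" using k by (auto simp: i_def e_def o3_def)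
      have ee: "o3 (q + e) = e" "q + e \<in> {1..6}" if "q \<in> {1,2,3}" for q using ie(3) that by (auto simp: o3_def)
      interpret s: comm_ring_hom "sub6 const6 Yp" by (rule ring_hom_sub6[OF ring_hom_const6])
      have "sub6 const6 Yp (sub6 const6 Xp (var6 k)) = sub6 const6 Yp (\<Sum>q\<in>{1,2,3}. const6 (m i q) * var6 (q + e))"
        unfolding sub6_var6[OF ring_hom_const6 k] Xp_def i_def e_def ..
      also have "\<dots> = (\<Sum>q\<in>{1,2,3}. const6 (m i q) * Yp (q + e))"
        unfolding s.hom_sum s.hom_mult using ee(2)
        by (intro sum.cong refl) (simp add: sub6_const6[OF ring_hom_const6] sub6_var6[OF ring_hom_const6])
      also have "\<dots> = (\<Sum>q\<in>{1,2,3}. \<Sum>i'\<in>{1,2,3}. const6 (m i q * l i' q) * var6 (i' + e))"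
      proof (rule sum.cong[OF refl])
        fix q :: nat assume q: "q \<in> {1,2,3}"
        have "Yp (q + e) = (\<Sum>i'\<in>{1,2,3}. const6 (l i' q) * var6 (i' + e))" unfolding Yp_def ee(1)[OF q] by simp
        then show "const6 (m i q) * Yp (q + e) = (\<Sum>i'\<in>{1,2,3}. const6 (m i q * l i' q) * var6 (i' + e))"
          by (simp only: sum_distrib_left c.hom_mult mult.assoc)
      qed
      also have "\<dots> = (\<Sum>i'\<in>{1,2,3}. const6 (\<Sum>q\<in>{1,2,3}. m i q * l i' q) * var6 (i' + e))"
        by (subst sum.swap) (simp only: c.hom_sum sum_distrib_right)
      also have "\<dots> = (\<Sum>i'\<in>{1,2,3}. if i = i' then var6 (i' + e) else 0)"
        using m2[OF ie(1)] by (intro sum.cong refl) simp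
      also have "\<dots> = var6 k" using ie by (subst sum.delta') auto
      finally show "sub6 const6 Yp (sub6 const6 Xp (var6 k)) = var6 k" .
    qed
    then show "p = 0" using 0 ring_hom_0[OF ring_hom_sub6[OF ring_hom_const6], of Yp] by simp
  qed
qed

section \<open>Nonvanishing and homogeneity of the generic resultant\<close>

definition gen :: "nat \<Rightarrow> (nat \<Rightarrow> 'c::comm_ring_1 poly) \<Rightarrow> 'c poly6 poly" where
  "gen e p = (\<Sum>i\<in>{1,2,3}. [:var6 (i + e):] * map_poly const6 (p i))"

lemma V1L_gen: "V1L l s = gen 0 (Lform l s)" and V2L_gen: "V2L l s = gen 3 (Lform l s)"
  by (simp_all add: V1L_def V2L_def gen_def)

lemma map_gen:
  fixes H :: "'c::comm_ring_1 poly6 \<Rightarrow> 'd::comm_ring_1"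
  assumes H: "comm_ring_hom H"
  shows "map_poly H (gen e p) = (\<Sum>i\<in>{1,2,3}. [:H (var6 (i + e)):] * map_poly (\<lambda>c. H (const6 c)) (p i))"
proof -
  interpret m: comm_ring_hom "map_poly H" by (rule ring_hom_map_poly[OF H])
  have "map_poly H (map_poly const6 q) = map_poly (\<lambda>c. H (const6 c)) q" for q
    by (rule poly_eqI) (simp add: coeff_map_poly ring_hom_0[OF H] ring_hom_0[OF ring_hom_const6])
  then show ?thesis
    unfolding gen_def by (simp only: m.hom_sum m.hom_mult map_poly_const[of H, OF ring_hom_0[OF H]])
qed

lemma coeff_gen: "coeff (gen e p) k = (\<Sum>i\<in>{1,2,3}. var6 (i + e) * const6 (coeff (p i) k))"
  unfolding gen_def coeff_sum
  by (rule sum.cong[OF refl]) (simp add: coeff_map_poly ring_hom_0[OF ring_hom_const6])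

lemma degree_gen:
  assumes "\<And>i. i \<in> {1,2,3} \<Longrightarrow> degree (p i) \<le> n" shows "degree (gen e p) \<le> n"
proof (rule degree_le, intro allI impI)
  fix k assume "n < k"
  then have "coeff (p i) k = 0" if "i \<in> {1,2,3}" for i using assms[OF that] by (intro coeff_eq_0) auto
  then show "coeff (gen e p) k = 0" unfolding coeff_gen
    by (intro sum.neutral ballI) (simp add: ring_hom_0[OF ring_hom_const6])
qed

text \<open>The top coefficients survive \<open>H\<close>, so both degrees and the size of the
  Sylvester matrix are kept; this is what makes the resultant commute with \<open>H\<close>.\<close>

lemma resultant_specialize:
  assumes H: "comm_ring_hom H" and P: "degree P \<le> n" "H (coeff P n) \<noteq> 0" and Q: "degree Q \<le> m" "H (coeff Q m) \<noteq> 0"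
  shows "resultant (map_poly H P) (map_poly H Q) = H (resultant P Q)"
    "degree (map_poly H P) = n" "degree (map_poly H Q) = m"
proof -
  have *: "degree (map_poly H P) = n \<and> degree P = n" if "degree P \<le> n" "H (coeff P n) \<noteq> 0" for P n
  proof -
    have "coeff P n \<noteq> 0" using that ring_hom_0[OF H] by auto
    moreover have "coeff (map_poly H P) n \<noteq> 0" using that ring_hom_0[OF H] by (simp add: coeff_map_poly)
    moreover have "degree (map_poly H P) \<le> degree P" by (rule degree_map_poly_le)
    ultimately show ?thesis using that(1) le_degree by (metis le_antisym le_trans)
  qed
  show "resultant (map_poly H P) (map_poly H Q) = H (resultant P Q)"
    using *[OF P] *[OF Q] by (intro comm_ring_hom.resultant_map_poly[OF H]) auto
  show "degree (map_poly H P) = n" "degree (map_poly H Q) = m" using *[OF P] *[OF Q] by auto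
qed

text \<open>The x indeterminates are sent to 1, 0, 0 and the y indeterminates to 1, x, x^2, so one
  nonzero value suffices. Keeping \<open>p 1\<close> in the second member controls its leading
  coefficient, while the two powers of x separate \<open>p 2\<close> from
  \<open>p 3\<close>.\<close>

lemma gen_resultant_nonzero:
  fixes p :: "nat \<Rightarrow> 'c::idom poly"
  assumes deg: "\<And>i. i \<in> {1,2,3} \<Longrightarrow> degree (p i) \<le> n" and lc: "coeff (p 1) n \<noteq> 0"
    and lc': "coeff (p 1 + smult x (p 2) + smult (x\<^sup>2) (p 3)) n \<noteq> 0"
    and res: "resultant (p 1) (p 1 + smult x (p 2) + smult (x\<^sup>2) (p 3)) \<noteq> 0"
  shows "resultant (gen 0 p) (gen 3 p) \<noteq> 0"
proof -
  have id: "comm_ring_hom (\<lambda>c :: 'c. c)" by unfold_locales auto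
  define Z where "Z = (\<lambda>k :: nat. if k = 1 \<or> k = 4 then 1 else if k = 5 then x else if k = 6 then x\<^sup>2 else 0)"
  let ?H = "sub6 (\<lambda>c. c) Z"
  have H: "comm_ring_hom ?H" by (rule ring_hom_sub6[OF id])
  have v: "?H (var6 k) = Z k" if "k \<in> {1..6}" for k by (rule sub6_var6[OF id that])
  have 0: "map_poly ?H (gen 0 p) = p 1"
    unfolding map_gen[OF H] sub6_const6[OF id] using v[of 1] v[of 2] v[of 3]
    by (simp add: Z_def map_poly_idI)
  have 3: "map_poly ?H (gen 3 p) = p 1 + smult x (p 2) + smult (x\<^sup>2) (p 3)"
    unfolding map_gen[OF H] sub6_const6[OF id] using v[of 4] v[of 5] v[of 6]
    by (simp add: Z_def map_poly_idI)
  have co: "?H (coeff P n) = coeff (map_poly ?H P) n" for P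
    using ring_hom_0[OF H] by (simp add: coeff_map_poly)
  have "resultant (map_poly ?H (gen 0 p)) (map_poly ?H (gen 3 p)) = ?H (resultant (gen 0 p) (gen 3 p))"
    by (rule resultant_specialize(1)[OF H degree_gen[OF deg] _ degree_gen[OF deg]])
      (simp_all only: co 0 3 lc lc' not_False_eq_True)
  then show ?thesis using res ring_hom_0[OF H] unfolding 0 3 by auto
qed

text \<open>Euclid's lemma, with coprimality expressed through irreducible divisors: the prime
  factors of \<open>P\<close> are cancelled from \<open>v\<close> one by one.\<close>

lemma ufd_dvd_cancel:
  fixes P Q v :: "'c::ufd"
  assumes P: "P \<noteq> 0" and cop: "\<And>q. irreducible q \<Longrightarrow> q dvd P \<Longrightarrow> \<not> q dvd Q" and dvd: "P dvd v * Q"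
  shows "P dvd v"
proof (cases "P dvd 1")
  case False
  then obtain F where F: "mset_factors F P" using mset_factors_exist[OF P] by blast
  have main: "prod_mset F dvd v" if "\<And>f. f \<in># F \<Longrightarrow> prime_elem f \<and> \<not> f dvd Q" "prod_mset F dvd v * Q"
    using that
  proof (induction F arbitrary: v)
    case (add f F)
    have f: "prime_elem f" "\<not> f dvd Q" using add(2)[of f] by auto
    have "f dvd v * Q" using dvd_mult_left[of f "prod_mset F" "v * Q"] add(3) by simp
    then have "f dvd v" using f unfolding prime_elem_def by blast
    then obtain w where w: "v = f * w" by blast
    have "f * prod_mset F dvd f * (w * Q)" using add(3) w by (simp add: mult_ac)
    moreover have "f \<noteq> 0" using f(1) unfolding prime_elem_def by blast
    ultimately have "prod_mset F dvd w * Q" by (simp only: dvd_mult_cancel_left simp_thms)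
    then have "prod_mset F dvd w" by (rule add(1)[rotated]) (rule add(2), simp)
    then show ?case using w by (simp add: mult_dvd_mono)
  qed simp
  have "prime_elem f \<and> \<not> f dvd Q" if "f \<in># F" for f
  proof -
    have "irreducible f" "f dvd P" using F that mset_factors_imp_dvd by blast+
    then show ?thesis using cop by auto
  qed
  moreover have "prod_mset F = P" using F by (simp add: mset_factors_def)
  ultimately show ?thesis using main dvd by blast
qed auto

text \<open>In a relation with cofactors of low degree, coprimality makes \<open>P\<close> divide a
  cofactor of degree below that of \<open>P\<close>, which must therefore vanish.\<close>

lemma resultant_nonzero_coprime:
  fixes P Q :: "'c::ufd poly"
  assumes P: "P \<noteq> 0" and cop: "\<And>q. irreducible q \<Longrightarrow> q dvd P \<Longrightarrow> \<not> q dvd Q"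
  shows "resultant P Q \<noteq> 0"
proof
  assume "resultant P Q = 0"
  then obtain u v where uv: "u \<in> lowdeg (degree Q)" "v \<in> lowdeg (degree P)" "u \<noteq> 0 \<or> v \<noteq> 0" "u * P + v * Q = 0"
    using resultant_0_imp_relation by blast
  have "v * Q = P * (- u)" using uv(4) by (simp add: eq_neg_iff_add_eq_0 mult.commute add.commute)
  then have "P dvd v * Q" by simp
  then have "P dvd v" using ufd_dvd_cancel[OF P cop] by blast
  have "v = 0"
  proof (rule ccontr)
    assume v: "v \<noteq> 0"
    then have "degree v < degree P" using uv(2) lowdeg_degree by blast
    then show False using dvd_imp_degree_le[OF \<open>P dvd v\<close> v] by simp
  qed
  then show False using uv(3,4) P by simp
qed

text \<open>For x nonzero, a common irreducible divisor divides p2 + x p3. If it did so for two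
  values of x it would divide \<open>p 3\<close>, then \<open>p 2\<close>, hence all three; each of
  the finitely many irreducible factors of \<open>p 1\<close> thus spoils at most one nonzero
  x.\<close>

lemma generic_coprime:
  fixes p :: "nat \<Rightarrow> 'c::ufd poly" and \<kappa> :: "'k::field \<Rightarrow> 'c"
  assumes \<kappa>: "comm_ring_hom \<kappa>" and p1: "p 1 \<noteq> 0"
    and cop: "\<And>q. irreducible q \<Longrightarrow> \<not> (\<forall>i\<in>{1,2,3}. q dvd p i)"
  shows "finite {x. \<exists>q. irreducible q \<and> q dvd p 1 \<and> q dvd p 1 + smult (\<kappa> x) (p 2) + smult ((\<kappa> x)\<^sup>2) (p 3)}"
proof (cases "p 1 dvd 1")
  case True
  then have "\<not> q dvd p 1" if "irreducible q" for q using irreducible_not_unit[OF that] dvd_trans[OF _ True] by blast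
  then show ?thesis by (intro finite_subset[OF _ finite.emptyI]) blast
next
  case False
  interpret \<kappa>: comm_ring_hom \<kappa> by fact
  have unit: "\<kappa> x * \<kappa> (inverse x) = 1" if "x \<noteq> 0" for x using that by (simp flip: \<kappa>.hom_mult)
  have cancel: "q dvd r" if "q dvd smult (\<kappa> x) r" "x \<noteq> 0" for q r x
  proof -
    have "q dvd smult (\<kappa> (inverse x)) (smult (\<kappa> x) r)" using that(1) by (rule dvd_smult)
    then show ?thesis using unit[OF that(2)] by (simp add: mult.commute)
  qed
  obtain F where F: "mset_factors F (p 1)" using mset_factors_exist[OF p1 False] by blast
  define B where "B = (\<lambda>f. {x. x \<noteq> 0 \<and> f dvd p 2 + smult (\<kappa> x) (p 3)})"
  have finB: "finite (B f)" if f: "f \<in># F" for f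
  proof -
    have f': "irreducible f" "f dvd p 1" using F f mset_factors_imp_dvd by blast+
    have "x = y" if "x \<in> B f" "y \<in> B f" for x y
    proof (rule ccontr)
      assume "x \<noteq> y"
      have d: "f dvd p 2 + smult (\<kappa> x) (p 3)" "f dvd p 2 + smult (\<kappa> y) (p 3)" using that by (auto simp: B_def)
      have "f dvd smult (\<kappa> (x - y)) (p 3)"
        using dvd_diff[OF d] by (simp add: \<kappa>.hom_minus smult_diff_left)
      then have 3: "f dvd p 3" using cancel \<open>x \<noteq> y\<close> by auto
      then have "f dvd p 2" using d(1) dvd_add_left_iff dvd_smult by blast
      then show False using cop[OF f'(1)] f'(2) 3 by auto
    qed
    then have "B f \<subseteq> {} \<or> (\<exists>x. B f \<subseteq> {x})" by blast
    then show ?thesis using finite_subset by auto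
  qed
  have "{x. \<exists>q. irreducible q \<and> q dvd p 1 \<and> q dvd p 1 + smult (\<kappa> x) (p 2) + smult ((\<kappa> x)\<^sup>2) (p 3)}
      \<subseteq> insert 0 (\<Union>f\<in>set_mset F. B f)"
  proof
    fix x assume "x \<in> {x. \<exists>q. irreducible q \<and> q dvd p 1 \<and> q dvd p 1 + smult (\<kappa> x) (p 2) + smult ((\<kappa> x)\<^sup>2) (p 3)}"
    then obtain q where q: "irreducible q" "q dvd p 1" "q dvd p 1 + smult (\<kappa> x) (p 2) + smult ((\<kappa> x)\<^sup>2) (p 3)" by blast
    obtain f where f: "f \<in># F" "q ddvd f" using irreducible_dvd_imp_factor[OF q(2,1) F] by blast
    then have fq: "f dvd q" by auto
    have f1: "f dvd p 1" using fq q(2) dvd_trans by blast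
    have "f dvd p 1 + (smult (\<kappa> x) (p 2) + smult ((\<kappa> x)\<^sup>2) (p 3))" using fq q(3) dvd_trans by (metis add.assoc)
    then have "f dvd smult (\<kappa> x) (p 2) + smult ((\<kappa> x)\<^sup>2) (p 3)" using f1 dvd_add_right_iff by blast
    then have "f dvd smult (\<kappa> x) (p 2 + smult (\<kappa> x) (p 3))" by (simp add: smult_add_right power2_eq_square)
    then have "x = 0 \<or> x \<in> B f" using cancel unfolding B_def by auto
    then show "x \<in> insert 0 (\<Union>f\<in>set_mset F. B f)" using f(1) by auto
  qed
  then show ?thesis by (rule finite_subset) (use finB in auto)
qed

text \<open>\<kappa> embeds the scalars. It is the identity when the \<open>p i\<close> are
  polynomials along a line, and the embedding of constants into the polynomials in t1, t2 when they
  are the \<open>s i\<close> themselves.\<close>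

lemma gen_resultant_nonzero_coprime:
  fixes p :: "nat \<Rightarrow> 'c::ufd poly" and \<kappa> :: "'k::{field_char_0} \<Rightarrow> 'c"
  assumes \<kappa>: "comm_ring_hom \<kappa>" and deg: "\<And>i. i \<in> {1,2,3} \<Longrightarrow> degree (p i) \<le> n"
    and lc: "\<And>i. i \<in> {1,2,3} \<Longrightarrow> coeff (p i) n = \<kappa> (a i)" "a 1 \<noteq> 0"
    and cop: "\<And>q. irreducible q \<Longrightarrow> \<not> (\<forall>i\<in>{1,2,3}. q dvd p i)"
  shows "resultant (gen 0 p) (gen 3 p) \<noteq> 0"
proof -
  interpret \<kappa>: comm_ring_hom \<kappa> by fact
  have inj: "\<kappa> x \<noteq> 0" if "x \<noteq> 0" for x
  proof
    assume "\<kappa> x = 0"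
    then have "\<kappa> (x * inverse x) = 0" by (simp add: \<kappa>.hom_mult)
    then show False using that by simp
  qed
  have c1: "coeff (p 1) n \<noteq> 0" using lc(1)[of 1] inj[OF lc(2)] by simp
  then have p1: "p 1 \<noteq> 0" by auto
  let ?bad = "{x. \<exists>q. irreducible q \<and> q dvd p 1 \<and> q dvd p 1 + smult (\<kappa> x) (p 2) + smult ((\<kappa> x)\<^sup>2) (p 3)}"
  \<comment> \<open>Up to \<kappa>, the quadratic in x is the leading coefficient of the second
    member; its constant term \<open>a 1\<close> makes it nonzero. An infinite field has an x
    outside both finite sets.\<close>
  have "finite (?bad \<union> {x. poly [:a 1, a 2, a 3:] x = 0})"
    using generic_coprime[OF \<kappa> p1 cop] lc(2) poly_roots_finite[of "[:a 1, a 2, a 3:]"] by auto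
  then obtain x where x: "x \<notin> ?bad" "poly [:a 1, a 2, a 3:] x \<noteq> 0"
    using ex_new_if_finite[OF infinite_UNIV_char_0, of "?bad \<union> {x. poly [:a 1, a 2, a 3:] x = 0}"] by blast
  show ?thesis
  proof (rule gen_resultant_nonzero[where n = n and x = "\<kappa> x"])
    have "coeff (p 1 + smult (\<kappa> x) (p 2) + smult ((\<kappa> x)\<^sup>2) (p 3)) n = \<kappa> (poly [:a 1, a 2, a 3:] x)"
      using lc(1)[of 1] lc(1)[of 2] lc(1)[of 3]
      by (simp add: \<kappa>.hom_add \<kappa>.hom_mult \<kappa>.hom_power power2_eq_square algebra_simps)
    then show "coeff (p 1 + smult (\<kappa> x) (p 2) + smult ((\<kappa> x)\<^sup>2) (p 3)) n \<noteq> 0" using inj[OF x(2)] by simp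
    show "resultant (p 1) (p 1 + smult (\<kappa> x) (p 2) + smult ((\<kappa> x)\<^sup>2) (p 3)) \<noteq> 0"
      by (rule resultant_nonzero_coprime[OF p1]) (use x(1) in blast)
  qed (rule deg c1, assumption?)+
qed

text \<open>In weight terms, the \<open>k\<close>-th coefficient in \<open>t3\<close> of a form of degree \<open>d\<close> has weight \<open>d - k\<close>; row
  \<open>i\<close> and column \<open>j\<close> of the Sylvester matrix then meet in an entry of weight \<open>j - i\<close> (rows of the
  second block being counted from its start).\<close>

definition wt6 :: "int \<Rightarrow> 'c::comm_ring_1 poly poly poly6 \<Rightarrow> bool" where
  "wt6 = coeff_wt (coeff_wt (coeff_wt (coeff_wt (coeff_wt (coeff_wt (poly_wt (poly_wt const_wt)))))))"

lemma grading_wt6: "grading (wt6 :: int \<Rightarrow> 'c::comm_ring_1 poly poly poly6 \<Rightarrow> bool)"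
  unfolding wt6_def by (intro grading.coeff_wt grading2)

lemma wt6_coeffs6: "wt6 n R \<longleftrightarrow> (\<forall>r\<in>coeffs6 R. poly_wt (poly_wt const_wt) n r)"
  unfolding wt6_def coeff_wt_def coeffs6_range by (simp add: case_prod_unfold split_paired_all)

lemma wt6_const6: "poly_wt (poly_wt const_wt) n c \<Longrightarrow> wt6 n (const6 c)"
  unfolding wt6_def coeff_wt_def const6_def
  by (auto simp: coeff_pCons grading.zero[OF grading2] split: nat.split)

lemma wt6_var6: "wt6 0 (var6 k)"
  unfolding wt6_def coeff_wt_def var6_def
  by (auto simp: coeff_pCons grading.zero[OF grading2] grading.one[OF grading2] split: nat.split)

lemma wt6_gen:
  assumes "\<And>i. i \<in> {1,2,3} \<Longrightarrow> hom3 d (p i)" shows "wt6 (int d - int k) (coeff (gen e p) k)"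
  unfolding coeff_gen
proof (rule grading.sum[OF grading_wt6])
  fix i :: nat assume "i \<in> {1,2,3}"
  then have "poly_wt (poly_wt const_wt) (int d - int k) (coeff (p i) k)"
    using assms[of i] unfolding hom3_wt poly_wt_def[of "poly_wt (poly_wt const_wt)"] by blast
  then have "wt6 (0 + (int d - int k)) (var6 (i + e) * const6 (coeff (p i) k))"
    by (intro grading.mult[OF grading_wt6] wt6_var6 wt6_const6)
  then show "wt6 (int d - int k) (var6 (i + e) * const6 (coeff (p i) k))" by simp
qed

lemma resultant_hom2:
  fixes p :: "nat \<Rightarrow> 'c::comm_ring_1 poly poly poly"
  assumes p: "\<And>i. i \<in> {1,2,3} \<Longrightarrow> hom3 d (p i)" and deg: "degree (gen 0 p) = d" "degree (gen 3 p) = d"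
  shows "\<exists>n. \<forall>r\<in>coeffs6 (resultant (gen 0 p) (gen 3 p)). hom2 n r"
proof -
  let ?S = "sylvester_mat (gen 0 p) (gen 3 p)"
  have S: "?S \<in> carrier_mat (d + d) (d + d)" using sylvester_carrier_mat[of "gen 0 p" "gen 3 p"] deg by simp
  note z = grading.zero[OF grading_wt6]
  define r where "r = (\<lambda>i. int (if i < d then i else i - d))"
  have "wt6 ((\<Sum>j<d+d. int j) - (\<Sum>i<d+d. r i)) (det ?S)"
  proof (rule grading.det[OF grading_wt6 S])
    fix i j assume ij: "i < d + d" "j < d + d"
    show "wt6 (int j - r i) (?S $$ (i, j))"
    proof (cases "i < d")
      case True
      have eq: "int d - int (d + i - j) = int j - r i" if "i \<le> j" "j - i \<le> d" using that True by (simp add: r_def)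
      have "wt6 (int j - r i) (coeff (gen 0 p) (d + i - j))" if "i \<le> j" "j - i \<le> d"
        using wt6_gen[where p = p and d = d and k = "d + i - j" and e = 0, OF p] unfolding eq[OF that] .
      then show ?thesis using True ij z by (subst sylvester_index_mat) (auto simp: deg)
    next
      case False
      have eq: "int d - int (i - j) = int j - r i" if "i - d \<le> j" "j \<le> i" using that False by (simp add: r_def)
      have "wt6 (int j - r i) (coeff (gen 3 p) (i - j))" if "i - d \<le> j" "j \<le> i"
        using wt6_gen[where p = p and d = d and k = "i - j" and e = 3, OF p] unfolding eq[OF that] .
      then show ?thesis using False ij z by (subst sylvester_index_mat) (auto simp: deg)
    qed
  qed
  then obtain n where n: "\<forall>r\<in>coeffs6 (resultant (gen 0 p) (gen 3 p)). poly_wt (poly_wt const_wt) n r"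
    unfolding resultant_def wt6_coeffs6 by blast
  have "hom2 (nat n) r" if "poly_wt (poly_wt const_wt) n r" for r :: "'c poly poly"
    unfolding hom2_def
  proof (intro allI impI)
    fix i j assume "coeff (coeff r j) i \<noteq> 0"
    then have "n - int j - int i = 0" using that unfolding poly_wt_def const_wt_def by metis
    then show "i + j = nat n" by linarith
  qed
  then show ?thesis using n by blast
qed

subsection \<open>Lines through the centre of projection\<close>

definition generic_comb :: "nat \<Rightarrow> (nat \<Rightarrow> 'a::field poly) \<Rightarrow> 'a FF poly" where
  "generic_comb e p = (\<Sum>i\<in>{1,2,3}. smult (indetF (i + e)) (map_poly embK (p i)))"

lemma map_iota6_gen: "map_poly iota6 (gen e p) = generic_comb e p"
  unfolding map_gen[OF ring_hom_iota6] generic_comb_def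
  by (rule sum.cong[OF refl]) (simp add: indetF_iota6 embK_iota6[abs_def])

text \<open>Sending the indeterminate with index \<open>1 + e\<close> to 1 and the others to 0 gives
  \<open>a 1\<close>, so the combination is already nonzero as a polynomial.\<close>

lemma indet_comb_nonzero:
  fixes a :: "nat \<Rightarrow> 'a::field"
  assumes "a 1 \<noteq> 0" and e: "e = 0 \<or> e = 3"
  shows "(\<Sum>i\<in>{1,2,3}. indetF (i + e) * embK (a i)) \<noteq> 0"
proof
  interpret i: comm_ring_hom "iota6 :: 'a poly6 \<Rightarrow> 'a FF" by (rule ring_hom_iota6)
  have id: "comm_ring_hom (\<lambda>c :: 'a. c)" by unfold_locales auto
  define Z :: "nat \<Rightarrow> 'a" where "Z = (\<lambda>k. if k = 1 + e then 1 else 0)"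
  interpret s: comm_ring_hom "sub6 (\<lambda>c. c) Z" by (rule ring_hom_sub6[OF id])
  assume "(\<Sum>i\<in>{1,2,3}. indetF (i + e) * embK (a i)) = 0"
  then have "iota6 (\<Sum>i\<in>{1,2,3}. var6 (i + e) * const6 (a i)) = 0"
    unfolding i.hom_sum i.hom_mult indetF_iota6 embK_iota6 .
  from iota6_eq_0[OF this] have "sub6 (\<lambda>c. c) Z (\<Sum>i\<in>{1,2,3}. var6 (i + e) * const6 (a i)) = 0"
    by (simp only: s.hom_zero)
  moreover have "sub6 (\<lambda>c. c) Z (\<Sum>i\<in>{1,2,3}. var6 (i + e) * const6 (a i)) = (\<Sum>i\<in>{1,2,3}. Z (i + e) * a i)"
    unfolding s.hom_sum s.hom_mult using e
    by (intro sum.cong refl) (auto simp: sub6_const6[OF id] sub6_var6[OF id])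
  ultimately show False using assms(1) by (simp add: Z_def)
qed

lemma coeff_generic_comb: "coeff (generic_comb e p) k = (\<Sum>i\<in>{1,2,3}. indetF (i + e) * embK (coeff (p i) k))"
  unfolding generic_comb_def coeff_sum
  by (rule sum.cong[OF refl]) (simp add: coeff_map_poly ring_hom_0[OF ring_hom_embK])

lemma generic_comb_mult: "generic_comb e (\<lambda>i. D * p i) = map_poly embK D * generic_comb e p"
proof -
  interpret m: comm_ring_hom "map_poly embK" by (rule ring_hom_map_poly[OF ring_hom_embK])
  show ?thesis unfolding generic_comb_def m.hom_mult sum_distrib_left by simp
qed

text \<open>The resultant of the generic members is the image of a nonzero polynomial under the
  injective \<open>iota6\<close>, and it lies in the ideal they generate. Hence a line carries no
  intersection points beyond the common zeros over the ground field.\<close>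

lemma generic_comb_coprime:
  fixes p :: "nat \<Rightarrow> 'a::{alg_closed_field, field_char_0} poly"
  assumes deg: "\<And>i. i \<in> {1,2,3} \<Longrightarrow> degree (p i) \<le> n" and lc: "coeff (p 1) n \<noteq> 0"
    and cop: "\<And>c. \<not> (\<forall>i\<in>{1,2,3}. poly (p i) c = 0)"
  shows "\<exists>P Q. P * generic_comb 0 p + Q * generic_comb 3 p = 1"
proof -
  have id: "comm_ring_hom (\<lambda>c :: 'a. c)" by unfold_locales auto
  have cop': "\<not> (\<forall>i\<in>{1,2,3}. q dvd p i)" if q: "irreducible q" for q
  proof
    assume dvd: "\<forall>i\<in>{1,2,3}. q dvd p i"
    have "degree q > 0"
    proof (rule ccontr)
      assume "\<not> degree q > 0"
      then obtain b where b: "q = [:b:]" using degree_eq_zeroE by blast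
      have "q \<noteq> 0" "\<not> q dvd 1" using q irreducible_not_unit by auto
      then show False unfolding b by (simp add: const_poly_dvd_1)
    qed
    then obtain c where "poly q c = 0" using alg_closed_imp_poly_has_root by blast
    then have "\<forall>i\<in>{1,2,3}. poly (p i) c = 0" using dvd poly_eq_0_iff_dvd dvd_trans by metis
    then show False using cop by blast
  qed
  have res: "resultant (gen 0 p) (gen 3 p) \<noteq> 0"
    by (rule gen_resultant_nonzero_coprime[OF id deg refl lc cop'])
  have co: "iota6 (coeff (gen e p) n) = coeff (generic_comb e p) n" for e
    unfolding map_iota6_gen[symmetric] by (simp add: coeff_map_poly ring_hom_0[OF ring_hom_iota6])
  have nz: "coeff (generic_comb e p) n \<noteq> 0" if "e = 0 \<or> e = 3" for e
    unfolding coeff_generic_comb using indet_comb_nonzero[where a = "\<lambda>i. coeff (p i) n", OF lc that] .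
  have spec: "resultant (generic_comb 0 p) (generic_comb 3 p) = iota6 (resultant (gen 0 p) (gen 3 p))"
    and d0: "degree (generic_comb 0 p) = n"
    using resultant_specialize[where H = iota6 and P = "gen 0 p" and Q = "gen 3 p" and n = n and m = n,
        OF ring_hom_iota6 degree_gen[OF deg] _ degree_gen[OF deg]]
    unfolding co map_iota6_gen using nz by auto
  have rnz: "resultant (generic_comb 0 p) (generic_comb 3 p) \<noteq> 0"
    unfolding spec using res iota6_eq_0 by blast
  show ?thesis
  proof (cases "degree (generic_comb 0 p) + degree (generic_comb 3 p) = 0")
    case True
    then obtain b where b: "generic_comb 0 p = [:b:]" using degree_eq_zeroE by (metis add_is_0)
    then have "b \<noteq> 0" using nz[of 0] d0 True by auto
    then have "[:inverse b:] * generic_comb 0 p + 0 * generic_comb 3 p = 1" unfolding b by (simp add: pCons_one)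
    then show ?thesis by blast
  next
    case False
    then have "degree (generic_comb 0 p) + degree (generic_comb 3 p) > 0" by simp
    from resultant_in_ideal[OF this] obtain P Q
      where PQ: "[:resultant (generic_comb 0 p) (generic_comb 3 p):] = P * generic_comb 0 p + Q * generic_comb 3 p"
      by blast
    let ?r = "resultant (generic_comb 0 p) (generic_comb 3 p)"
    have "(smult (inverse ?r) P) * generic_comb 0 p + (smult (inverse ?r) Q) * generic_comb 3 p = smult (inverse ?r) [:?r:]"
      unfolding PQ by (simp add: smult_add_right)
    also have "\<dots> = 1" using rnz by (simp add: pCons_one)
    finally show ?thesis by blast
  qed
qed

text \<open>Take a common divisor \<open>D\<close> of largest degree; a common zero of the cofactors
  would give a larger one.\<close>

lemma common_root_factor:
  fixes p :: "nat \<Rightarrow> 'a::alg_closed_field poly"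
  assumes "p 1 \<noteq> 0"
  obtains e q where "\<And>i. i \<in> {1,2,3} \<Longrightarrow> p i = (\<Prod>c\<in>{c. \<forall>i\<in>{1,2,3}. poly (p i) c = 0}. [:-c, 1:] ^ e c) * q i"
    "\<And>c. \<not> (\<forall>i\<in>{1,2,3}. poly (q i) c = 0)"
proof -
  let ?P = "\<lambda>D. \<forall>i\<in>{1,2,3}. D dvd p i"
  have "\<exists>D. ?P D \<and> (\<forall>D'. ?P D' \<longrightarrow> degree D' \<le> degree D)"
  proof (rule ex_has_greatest_nat[of ?P 1 degree "Suc (degree (p 1))"])
    show "\<forall>D. ?P D \<longrightarrow> degree D < Suc (degree (p 1))"
      using assms dvd_imp_degree_le[of _ "p 1"] by (auto simp: less_Suc_eq_le)
  qed simp
  then obtain D where D: "?P D" "\<And>D'. ?P D' \<Longrightarrow> degree D' \<le> degree D" by blast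
  have D0: "D \<noteq> 0" using D(1) assms by auto
  have "\<forall>i\<in>{1,2,3}. \<exists>r. p i = D * r" using D(1) unfolding dvd_def by blast
  from bchoice[OF this] obtain r where r: "\<And>i. i \<in> {1,2,3} \<Longrightarrow> p i = D * r i" by blast
  have nor: "\<not> (\<forall>i\<in>{1,2,3}. poly (r i) c = 0)" for c
  proof
    assume c: "\<forall>i\<in>{1,2,3}. poly (r i) c = 0"
    have "D * [:-c, 1:] dvd p i" if "i \<in> {1,2,3}" for i
    proof -
      have "[:-c, 1:] dvd r i" using c that unfolding poly_eq_0_iff_dvd by blast
      then show ?thesis unfolding r[OF that] by (rule mult_dvd_mono[OF dvd_refl])
    qed
    then have "degree (D * [:-c, 1:]) \<le> degree D" using D(2) by blast
    moreover have "degree (D * [:-c, 1:]) = degree D + degree [:-c, 1:]" using D0 by (intro degree_mult_eq) auto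
    ultimately show False by simp
  qed
  have roots: "{c. \<forall>i\<in>{1,2,3}. poly (p i) c = 0} = {c. poly D c = 0}"
  proof (rule Set.set_eqI, rule iffI)
    fix c assume "c \<in> {c. \<forall>i\<in>{1,2,3}. poly (p i) c = 0}"
    then have "\<forall>i\<in>{1,2,3}. poly D c * poly (r i) c = 0" using r by auto
    then show "c \<in> {c. poly D c = 0}" using nor[of c] by auto
  qed (use r in auto)
  have "D = smult (lead_coeff D) (\<Prod>x\<in>#proots D. [:-x, 1:])" by (rule alg_closed_split[OF D0])
  also have "(\<Prod>x\<in>#proots D. [:-x, 1:]) = (\<Prod>c\<in>{c. poly D c = 0}. [:-c, 1:] ^ order c D)"
    unfolding image_prod_mset_multiplicity using D0 by simp
  finally have D': "D = smult (lead_coeff D) (\<Prod>c\<in>{c. poly D c = 0}. [:-c, 1:] ^ order c D)" .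
  show thesis
  proof (rule that)
    \<comment> \<open>The leading coefficient of \<open>D\<close> is moved into the cofactors, so
      that the common factor is a pure product of linear ones.\<close>
    show "p i = (\<Prod>c\<in>{c. \<forall>i\<in>{1,2,3}. poly (p i) c = 0}. [:-c, 1:] ^ order c D) * smult (lead_coeff D) (r i)"
      if "i \<in> {1,2,3}" for i
    proof -
      have "p i = smult (lead_coeff D) (\<Prod>c\<in>{c. poly D c = 0}. [:-c, 1:] ^ order c D) * r i"
        unfolding r[OF that] by (rule arg_cong[where f = "\<lambda>x. x * r i", OF D'])
      then show ?thesis unfolding roots by simp
    qed
    show "\<not> (\<forall>i\<in>{1,2,3}. poly (smult (lead_coeff D) (r i)) c = 0)" for c using nor[of c] D0 by simp
  qed
qed

text \<open>A generic member with t1 or t2 set to 1 by \<eta>: the inner variable moves between the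
  lines through (0:0:1), the outer one is t3 along a line. \<open>e\<close> selects the x or the y
  indeterminates.\<close>

definition fibre :: "('a::field poly poly \<Rightarrow> 'a poly) \<Rightarrow> nat \<Rightarrow> (nat \<Rightarrow> 'a poly poly poly) \<Rightarrow> 'a FF poly poly" where
  "fibre \<eta> e s = (\<Sum>i\<in>{1,2,3}. smult [:indetF (i + e):] (map_poly (\<lambda>c. map_poly embK (\<eta> c)) (s i)))"

definition restrict_line :: "('a::field poly poly \<Rightarrow> 'a poly) \<Rightarrow> 'a \<Rightarrow> 'a poly poly poly \<Rightarrow> 'a poly" where
  "restrict_line \<eta> a f = map_poly (\<lambda>c. poly (\<eta> c) a) f"

definition line_points ::
    "('a::field poly poly \<Rightarrow> 'a poly) \<Rightarrow> (nat \<Rightarrow> 'a poly poly poly) \<Rightarrow> 'a \<Rightarrow> 'a set" where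
  "line_points \<eta> s a = {c. \<forall>i\<in>{1,2,3}. poly (restrict_line \<eta> a (s i)) c = 0}"

locale central_system =
  fixes s :: "nat \<Rightarrow> 'a::{alg_closed_field, field_char_0} poly poly poly" and d :: nat and w :: "nat \<Rightarrow> 'a"
    and \<eta> :: "'a poly poly \<Rightarrow> 'a poly"
  assumes deg: "i \<in> {1,2,3} \<Longrightarrow> degree (s i) \<le> d"
    and top: "i \<in> {1,2,3} \<Longrightarrow> coeff (s i) d = [:[:w i:]:]"
    and w: "i \<in> {1,2,3} \<Longrightarrow> w i \<noteq> 0"
    and eta: "comm_ring_hom \<eta>" and eta_const: "\<eta> [:[:c:]:] = [:c:]"
begin

lemma eta_0: "\<eta> 0 = 0" by (rule ring_hom_0[OF eta])

lemma coeff_fibre: "coeff (fibre \<eta> e s) k = (\<Sum>i\<in>{1,2,3}. smult (indetF (i + e)) (map_poly embK (\<eta> (coeff (s i) k))))"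
  unfolding fibre_def coeff_sum by (rule sum.cong[OF refl]) (simp add: coeff_map_poly eta_0)

lemma fibre_lead:
  assumes e: "e = 0 \<or> e = 3"
  shows "degree (fibre \<eta> e s) = d" "\<exists>c. lead_coeff (fibre \<eta> e s) * c = 1"
proof -
  let ?c = "\<Sum>i\<in>{1,2,3}. indetF (i + e) * embK (w i)"
  have c: "?c \<noteq> 0" using indet_comb_nonzero[where a = w, OF w e] by simp
  have co: "coeff (fibre \<eta> e s) d = [:?c:]"
  proof -
    have "coeff (fibre \<eta> e s) d = (\<Sum>i\<in>{1,2,3}. [:indetF (i + e) * embK (w i):])"
      unfolding coeff_fibre by (intro sum.cong refl) (simp add: top eta_const map_poly_const ring_hom_0[OF ring_hom_embK])
    also have "\<dots> = [:?c:]" by simp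
    finally show ?thesis .
  qed
  have "coeff (fibre \<eta> e s) k = 0" if "k > d" for k
    unfolding coeff_fibre
  proof (intro sum.neutral ballI)
    fix i :: nat assume "i \<in> {1,2,3}"
    then have "coeff (s i) k = 0" using deg[of i] that by (intro coeff_eq_0) auto
    then show "smult (indetF (i + e)) (map_poly embK (\<eta> (coeff (s i) k))) = 0" by (simp add: eta_0)
  qed
  then have "degree (fibre \<eta> e s) \<le> d" by (intro degree_le) auto
  moreover have "d \<le> degree (fibre \<eta> e s)" using co c by (intro le_degree) auto
  ultimately show *: "degree (fibre \<eta> e s) = d" by simp
  have "lead_coeff (fibre \<eta> e s) * [:inverse ?c:] = 1" unfolding * co using c by (simp add: pCons_one)
  then show "\<exists>c. lead_coeff (fibre \<eta> e s) * c = 1" by blast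
qed

text \<open>The difference from the restriction to the line vanishes at the inner coordinate
  \<open>embK a\<close>, coefficient by coefficient.\<close>

lemma fibre_expand:
  obtains y where "fibre \<eta> e s =
     map_poly (\<lambda>x. [:x:]) (generic_comb e (\<lambda>i. restrict_line \<eta> a (s i))) + lin_inner (embK a) * y"
proof -
  let ?g = "generic_comb e (\<lambda>i. restrict_line \<eta> a (s i))"
  have "lin_inner (embK a) dvd fibre \<eta> e s - map_poly (\<lambda>x. [:x:]) ?g"
    unfolding lin_inner_def const_poly_dvd_iff
  proof
    fix k
    have "poly (coeff (fibre \<eta> e s) k) (embK a) = coeff ?g k"
      unfolding coeff_fibre coeff_generic_comb poly_sum
      by (rule sum.cong[OF refl])
        (simp add: restrict_line_def coeff_map_poly eta_0 comm_ring_hom_poly[OF ring_hom_embK])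
    then have "poly (coeff (fibre \<eta> e s - map_poly (\<lambda>x. [:x:]) ?g) k) (embK a) = 0"
      by (simp add: coeff_map_poly)
    then show "[:- embK a, 1:] dvd coeff (fibre \<eta> e s - map_poly (\<lambda>x. [:x:]) ?g) k"
      unfolding poly_eq_0_iff_dvd .
  qed
  then obtain y where "fibre \<eta> e s - map_poly (\<lambda>x. [:x:]) ?g = lin_inner (embK a) * y" by blast
  then show thesis using that by (metis diff_eq_eq add.commute)
qed

lemma top_restrict:
  assumes "i \<in> {1,2,3}"
  shows "coeff (restrict_line \<eta> a (s i)) d = w i" "degree (restrict_line \<eta> a (s i)) \<le> d"
proof -
  show "coeff (restrict_line \<eta> a (s i)) d = w i"
    using top[OF assms] by (simp add: restrict_line_def coeff_map_poly eta_0 eta_const)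
  show "degree (restrict_line \<eta> a (s i)) \<le> d"
    using deg[OF assms] degree_map_poly_le[of "\<lambda>c. poly (\<eta> c) a" "s i"] unfolding restrict_line_def by simp
qed

lemma finite_line_points: "finite (line_points \<eta> s a)"
proof -
  have "restrict_line \<eta> a (s 1) \<noteq> 0" using top_restrict(1)[of 1 a] w[of 1] by auto
  then have "finite {c. poly (restrict_line \<eta> a (s 1)) c = 0}" by (rule poly_roots_finite)
  then show ?thesis by (rule finite_subset[rotated]) (auto simp: line_points_def)
qed

text \<open>Divide the restrictions to the line by their common factor \<open>?D\<close>. The
  quotients have no common zero, so their generic members generate 1; multiplying by
  \<open>?D\<close> puts the product of linear factors into the ideal of the two fibres and
  \<open>lin_inner\<close>, as the decomposition into points requires.\<close>

lemma sum_aff_imult_line: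
  assumes res: "resultant (fibre \<eta> 0 s) (fibre \<eta> 3 s) \<noteq> 0"
  shows "(\<Sum>c\<in>line_points \<eta> s a. aff_imult (fibre \<eta> 0 s) (fibre \<eta> 3 s) (embK a) (embK c)) =
    enat (order (embK a) (resultant (fibre \<eta> 0 s) (fibre \<eta> 3 s)))"
proof -
  let ?p = "\<lambda>i. restrict_line \<eta> a (s i)" and ?f = "fibre \<eta> 0 s" and ?g = "fibre \<eta> 3 s"
  let ?C = "map_poly (\<lambda>x. [:x:]) :: 'a FF poly \<Rightarrow> 'a FF poly poly"
  interpret C: comm_ring_hom ?C by (rule ring_hom_map_poly[OF ring_hom_const])
  interpret E: comm_ring_hom "map_poly embK :: 'a poly \<Rightarrow> 'a FF poly" by (rule ring_hom_map_poly[OF ring_hom_embK])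
  have p1: "?p 1 \<noteq> 0" using top_restrict(1)[of 1 a] w[of 1] by auto
  obtain m q where q: "\<And>i. i \<in> {1,2,3} \<Longrightarrow> ?p i = (\<Prod>c\<in>line_points \<eta> s a. [:-c, 1:] ^ m c) * q i"
    and cop: "\<And>c. \<not> (\<forall>i\<in>{1,2,3}. poly (q i) c = 0)"
    unfolding line_points_def using common_root_factor[of ?p, OF p1] by blast
  let ?D = "\<Prod>c\<in>line_points \<eta> s a. [:-c, 1:] ^ m c"
  have pnz: "?p i \<noteq> 0" "degree (?p i) = d" if "i \<in> {1,2,3}" for i
    using top_restrict[OF that, of a] w[OF that] le_degree[of "?p i" d] by auto
  have D0: "?D \<noteq> 0" using q[of 1] p1 by auto
  have degq: "degree (q i) = d - degree ?D" if "i \<in> {1,2,3}" for i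
    using pnz[OF that] q[OF that] D0 degree_mult_eq[of ?D "q i"] by auto
  obtain P Q where PQ: "P * generic_comb 0 q + Q * generic_comb 3 q = 1"
  proof -
    have "coeff (q 1) (d - degree ?D) \<noteq> 0" using degq[of 1] q[of 1] p1 by (metis insertI1 leading_coeff_0_iff mult_zero_right)
    then show thesis using generic_comb_coprime[of q "d - degree ?D"] degq cop that by auto
  qed
  have comb: "generic_comb e ?p = map_poly embK ?D * generic_comb e q" for e
  proof -
    have "generic_comb e ?p = generic_comb e (\<lambda>i. ?D * q i)"
      unfolding generic_comb_def by (rule sum.cong[OF refl]) (simp only: q)
    then show ?thesis unfolding generic_comb_mult .
  qed
  obtain y0 where y0: "?f = ?C (generic_comb 0 ?p) + lin_inner (embK a) * y0" by (rule fibre_expand)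
  obtain y3 where y3: "?g = ?C (generic_comb 3 ?p) + lin_inner (embK a) * y3" by (rule fibre_expand)
  have "map_poly embK ?D = map_poly embK ?D * (P * generic_comb 0 q + Q * generic_comb 3 q)" unfolding PQ by simp
  also have "\<dots> = P * generic_comb 0 ?p + Q * generic_comb 3 ?p" unfolding comb by (simp add: algebra_simps)
  finally have "?C (map_poly embK ?D) = ?C P * ?C (generic_comb 0 ?p) + ?C Q * ?C (generic_comb 3 ?p)"
    by (simp only: C.hom_add C.hom_mult)
  also have "\<dots> = ?C P * ?f + ?C Q * ?g + lin_inner (embK a) * (- (?C P * y0 + ?C Q * y3))"
    unfolding y0 y3 by (simp add: algebra_simps)
  also have "?C (map_poly embK ?D) = (\<Prod>c\<in>line_points \<eta> s a. lin_outer (embK c) ^ m c)"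
  proof -
    have "?C (map_poly embK [:-c, 1:]) = lin_outer (embK c)" for c :: 'a
    proof -
      interpret e: comm_ring_hom "embK :: 'a \<Rightarrow> 'a FF" by (rule ring_hom_embK)
      have "map_poly embK (pCons (- c) [:1:]) = pCons (embK (- c)) (map_poly embK [:1:])" by (rule map_poly_pCons) simp
      then have 1: "map_poly embK [:-c, 1:] = [:- embK c, 1:]"
        by (simp only: map_poly_const[of embK, OF e.hom_zero] e.hom_one e.hom_uminus)
      have "?C (pCons (- embK c) [:1:]) = pCons [:- embK c:] (?C [:1:])" by (rule map_poly_pCons) simp
      then show ?thesis unfolding 1 lin_outer_def by (simp add: map_poly_const pCons_one)
    qed
    then show ?thesis unfolding E.hom_prod C.hom_prod E.hom_power C.hom_power by simp
  qed
  \<comment> \<open>The exponents are indexed by ground field points; \<open>inv_into\<close>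
    carries them over to the images under \<open>embK\<close>.\<close>
  also have "(\<Prod>c\<in>line_points \<eta> s a. lin_outer (embK c) ^ m c) = (\<Prod>c\<in>embK ` line_points \<eta> s a. lin_outer c ^ m (inv_into UNIV embK c))"
    by (subst prod.reindex) (auto simp: inj_on_def embK_inj inv_into_f_f)
  finally have D: "(\<Prod>c\<in>embK ` line_points \<eta> s a. lin_outer c ^ m (inv_into UNIV embK c)) =
    ?C P * ?f + ?C Q * ?g + lin_inner (embK a) * (- (?C P * y0 + ?C Q * y3))" .
  obtain c0 where c0: "lead_coeff ?f * c0 = 1" using fibre_lead(2)[of 0] by blast
  have "(\<Sum>c\<in>embK ` line_points \<eta> s a. aff_imult ?f ?g (embK a) c) = enat (order (embK a) (resultant ?f ?g))"
    by (rule sum_aff_imult_resultant[OF c0 res _ D]) (simp add: finite_line_points)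
  then show ?thesis by (subst (asm) sum.reindex) (auto simp: inj_on_def embK_inj)
qed

lemma aff_imult_line_pos:
  assumes "c \<in> line_points \<eta> s a" shows "aff_imult (fibre \<eta> 0 s) (fibre \<eta> 3 s) (embK a) (embK c) \<noteq> 0"
proof (rule aff_imult_pos)
  have "val2 (fibre \<eta> e s) (embK a) (embK c) = 0" for e
  proof -
    obtain y where y: "fibre \<eta> e s = map_poly (\<lambda>x. [:x:]) (generic_comb e (\<lambda>i. restrict_line \<eta> a (s i))) + lin_inner (embK a) * y"
      by (rule fibre_expand)
    have "poly (map_poly (\<lambda>x. [:x:]) q) [:b:] = [:poly q b:]" for q :: "'a FF poly" and b
      using comm_ring_hom_poly[OF ring_hom_const, of q b] by simp
    then have "val2 (fibre \<eta> e s) (embK a) (embK c) = poly (generic_comb e (\<lambda>i. restrict_line \<eta> a (s i))) (embK c)"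
      unfolding y by (simp only: val2_simps) (simp add: val2_def)
    also have "\<dots> = (\<Sum>i\<in>{1,2,3}. indetF (i + e) * embK (poly (restrict_line \<eta> a (s i)) c))"
      unfolding generic_comb_def poly_sum comm_ring_hom_poly[OF ring_hom_embK] by simp
    also have "\<dots> = 0" using assms unfolding line_points_def
      by (intro sum.neutral) (auto simp: ring_hom_0[OF ring_hom_embK])
    finally show ?thesis .
  qed
  then show "val2 (fibre \<eta> 0 s) (embK a) (embK c) = 0" "val2 (fibre \<eta> 3 s) (embK a) (embK c) = 0" by auto
qed

end

subsection \<open>Base points and the content of the resultant\<close>

text \<open>The values \<open>Y\<close> make the matrix \<open>l\<close> cancel after the two sums
  are interchanged; what remains is the fibre of the original system.\<close>

lemma map_fibre:
  fixes \<eta> :: "'a::field poly poly \<Rightarrow> 'a poly"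
  assumes eta: "comm_ring_hom \<eta>" and eta_const: "\<And>c. \<eta> [:[:c:]:] = [:c:]"
    and Y: "\<And>j. j \<in> {1,2,3} \<Longrightarrow> (\<Sum>i\<in>{1,2,3}. Y (i + e) * embK (l i j)) = indetF (j + e)"
    and e: "e = 0 \<or> e = 3"
  shows "map_poly (sub6 (\<lambda>c. map_poly embK (\<eta> c)) (\<lambda>k. [:Y k:])) (gen e (Lform l s)) = fibre \<eta> e s"
proof -
  let ?h = "\<lambda>c. map_poly embK (\<eta> c)"
  have h: "comm_ring_hom ?h" by (rule ring_hom_comp[OF ring_hom_map_poly[OF ring_hom_embK] eta])
  interpret m: comm_ring_hom "map_poly ?h" by (rule ring_hom_map_poly[OF h])
  interpret h: comm_ring_hom ?h by (rule h)
  have sm: "map_poly ?h (smult [:[:c:]:] q) = smult [:embK c:] (map_poly ?h q)" for c q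
    by (rule poly_eqI) (simp add: coeff_map_poly h.hom_mult eta_const map_poly_const ring_hom_0[OF ring_hom_embK] del: mult_pCons_left)
  have L: "map_poly ?h (Lform l s i) = (\<Sum>j\<in>{1,2,3}. smult [:embK (l i j):] (map_poly ?h (s j)))" for i
    unfolding Lform_def m.hom_sum sm ..
  have v: "sub6 ?h (\<lambda>k. [:Y k:]) (var6 (i + e)) = [:Y (i + e):]" if "i \<in> {1,2,3}" for i
    by (rule sub6_var6[OF h]) (use that e in auto)
  have "map_poly (sub6 ?h (\<lambda>k. [:Y k:])) (gen e (Lform l s)) =
      (\<Sum>i\<in>{1,2,3}. [:[:Y (i + e):]:] * (\<Sum>j\<in>{1,2,3}. smult [:embK (l i j):] (map_poly ?h (s j))))"
    unfolding map_gen[OF ring_hom_sub6[OF h]] sub6_const6[OF h] L by (rule sum.cong[OF refl]) (simp only: v)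
  also have "\<dots> = (\<Sum>i\<in>{1,2,3}. \<Sum>j\<in>{1,2,3}. smult [:Y (i + e) * embK (l i j):] (map_poly ?h (s j)))"
    unfolding sum_distrib_left by (intro sum.cong refl) simp
  also have "\<dots> = (\<Sum>j\<in>{1,2,3}. \<Sum>i\<in>{1,2,3}. smult [:Y (i + e) * embK (l i j):] (map_poly ?h (s j)))"
    by (rule sum.swap)
  also have "\<dots> = (\<Sum>j\<in>{1,2,3}. smult [:\<Sum>i\<in>{1,2,3}. Y (i + e) * embK (l i j):] (map_poly ?h (s j)))"
  proof (rule sum.cong[OF refl])
    fix j
    have "(\<Sum>i\<in>{1,2,3}. smult [:y i:] q) = smult [:\<Sum>i\<in>{1,2,3}. y i:] q" for y :: "nat \<Rightarrow> 'a FF" and q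
      by (simp flip: smult_add_left)
    then show "(\<Sum>i\<in>{1,2,3}. smult [:Y (i + e) * embK (l i j):] (map_poly ?h (s j))) =
      smult [:\<Sum>i\<in>{1,2,3}. Y (i + e) * embK (l i j):] (map_poly ?h (s j))" .
  qed
  also have "\<dots> = fibre \<eta> e s"
    unfolding fibre_def by (rule sum.cong[OF refl]) (simp only: Y)
  finally show ?thesis .
qed

lemma spec_const: "spec2 [:[:c:]:] = [:c:]" "spec1 [:[:c:]:] = [:c:]"
  by (simp_all add: spec2_def spec1_def map_poly_const)

lemma spec_map_embK: "spec2 (map_poly (map_poly embK) c) = map_poly embK (spec2 c)"
  "spec1 (map_poly (map_poly embK) c) = map_poly embK (spec1 c)"
proof -
  have m: "comm_ring_hom (map_poly embK)" by (rule ring_hom_map_poly[OF ring_hom_embK])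
  show "spec2 (map_poly (map_poly embK) c) = map_poly embK (spec2 c)"
    unfolding spec2_def comm_ring_hom_poly[OF m] ring_hom_1[OF m] ..
  show "spec1 (map_poly (map_poly embK) c) = map_poly embK (spec1 c)"
    unfolding spec1_def
    by (rule poly_eqI) (simp add: coeff_map_poly ring_hom_0[OF ring_hom_embK] ring_hom_0[OF m]
        comm_ring_hom_poly[OF ring_hom_embK] ring_hom_1[OF ring_hom_embK])
qed

definition VF :: "nat \<Rightarrow> (nat \<Rightarrow> 'a::field poly poly poly) \<Rightarrow> 'a FF poly poly poly" where
  "VF e s = (\<Sum>i\<in>{1,2,3}. smult [:[:indetF (i + e):]:] (map_poly (map_poly (map_poly embK)) (s i)))"

lemma V1F_VF: "V1F s = VF 0 s" and V2F_VF: "V2F s = VF 3 s"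
  by (simp_all add: V1F_def V2F_def VF_def)

lemma hom3_VF:
  assumes "\<And>i. i \<in> {1,2,3} \<Longrightarrow> hom3 d (s i)" shows "hom3 d (VF e s)"
  unfolding VF_def
proof (intro hom3_sum hom3_smult)
  fix i :: nat assume "i \<in> {1,2,3}"
  then show "hom3 d (map_poly (map_poly (map_poly embK)) (s i))"
    using assms[of i] unfolding hom3_def by (simp add: coeff_map_poly embK_eq_0)
qed

lemma dehom_VF: "dehom2 (VF e s) = fibre spec2 e s" "dehom1 (VF e s) = fibre spec1 e s"
proof -
  interpret d2: chart dehom2 "(0, 1, 0)" 0 "0 :: 'a FF" by (rule chart2)
  interpret d1: chart dehom1 "(1, 0, 0)" 0 "0 :: 'a FF" by (rule chart1)
  have m: "comm_ring_hom (map_poly (embK :: 'a \<Rightarrow> 'a FF))" by (rule ring_hom_map_poly[OF ring_hom_embK])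
  have mm: "comm_ring_hom (map_poly (map_poly (embK :: 'a \<Rightarrow> 'a FF)))" by (rule ring_hom_map_poly[OF m])
  have "dehom2 (map_poly (map_poly (map_poly embK)) q) = map_poly (\<lambda>c. map_poly embK (spec2 c)) q" for q :: "'a poly poly poly"
    unfolding dehom2_def spec2_def[symmetric]
    by (rule poly_eqI) (simp add: coeff_map_poly ring_hom_0[OF mm] ring_hom_0[OF m] ring_hom_0[OF ring_hom_spec2] spec_map_embK)
  then show "dehom2 (VF e s) = fibre spec2 e s" unfolding VF_def fibre_def d2.sum d2.scale by simp
  have "dehom1 (map_poly (map_poly (map_poly embK)) q) = map_poly (\<lambda>c. map_poly embK (spec1 c)) q" for q :: "'a poly poly poly"
    unfolding dehom1_def spec1_def[abs_def, symmetric]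
    by (rule poly_eqI) (simp add: coeff_map_poly ring_hom_0[OF mm] ring_hom_0[OF m] ring_hom_0[OF ring_hom_spec1] spec_map_embK)
  then show "dehom1 (VF e s) = fibre spec1 e s" unfolding VF_def fibre_def d1.sum d1.scale by simp
qed

lemma ev3_line:
  fixes f :: "'a::field poly poly poly"
  shows "poly (restrict_line spec2 a f) c = ev3 f (a, 1, c)" "poly (restrict_line spec1 0 f) c = ev3 f (1, 0, c)"
proof -
  have ev: "comm_ring_hom (\<lambda>p :: 'a poly. poly p b)" for b by unfold_locales auto
  have r: "poly (restrict_line \<eta> b f) c = val2 (map_poly \<eta> f) b c" if "comm_ring_hom \<eta>" for \<eta> :: "'a poly poly \<Rightarrow> 'a poly" and b
  proof -
    have "restrict_line \<eta> b f = map_poly (\<lambda>p. poly p b) (map_poly \<eta> f)"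
      unfolding restrict_line_def by (rule poly_eqI) (simp add: coeff_map_poly ring_hom_0[OF that])
    then show ?thesis unfolding val2_def using comm_ring_hom_poly[OF ev[of b], of "map_poly \<eta> f" "[:c:]"] by simp
  qed
  show "poly (restrict_line spec2 a f) c = ev3 f (a, 1, c)"
    using chart.eval[OF chart2, of f a c] unfolding r[OF ring_hom_spec2] unfolding dehom2_def spec2_def[abs_def] .
  show "poly (restrict_line spec1 0 f) c = ev3 f (1, 0, c)"
    using chart.eval[OF chart1, of f 0 c] unfolding r[OF ring_hom_spec1] unfolding dehom1_def spec1_def[abs_def] .
qed

locale base_system =
  fixes s :: "nat \<Rightarrow> 'a::{alg_closed_field, field_char_0} poly poly poly" and d :: nat
  assumes hom: "i \<in> {1,2,3} \<Longrightarrow> hom3 d (s i)"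
    and coprime: "(\<And>i. i \<in> {1,2,3} \<Longrightarrow> q dvd s i) \<Longrightarrow> q dvd 1"
    and at001: "i \<in> {1,2,3} \<Longrightarrow> ev3 (s i) (0, 0, 1) \<noteq> 0"
begin

text \<open>By homogeneity only t3^d survives at (0,0,1), and its coefficient has degree 0 in t1 and
  t2.\<close>

lemma top: "i \<in> {1,2,3} \<Longrightarrow> coeff (s i) d = [:[:ev3 (s i) (0, 0, 1):]:]"
proof -
  assume i: "i \<in> {1,2,3}"
  have "ev3 (s i) (0, 0, 1) = val2 (dehom3 (s i)) 0 0" by (rule chart.eval[OF chart3, symmetric])
  also have "\<dots> = coeff (coeff (dehom3 (s i)) 0) 0" by (simp add: val2_def poly_0_coeff_0)
  also have "\<dots> = coeff (coeff (coeff (s i) d) 0) 0" by (simp add: coeff_dehom3[OF hom[OF i]])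
  finally have "ev3 (s i) (0, 0, 1) = coeff (coeff (coeff (s i) d) 0) 0" .
  moreover have "coeff (coeff (coeff (s i) d) j) k = 0" if "j \<noteq> 0 \<or> k \<noteq> 0" for j k
    using hom[OF i] that unfolding hom3_def by force
  ultimately show ?thesis
    by (intro poly_eqI) (auto simp: coeff_pCons split: nat.split)
qed

lemma degree_le: "i \<in> {1,2,3} \<Longrightarrow> degree (s i) \<le> d"
proof (rule degree_le, intro allI impI)
  fix k assume i: "i \<in> {1,2,3}" and "d < k"
  then have "coeff (coeff (coeff (s i) k) j) m = 0" for j m using hom[OF i] unfolding hom3_def by force
  then show "coeff (s i) k = 0" by (intro poly_eqI) simp
qed

lemma central:
  assumes "\<eta> = spec1 \<or> \<eta> = spec2"
  shows "central_system s d (\<lambda>i. ev3 (s i) (0, 0, 1)) \<eta>"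
proof (rule central_system.intro)
  show "comm_ring_hom \<eta>" using assms ring_hom_spec1 ring_hom_spec2 by blast
  show "\<eta> [:[:c:]:] = [:c:]" for c using assms spec_const by blast
qed (rule degree_le top at001; assumption)+

text \<open>A single transformed form may vanish at (0:0:1) and have lower degree in t3, but the
  generic combination does not: after substituting \<open>Y\<close> it is a fibre, of degree
  \<open>d\<close>, and mapping coefficients cannot raise the degree.\<close>

lemma degree_gen_Lform:
  assumes "det3 l \<noteq> 0" and e: "e = 0 \<or> e = 3"
  shows "degree (gen e (Lform l s)) = d"
proof -
  obtain Y :: "nat \<Rightarrow> 'a FF" where "\<And>p. sub6 embK Y p = 0 \<Longrightarrow> p = 0" and Y0: "\<And>j. j \<in> {1,2,3} \<Longrightarrow> (\<Sum>i\<in>{1,2,3}. Y i * embK (l i j)) = indetF j"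
    "\<And>j. j \<in> {1,2,3} \<Longrightarrow> (\<Sum>i\<in>{1,2,3}. Y (i + 3) * embK (l i j)) = indetF (j + 3)"
    using transformed_indeterminates[OF assms(1)] by blast
  have Y: "(\<Sum>i\<in>{1,2,3}. Y (i + e) * embK (l i j)) = indetF (j + e)" if "j \<in> {1,2,3}" for j
    using e Y0[OF that] by (elim disjE) (simp_all only: add_0_right)
  let ?H = "sub6 (\<lambda>c. map_poly embK (spec2 c)) (\<lambda>k. [:Y k:])"
  have f: "map_poly ?H (gen e (Lform l s)) = fibre spec2 e s"
    by (rule map_fibre[OF ring_hom_spec2 spec_const(1) Y e])
  interpret central_system s d "\<lambda>i. ev3 (s i) (0, 0, 1)" spec2 by (rule central) simp
  have "d \<le> degree (gen e (Lform l s))"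
    using fibre_lead(1)[OF e] degree_map_poly_le[of ?H "gen e (Lform l s)"] unfolding f by simp
  moreover have "degree (gen e (Lform l s)) \<le> d"
  proof (rule degree_gen)
    show "degree (Lform l s i) \<le> d" for i
      unfolding Lform_def by (intro degree_sum_le) (auto intro: order_trans[OF degree_smult_le] degree_le simp del: One_nat_def)
  qed
  ultimately show ?thesis by simp
qed

lemma resultant_fibre:
  assumes l: "det3 l \<noteq> 0" and sp: "\<eta> = spec1 \<or> \<eta> = spec2"
    and Y: "\<And>j. j \<in> {1,2,3} \<Longrightarrow> (\<Sum>i\<in>{1,2,3}. Y i * embK (l i j)) = indetF j"
      "\<And>j. j \<in> {1,2,3} \<Longrightarrow> (\<Sum>i\<in>{1,2,3}. Y (i + 3) * embK (l i j)) = indetF (j + 3)"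
  shows "resultant (fibre \<eta> 0 s) (fibre \<eta> 3 s) =
    sub6 (map_poly embK) (\<lambda>k. [:Y k:]) (map6 \<eta> (resultant (V1L l s) (V2L l s)))"
proof -
  interpret central_system s d "\<lambda>i. ev3 (s i) (0, 0, 1)" \<eta> by (rule central[OF sp])
  let ?h = "\<lambda>c. map_poly embK (\<eta> c)"
  let ?H = "sub6 ?h (\<lambda>k. [:Y k:])"
  have m: "comm_ring_hom (map_poly (embK :: 'a \<Rightarrow> 'a FF))" by (rule ring_hom_map_poly[OF ring_hom_embK])
  have h: "comm_ring_hom ?h" by (rule ring_hom_comp[OF m eta])
  have f0: "map_poly ?H (gen 0 (Lform l s)) = fibre \<eta> 0 s"
    by (rule map_fibre[OF eta eta_const]) (simp_all only: add_0_right Y simp_thms)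
  have f3: "map_poly ?H (gen 3 (Lform l s)) = fibre \<eta> 3 s"
    by (rule map_fibre[OF eta eta_const]) (simp_all only: Y simp_thms)
  have "resultant (map_poly ?H (gen 0 (Lform l s))) (map_poly ?H (gen 3 (Lform l s))) = ?H (resultant (gen 0 (Lform l s)) (gen 3 (Lform l s)))"
    by (rule comm_ring_hom.resultant_map_poly[OF ring_hom_sub6[OF h]])
      (simp_all add: f0 f3 fibre_lead(1) degree_gen_Lform[OF l])
  then show ?thesis unfolding f0 f3 V1L_gen V2L_gen sub6_map6[OF eta m] .
qed

lemma resultant_coeffs_hom2:
  assumes l: "det3 l \<noteq> 0"
  shows "\<exists>n. \<forall>r\<in>coeffs6 (resultant (V1L l s) (V2L l s)). hom2 n r"
  unfolding V1L_gen V2L_gen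
proof (rule resultant_hom2)
  show "hom3 d (Lform l s i)" for i
    unfolding Lform_def by (intro hom3_sum hom3_smult hom)
qed (simp_all add: degree_gen_Lform[OF l])

text \<open>For the identity matrix the resultant is nonzero by coprimality of the
  \<open>s i\<close>. If it vanished after dehomogenizing, \<open>order_transfer\<close> would make
  every power of the variable divide \<eta> of each coefficient, yet a nonzero form stays nonzero
  under \<eta>.\<close>

lemma resultant_fibre_nonzero:
  assumes sp: "\<eta> = spec1 \<or> \<eta> = spec2"
  shows "resultant (fibre \<eta> 0 s) (fibre \<eta> 3 s) \<noteq> 0"
proof
  assume res: "resultant (fibre \<eta> 0 s) (fibre \<eta> 3 s) = 0"
  define l :: "nat \<Rightarrow> nat \<Rightarrow> 'a" where "l = (\<lambda>i j. if i = j then 1 else 0)"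
  have l: "det3 l \<noteq> 0" by (simp add: l_def det3_def)
  have L: "Lform l s i = s i" if "i \<in> {1,2,3}" for i
    using that unfolding Lform_def l_def by (auto simp: pCons_one)
  let ?R = "resultant (V1L l s) (V2L l s)"
  have gen: "gen e (Lform l s) = gen e s" for e
    unfolding gen_def by (rule sum.cong[OF refl]) (simp only: L)
  have cc: "comm_ring_hom (\<lambda>c :: 'a. [:[:c:]:])" by (intro ring_hom_comp[OF ring_hom_const] ring_hom_const)
  have "?R \<noteq> 0"
    unfolding V1L_gen V2L_gen gen
  proof (rule gen_resultant_nonzero_coprime[OF cc degree_le top])
    show "ev3 (s 1) (0, 0, 1) \<noteq> 0" by (rule at001) simp
    show "\<not> (\<forall>i\<in>{1,2,3}. q dvd s i)" if "irreducible q" for q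
      using coprime[of q] irreducible_not_unit[OF that] by blast
  qed
  then obtain r where r: "r \<in> coeffs6 ?R" "r \<noteq> 0" using coeffs6_nonzero by blast
  obtain n where "hom2 n r" using resultant_coeffs_hom2[OF l] r(1) by blast
  then have "\<eta> r \<noteq> 0" using hom2_nonzero[OF _ r(2)] sp by auto
  obtain Y :: "nat \<Rightarrow> 'a FF" where Y: "\<And>p. sub6 embK Y p = 0 \<Longrightarrow> p = 0"
    "\<And>j. j \<in> {1,2,3} \<Longrightarrow> (\<Sum>i\<in>{1,2,3}. Y i * embK (l i j)) = indetF j"
    "\<And>j. j \<in> {1,2,3} \<Longrightarrow> (\<Sum>i\<in>{1,2,3}. Y (i + 3) * embK (l i j)) = indetF (j + 3)"
    using transformed_indeterminates[OF l] by blast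
  have e0: "\<eta> 0 = 0" using sp ring_hom_0[OF ring_hom_spec1] ring_hom_0[OF ring_hom_spec2] by metis
  have "[:- 0, 1:] ^ Suc (degree (\<eta> r)) dvd \<eta> r"
  proof -
    have "(\<forall>r\<in>coeffs6 (map6 \<eta> ?R). [:- 0, 1:] ^ m dvd r) \<longleftrightarrow>
        [:- embK 0, 1:] ^ m dvd sub6 (map_poly embK) (\<lambda>k. [:Y k:]) (map6 \<eta> ?R)" for m
      by (rule order_transfer[OF ring_hom_embK]) (rule Y(1))
    moreover have "sub6 (map_poly embK) (\<lambda>k. [:Y k:]) (map6 \<eta> ?R) = resultant (fibre \<eta> 0 s) (fibre \<eta> 3 s)"
      by (rule resultant_fibre[OF l sp, symmetric]) (rule Y(2,3), assumption)+
    ultimately have all: "\<forall>x\<in>coeffs6 (map6 \<eta> ?R). [:- 0, 1:] ^ Suc (degree (\<eta> r)) dvd x"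
      unfolding res by (simp only: dvd_0_right simp_thms)
    show ?thesis
      by (rule bspec[OF all]) (unfold coeffs6_map6[of \<eta>, OF e0], rule imageI, rule r(1))
  qed
  then have "Suc (degree (\<eta> r)) \<le> degree (\<eta> r)"
    using dvd_imp_degree_le[OF _ \<open>\<eta> r \<noteq> 0\<close>] by (metis degree_linear_power)
  then show False by simp
qed

definition line_mult :: "('a poly poly \<Rightarrow> 'a poly) \<Rightarrow> 'a \<Rightarrow> nat" where
  "line_mult \<eta> a = order (embK a) (resultant (fibre \<eta> 0 s) (fibre \<eta> 3 s))"

text \<open>The bound on the right does not mention \<open>l\<close>, so the orders that determine
  the content are the same for every transformation.\<close>

lemma line_mult_iff:
  assumes l: "det3 l \<noteq> 0" and sp: "\<eta> = spec1 \<or> \<eta> = spec2"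
  shows "(\<forall>r\<in>coeffs6 (resultant (V1L l s) (V2L l s)). [:-a, 1:] ^ k dvd \<eta> r) \<longleftrightarrow> k \<le> line_mult \<eta> a"
proof -
  obtain Y :: "nat \<Rightarrow> 'a FF" where Y: "\<And>p. sub6 embK Y p = 0 \<Longrightarrow> p = 0"
    "\<And>j. j \<in> {1,2,3} \<Longrightarrow> (\<Sum>i\<in>{1,2,3}. Y i * embK (l i j)) = indetF j"
    "\<And>j. j \<in> {1,2,3} \<Longrightarrow> (\<Sum>i\<in>{1,2,3}. Y (i + 3) * embK (l i j)) = indetF (j + 3)"
    using transformed_indeterminates[OF l] by blast
  have e0: "\<eta> 0 = 0" using sp ring_hom_0[OF ring_hom_spec1] ring_hom_0[OF ring_hom_spec2] by metis
  have "(\<forall>r\<in>coeffs6 (map6 \<eta> (resultant (V1L l s) (V2L l s))). [:-a, 1:] ^ k dvd r) \<longleftrightarrow>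
    [:- embK a, 1:] ^ k dvd resultant (fibre \<eta> 0 s) (fibre \<eta> 3 s)"
  proof -
    have "sub6 (map_poly embK) (\<lambda>k. [:Y k:]) (map6 \<eta> (resultant (V1L l s) (V2L l s))) =
        resultant (fibre \<eta> 0 s) (fibre \<eta> 3 s)"
      by (rule resultant_fibre[OF l sp, symmetric]) (rule Y(2,3), assumption)+
    then show ?thesis by (rule subst) (rule order_transfer[OF ring_hom_embK], rule Y(1))
  qed
  then show ?thesis
    unfolding coeffs6_map6[of \<eta>, OF e0] line_mult_def order_divides
    using resultant_fibre_nonzero[OF sp] by simp
qed

lemma tdeg2_content:
  assumes l: "det3 l \<noteq> 0"
  shows "finite {a. line_mult spec2 a \<noteq> 0}"
    "tdeg2 (content_xy (resultant (V1L l s) (V2L l s))) = line_mult spec1 0 + (\<Sum>a\<in>{a. line_mult spec2 a \<noteq> 0}. line_mult spec2 a)"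
proof -
  let ?C = "coeffs6 (resultant (V1L l s) (V2L l s))"
  obtain n where n: "\<And>r. r \<in> ?C \<Longrightarrow> hom2 n r" using resultant_coeffs_hom2[OF l] by blast
  have "\<exists>r\<in>?C. r \<noteq> 0"
  proof (rule ccontr)
    assume "\<not> (\<exists>r\<in>?C. r \<noteq> 0)"
    \<comment> \<open>Zero is divisible by every power, whereas the common order at a line is
      finite.\<close>
    then have "\<forall>r\<in>?C. [:- 0, 1:] ^ Suc (line_mult spec2 0) dvd spec2 r"
      using ring_hom_0[OF ring_hom_spec2] by (metis dvd_0_right)
    then show False using line_mult_iff[OF l, of spec2 0 "Suc (line_mult spec2 0)"] by simp
  qed
  then obtain r0 where r0: "r0 \<in> ?C" "r0 \<noteq> 0" by blast
  have iff: "(\<forall>r\<in>?C. [:-a, 1:] ^ k dvd spec2 r) \<longleftrightarrow> k \<le> line_mult spec2 a"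
    "(\<forall>r\<in>?C. [:-0, 1:] ^ k dvd spec1 r) \<longleftrightarrow> k \<le> line_mult spec1 0" for a k
    by (rule line_mult_iff[OF l], simp)+
  show "finite {a. line_mult spec2 a \<noteq> 0}"
    by (rule tdeg2_gcd(1)[of ?C n r0]) (rule n r0 iff, assumption?)+
  show "tdeg2 (content_xy (resultant (V1L l s) (V2L l s))) = line_mult spec1 0 + (\<Sum>a\<in>{a. line_mult spec2 a \<noteq> 0}. line_mult spec2 a)"
    unfolding content_xy_def by (rule tdeg2_gcd(2)[of ?C n r0]) (rule n r0 iff, assumption?)+
qed

lemma line_points_sum:
  assumes sp: "\<eta> = spec1 \<or> \<eta> = spec2"
  shows "finite (line_points \<eta> s a)"
    "(\<Sum>c\<in>line_points \<eta> s a. aff_imult (fibre \<eta> 0 s) (fibre \<eta> 3 s) (embK a) (embK c)) = enat (line_mult \<eta> a)"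
    "line_points \<eta> s a \<noteq> {} \<Longrightarrow> line_mult \<eta> a \<noteq> 0"
proof -
  interpret central_system s d "\<lambda>i. ev3 (s i) (0, 0, 1)" \<eta> by (rule central[OF sp])
  show fin: "finite (line_points \<eta> s a)" by (rule finite_line_points)
  show sum: "(\<Sum>c\<in>line_points \<eta> s a. aff_imult (fibre \<eta> 0 s) (fibre \<eta> 3 s) (embK a) (embK c)) = enat (line_mult \<eta> a)"
    unfolding line_mult_def by (rule sum_aff_imult_line[OF resultant_fibre_nonzero[OF sp]])
  show "line_mult \<eta> a \<noteq> 0" if ne: "line_points \<eta> s a \<noteq> {}"
  proof
    assume "line_mult \<eta> a = 0"
    then have "(\<Sum>c\<in>line_points \<eta> s a. aff_imult (fibre \<eta> 0 s) (fibre \<eta> 3 s) (embK a) (embK c)) = 0"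
      using sum by (simp add: zero_enat_def)
    then have "\<forall>c\<in>line_points \<eta> s a. aff_imult (fibre \<eta> 0 s) (fibre \<eta> 3 s) (embK a) (embK c) = 0"
      using fin by (simp add: sum_eq_0_iff)
    then show False using ne aff_imult_line_pos by blast
  qed
qed

text \<open>Normalized coordinates of the base points, sorted by lines through the centre: t2 = 1,
  or t2 = 0 and t1 = 1. Among the former only lines of positive order are listed, which makes the
  index set finite; the others carry no base points.\<close>

definition base_reps :: "('a \<times> 'a \<times> 'a) set" where
  "base_reps = (\<lambda>(a, c). (a, 1, c)) ` (SIGMA a:{a. line_mult spec2 a \<noteq> 0}. line_points spec2 s a) \<union> (\<lambda>c. (1, 0, c)) ` line_points spec1 s 0"

lemma pclass_mem: "x \<in> pclass (b1, b2, b3) \<longleftrightarrow> (\<exists>c. c \<noteq> 0 \<and> x = (c * b1, c * b2, c * b3))"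
  unfolding pclass_def by auto

lemma pclass_scale: "t \<noteq> 0 \<Longrightarrow> pclass (t * b1, t * b2, t * b3) = pclass (b1, b2, b3 :: 'a)"
proof (rule Set.set_eqI)
  fix x assume t: "t \<noteq> 0"
  have 1: "\<exists>c. c \<noteq> 0 \<and> x = (c * b1, c * b2, c * b3)" if "c \<noteq> 0" "x = (c * (t * b1), c * (t * b2), c * (t * b3))" for c
    using that t by (intro exI[of _ "c * t"]) simp
  have 2: "\<exists>c. c \<noteq> 0 \<and> x = (c * (t * b1), c * (t * b2), c * (t * b3))" if "c \<noteq> 0" "x = (c * b1, c * b2, c * b3)" for c
    using that t by (intro exI[of _ "c / t"]) simp
  show "x \<in> pclass (t * b1, t * b2, t * b3) \<longleftrightarrow> x \<in> pclass (b1, b2, b3)"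
    unfolding pclass_mem using 1 2 by blast
qed

lemma base_points_eq: "base_points s = pclass ` base_reps"
proof (rule subset_antisym; rule subsetI)
  fix A assume "A \<in> base_points s"
  then obtain b1 b2 b3 where A: "A = pclass (b1, b2, b3)" and b: "(b1, b2, b3) \<noteq> (0, 0, 0)"
    and z: "\<forall>i\<in>{1,2,3}. ev3 (s i) (b1, b2, b3) = 0" unfolding base_points_def by auto
  have z': "ev3 (s i) (t * b1, t * b2, t * b3) = 0" if "i \<in> {1,2,3}" for i t
    using z that ev3_scale[OF hom[OF that]] by auto
  consider "b2 \<noteq> 0" | "b2 = 0" "b1 \<noteq> 0" | "b2 = 0" "b1 = 0" "b3 \<noteq> 0" using b by auto
  then show "A \<in> pclass ` base_reps"
  proof cases
    case 1
    have "A = pclass (b1 / b2, 1, b3 / b2)" unfolding A using pclass_scale[of "inverse b2" b1 b2 b3] 1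
      by (simp add: field_simps)
    moreover have "b3 / b2 \<in> line_points spec2 s (b1 / b2)"
      unfolding line_points_def mem_Collect_eq ev3_line
    proof
      fix i :: nat assume "i \<in> {1,2,3}"
      then show "ev3 (s i) (b1 / b2, 1, b3 / b2) = 0" using z'[of i "inverse b2"] 1 by (simp add: field_simps)
    qed
    moreover from this have "(b1 / b2, 1, b3 / b2) \<in> base_reps"
      using line_points_sum(3)[of spec2 "b1 / b2"] unfolding base_reps_def
      by (intro UnI1 image_eqI[of _ _ "(b1 / b2, b3 / b2)"]) auto
    ultimately show ?thesis by blast
  next
    case 2
    have "A = pclass (1, 0, b3 / b1)" unfolding A using pclass_scale[of "inverse b1" b1 b2 b3] 2
      by (simp add: field_simps)
    moreover have "b3 / b1 \<in> line_points spec1 s 0"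
      unfolding line_points_def mem_Collect_eq ev3_line
    proof
      fix i :: nat assume "i \<in> {1,2,3}"
      then show "ev3 (s i) (1, 0, b3 / b1) = 0" using z'[of i "inverse b1"] 2 by (simp add: field_simps)
    qed
    ultimately show ?thesis unfolding base_reps_def by (intro image_eqI) auto
  next
    case 3
    \<comment> \<open>The only point left is the centre of projection, which \<open>at001\<close>
      excludes.\<close>
    then show ?thesis using z'[of 1 "inverse b3"] at001[of 1] by simp
  qed
next
  fix A assume "A \<in> pclass ` base_reps"
  then obtain x where x: "x \<in> base_reps" "A = pclass x" by blast
  have "x \<noteq> (0, 0, 0) \<and> (\<forall>i\<in>{1,2,3}. ev3 (s i) x = 0)"
    using x(1) unfolding base_reps_def by (auto simp: line_points_def ev3_line)
  then show "A \<in> base_points s" unfolding base_points_def x(2) by blast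
qed

lemma inj_pclass: "inj_on pclass base_reps"
proof (rule inj_onI)
  fix x y assume "x \<in> base_reps" "y \<in> base_reps" "pclass x = pclass y"
  moreover obtain x1 x2 x3 y1 y2 y3 where xy: "x = (x1, x2, x3)" "y = (y1, y2, y3)" by (cases x, cases y) auto
  have "x \<in> pclass x" unfolding xy pclass_mem by (intro exI[of _ 1]) simp
  ultimately have "x \<in> pclass y" by simp
  then obtain t where t: "t \<noteq> 0" "x1 = t * y1" "x2 = t * y2" "x3 = t * y3" unfolding xy pclass_mem by auto
  have "(x2 = 1 \<or> x1 = 1 \<and> x2 = 0) \<and> (y2 = 1 \<or> y1 = 1 \<and> y2 = 0)"
    using \<open>x \<in> base_reps\<close> \<open>y \<in> base_reps\<close> unfolding xy base_reps_def by auto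
  then have "t = 1" using t by auto
  then show "x = y" using t unfolding xy by simp
qed

text \<open>The choice operator may pick any representative of the class; passing to
  \<open>hmult\<close> makes the scaling factor harmless.\<close>

lemma proj_imult_rep:
  assumes "(b1, b2, b3) \<noteq> (0, 0, 0)"
  shows "proj_imult (V1F s) (V2F s) (embK3 (SOME a. a \<in> pclass (b1, b2, b3))) = hmult (VF 0 s) (VF 3 s) (embK b1, embK b2, embK b3)"
proof -
  interpret e: comm_ring_hom "embK :: 'a \<Rightarrow> 'a FF" by (rule ring_hom_embK)
  have "(b1, b2, b3) \<in> pclass (b1, b2, b3)" unfolding pclass_mem by (intro exI[of _ 1]) simp
  then have "(SOME a. a \<in> pclass (b1, b2, b3)) \<in> pclass (b1, b2, b3)" by (rule someI)
  then obtain t where t: "t \<noteq> 0" "(SOME a. a \<in> pclass (b1, b2, b3)) = (t * b1, t * b2, t * b3)"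
    unfolding pclass_mem by blast
  have "proj_imult (V1F s) (V2F s) (embK3 (SOME a. a \<in> pclass (b1, b2, b3))) =
      hmult (VF 0 s) (VF 3 s) (embK t * embK b1, embK t * embK b2, embK t * embK b3)"
    unfolding t(2) embK3_def prod.case V1F_VF V2F_VF e.hom_mult
    by (rule proj_imult_eq_hmult[OF hom3_VF[OF hom] hom3_VF[OF hom]]) (use assms t(1) in \<open>simp_all add: embK_eq_0\<close>)
  also have "\<dots> = hmult (VF 0 s) (VF 3 s) (embK b1, embK b2, embK b3)"
    by (rule hmult_scale) (simp add: embK_eq_0 t(1))
  finally show ?thesis .
qed

lemma hmult_line:
  "hmult (VF 0 s) (VF 3 s) (embK a, embK 1, embK c) = aff_imult (fibre spec2 0 s) (fibre spec2 3 s) (embK a) (embK c)"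
  "hmult (VF 0 s) (VF 3 s) (embK 1, embK 0, embK c) = aff_imult (fibre spec1 0 s) (fibre spec1 3 s) (embK 0) (embK c)"
  unfolding dehom_VF[symmetric] ring_hom_1[OF ring_hom_embK]
  by (rule chart.aff_imult_eq_hmult[OF chart2 hom3_VF[OF hom] hom3_VF[OF hom], symmetric]
      chart.aff_imult_eq_hmult[OF chart1 hom3_VF[OF hom] hom3_VF[OF hom], symmetric]; assumption)+

lemma enat_sum: "(\<Sum>x\<in>A. enat (f x)) = enat (sum f A)"
  by (induction A rule: infinite_finite_induct) (auto simp: zero_enat_def)

lemma mult_base_eq:
  assumes l: "det3 l \<noteq> 0"
  shows "mult_base s = enat (tdeg2 (content_xy (resultant (V1L l s) (V2L l s))))"
proof -
  let ?A = "{a. line_mult spec2 a \<noteq> 0}"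
  let ?g = "\<lambda>x. proj_imult (V1F s) (V2F s) (embK3 (SOME a. a \<in> pclass x))"
  let ?S = "SIGMA a:?A. line_points spec2 s a"
  note finA = tdeg2_content(1)[OF l]
  have fin2: "finite ?S" using finA line_points_sum(1)[of spec2] by auto
  have fin1: "finite (line_points spec1 s 0)" by (rule line_points_sum(1)) simp
  have "mult_base s = (\<Sum>x\<in>base_reps. ?g x)"
    unfolding mult_base_def base_points_eq by (subst sum.reindex[OF inj_pclass]) simp
  also have "\<dots> = (\<Sum>x\<in>(\<lambda>(a, c). (a, 1, c)) ` ?S. ?g x) + (\<Sum>x\<in>(\<lambda>c. (1, 0, c)) ` line_points spec1 s 0. ?g x)"
    unfolding base_reps_def by (rule sum.union_disjoint) (use fin1 fin2 in auto)
  also have "(\<Sum>x\<in>(\<lambda>(a, c). (a, 1, c)) ` ?S. ?g x) = (\<Sum>(a, c)\<in>?S. aff_imult (fibre spec2 0 s) (fibre spec2 3 s) (embK a) (embK c))"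
    by (subst sum.reindex) (auto simp: inj_on_def proj_imult_rep hmult_line(1) intro!: sum.cong)
  also have "\<dots> = (\<Sum>a\<in>?A. \<Sum>c\<in>line_points spec2 s a. aff_imult (fibre spec2 0 s) (fibre spec2 3 s) (embK a) (embK c))"
    by (rule sum.Sigma[symmetric]) (use finA line_points_sum(1)[of spec2] in auto)
  also have "\<dots> = (\<Sum>a\<in>?A. enat (line_mult spec2 a))"
    by (rule sum.cong[OF refl]) (rule line_points_sum(2), simp)
  also have "(\<Sum>x\<in>(\<lambda>c. (1, 0, c)) ` line_points spec1 s 0. ?g x) = (\<Sum>c\<in>line_points spec1 s 0. aff_imult (fibre spec1 0 s) (fibre spec1 3 s) (embK 0) (embK c))"
    by (subst sum.reindex) (auto simp: inj_on_def proj_imult_rep hmult_line(2) intro!: sum.cong)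
  also have "\<dots> = enat (line_mult spec1 0)"
    by (rule line_points_sum(2)) simp
  finally show ?thesis unfolding tdeg2_content(2)[OF l] enat_sum by (simp add: add.commute)
qed

end

theorem theorem3p3:
  fixes s :: "nat \<Rightarrow> 'a::{alg_closed_field, field_char_0} poly poly poly"
    and d :: nat
    and l :: "nat \<Rightarrow> nat \<Rightarrow> 'a"
  assumes hom: "\<forall>i\<in>{1,2,3}. hom3 d (s i)"
    and coprime: "\<forall>q. (\<forall>i\<in>{1,2,3}. q dvd s i) \<longrightarrow> is_unit q"
    and at001: "\<forall>i\<in>{1,2,3}. ev3 (s i) (0, 0, 1) \<noteq> 0"
    and dom: "dominant3 s"
    and L: "det3 l \<noteq> 0"
  shows "mult_base s = enat (tdeg2 (content_xy (resultant (V1L l s) (V2L l s))))"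
proof -
  interpret base_system s d
    by unfold_locales (use hom coprime at001 in blast)+
  show ?thesis by (rule mult_base_eq[OF L])
qed

end
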